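(* Let $k$ be a positive integer, let $(\mathscr F_n)_{n\ge1}$ be an interval filtration on $[0,1]$ with $\gamma:=\sup_n\gamma_k(\mathscr F_n)<\infty$, and let $P_n$ be the orthogonal projection onto $\mathscr S_k(\mathscr F_n)$. Let $(f_n)_{n\ge1}$ be a sequence of functions with $f_n\in\mathscr S_k(\mathscr F_n)$ for each $n$, and let $h_n\in L_1[0,1]$, $n\ge 1$, be arbitrary. Then, for any $N\ge 1$, $$\sum_{n=1}^N \mathbb E\big[|f_n\cdot h_n|\big]\le C\ \mathbb E\Big[\Big(\sum_{\ell=1}^N f_\ell^2\Big)^{1/2}\Big]\cdot\sup_{1\le n\le N}\Big\|P_n\Big(\sum_{\ell=n}^N h_\ell^2\Big)\Big\|_\infty^{1/2},$$ where the constant $C$ depends only on $k$ and $\gamma$.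
   Context: $\mathbb E[f]=\int_0^1 f(t)\,dt$, and $|\cdot|$ is Lebesgue measure on $[0,1]$. An interval $\sigma$-algebra on $[0,1]$ is a $\sigma$-algebra $\mathscr F$ generated by a finite partition of $[0,1]$ into intervals of positive length (the atoms of $\mathscr F$). An interval filtration is an increasing sequence of interval $\sigma$-algebras. For a positive integer $k$, $\mathscr S_k(\mathscr F)=\{f\in C^{k-2}[0,1]: f \text{ is a polynomial of order } k \text{ (degree at most } k-1) \text{ on each atom of } \mathscr F\}$ (for $k=1$: functions constant on each atom). The orthogonal projection onto $\mathscr S_k(\mathscr F)$ is with respect to the $L_2$ inner product on $[0,1]$; it extends to $L_1$ since $\mathscr S_k(\mathscr F)$ is a finite-dimensional space of bounded functions. If $\sum_{\ell=n}^N h_\ell^2$ is not integrable for some $n\le N$, the supremum on the right-hand side is read as $+\infty$ (and the inequality is trivial, with the right-hand side read as $0$ if all $f_\ell$, $\ell\le N$, vanish). The B-spline basis $(N_i)$ of $\mathscr S_k(\mathscr F)$ is the standard one (normalized to be a non-negative partition of unity, interior breakpoints simple knots, endpoints $0,1$ knots of multiplicity $k$); each support $E_i=\operatorname{supp} N_i$ is an interval consisting of at most $k$ neighboring atoms, ordered so that $\inf E_i\le\inf E_{i+1}$ and $\sup E_i\le \sup E_{i+1}$. The $k$-regularity parameter is $$\gamma_k(\mathscr F)=\max_i \max\big(|E_i|/|E_{i+1}|,\ |E_{i+1}|/|E_i|\big),$$ the first maximum over all $i$ for which $E_i,E_{i+1}$ are both defined (set to $1$ if there is no such $i$). *)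

theory Defs
  imports
    "HOL-Analysis.Analysis"
    "HOL-Computational_Algebra.Polynomial"
    "HOL-Library.Disjoint_Sets"
    "HOL-Probability.Essential_Supremum"
begin

section \<open>Interval \<open>\<sigma>\<close>-algebras and filtrations\<close>

definition interval_sigma_algebra :: "real set set \<Rightarrow> bool" where
  "interval_sigma_algebra \<F> \<longleftrightarrow>
     (\<exists>P. finite P \<and> partition_on {0..1} P \<and>
          (\<forall>A\<in>P. is_interval A \<and> 0 < measure lebesgue A) \<and>
          \<F> = sigma_sets {0..1} P)"

text \<open>The atoms are the minimal non-empty members; if \<open>\<F>\<close> is generated by a finite partition
  of \<open>{0..1}\<close>, they are exactly the sets of that partition.\<close>

definition atoms :: "real set set \<Rightarrow> real set set" where
  "atoms \<F> = {A\<in>\<F>. A \<noteq> {} \<and> (\<forall>B\<in>\<F>. B \<subseteq> A \<longrightarrow> B = {} \<or> B = A)}"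

definition interval_filtration :: "(nat \<Rightarrow> real set set) \<Rightarrow> bool" where
  "interval_filtration \<F> \<longleftrightarrow> (\<forall>n\<ge>1. interval_sigma_algebra (\<F> n)) \<and> mono_on {1..} \<F>"


section \<open>Spline spaces and orthogonal projections\<close>

text \<open>\<open>C_on m S f\<close>: \<open>f\<close> is of class \<open>C\<close> of order \<open>m\<close> on \<open>S\<close>. Derivatives are taken within \<open>S\<close>,
  hence are one-sided at the endpoints of a compact interval.\<close>

primrec C_on :: "nat \<Rightarrow> real set \<Rightarrow> (real \<Rightarrow> real) \<Rightarrow> bool" where
  "C_on 0 S f \<longleftrightarrow> continuous_on S f"
| "C_on (Suc m) S f \<longleftrightarrow>
     (\<exists>f'. (\<forall>x\<in>S. (f has_real_derivative f' x) (at x within S)) \<and> C_on m S f')"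

text \<open>There is no smoothness requirement for \<open>k = 1\<close>. The values of a spline outside \<open>{0..1}\<close>
  are irrelevant and left unconstrained.\<close>

definition spline_space :: "nat \<Rightarrow> real set set \<Rightarrow> (real \<Rightarrow> real) set" where
  "spline_space k \<F> =
     {f. (2 \<le> k \<longrightarrow> C_on (k - 2) {0..1} f) \<and>
         (\<forall>A\<in>atoms \<F>. \<exists>p. degree p \<le> k - 1 \<and> (\<forall>x\<in>A. f x = poly p x))}"

text \<open>The orthogonality relations make sense for every integrable \<open>h\<close>, since splines are bounded
  on \<open>{0..1}\<close>; they determine the projection uniquely on \<open>{0..1}\<close>.\<close>

definition spline_proj :: "nat \<Rightarrow> real set set \<Rightarrow> (real \<Rightarrow> real) \<Rightarrow> real \<Rightarrow> real" where
  "spline_proj k \<F> h =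
     (SOME s. s \<in> spline_space k \<F> \<and>
        (\<forall>g\<in>spline_space k \<F>. (\<integral>x. (h x - s x) * g x \<partial>lebesgue_on {0..1}) = 0))"


section \<open>B-splines and the regularity parameter\<close>

definition breakpoints :: "real set set \<Rightarrow> real list" where
  "breakpoints \<F> = sorted_list_of_set (Inf ` atoms \<F> \<union> Sup ` atoms \<F>)"

text \<open>\<open>0\<close> and \<open>1\<close> already occur once among the breakpoints, so they get multiplicity \<open>k\<close>.\<close>

definition knots :: "nat \<Rightarrow> real set set \<Rightarrow> real list" where
  "knots k \<F> = replicate (k - 1) 0 @ breakpoints \<F> @ replicate (k - 1) 1"

text \<open>The Cox--de Boor recursion for the B-splines of degree \<open>d\<close> over the knot sequence \<open>t\<close>,
  where a quotient with denominator \<open>0\<close> is \<open>0\<close>. It starts from the indicator functions of the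
  atoms themselves rather than of half-open intervals, so that degree \<open>0\<close> yields functions
  that are constant on each atom whichever endpoints the atoms contain. If \<open>t ! i = t ! (i + 1)\<close>,
  the function of degree \<open>0\<close> vanishes.\<close>

primrec bspline_deg :: "real set set \<Rightarrow> real list \<Rightarrow> nat \<Rightarrow> nat \<Rightarrow> real \<Rightarrow> real" where
  "bspline_deg \<F> t 0 i x =
     indicator (\<Union>{A\<in>atoms \<F>. Inf A = t ! i \<and> Sup A = t ! (i + 1)}) x"
| "bspline_deg \<F> t (Suc d) i x =
     (x - t ! i) / (t ! (i + d + 1) - t ! i) * bspline_deg \<F> t d i x +
     (t ! (i + d + 2) - x) / (t ! (i + d + 2) - t ! (i + 1)) * bspline_deg \<F> t d (i + 1) x"

definition bspline :: "nat \<Rightarrow> real set set \<Rightarrow> nat \<Rightarrow> real \<Rightarrow> real" where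
  "bspline k \<F> i = bspline_deg \<F> (knots k \<F>) (k - 1) i"

text \<open>The B-splines of order \<open>k\<close> are \<open>bspline k \<F> i\<close> for \<open>i < num_bsplines k \<F>\<close>.\<close>

definition num_bsplines :: "nat \<Rightarrow> real set set \<Rightarrow> nat" where
  "num_bsplines k \<F> = length (knots k \<F>) - k"

definition bspline_supp :: "nat \<Rightarrow> real set set \<Rightarrow> nat \<Rightarrow> real set" where
  "bspline_supp k \<F> i = closure {x\<in>{0..1}. bspline k \<F> i x \<noteq> 0}"

text \<open>Each of the maxima of two reciprocal ratios is at least \<open>1\<close>, so inserting \<open>1\<close> only matters if
  there is a single B-spline.\<close>

definition regularity :: "nat \<Rightarrow> real set set \<Rightarrow> real" where
  "regularity k \<F> =
     Max (insert 1
       ((\<lambda>i. max (measure lebesgue (bspline_supp k \<F> i) / measure lebesgue (bspline_supp k \<F> (i + 1)))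
                 (measure lebesgue (bspline_supp k \<F> (i + 1)) / measure lebesgue (bspline_supp k \<F> i)))
        ` {i. i + 1 < num_bsplines k \<F>}))"


section \<open>Norms with values in \<open>[0, \<infinity>]\<close>\<close>

definition Linf_norm :: "(real \<Rightarrow> real) \<Rightarrow> ennreal" where
  "Linf_norm g = esssup (lebesgue_on {0..1}) (\<lambda>x. ennreal \<bar>g x\<bar>)"

definition ennreal_sqrt :: "ennreal \<Rightarrow> ennreal" where
  "ennreal_sqrt c = (if c = \<infinity> then \<infinity> else ennreal (sqrt (enn2real c)))"

text \<open>The supremum norm of the projection of \<open>h\<close>, read as \<open>\<infinity>\<close> if \<open>h\<close> is not in \<open>L\<^sub>1\<close>.\<close>

definition spline_proj_norm :: "nat \<Rightarrow> real set set \<Rightarrow> (real \<Rightarrow> real) \<Rightarrow> ennreal" where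
  "spline_proj_norm k \<F> h =
     (if integrable (lebesgue_on {0..1}) h then Linf_norm (spline_proj k \<F> h) else \<infinity>)"

end

theory Submission
  imports Defs "HOL-Library.Function_Algebras"
begin

text \<open>Put \<open>d = k - 1\<close>, \<open>X n = sqrt (\<Sum>l\<le>n. f l ^ 2)\<close> and \<open>H n = (\<Sum>l=n..N. h l ^ 2)\<close>, and call the open
  supports of the B-splines of level \<open>n\<close> the tiles of level \<open>n\<close>. The theorem holds because splines
  behave, on the scale of tiles, like functions that are constant on atoms, and because tiles
  of different levels, although they are not nested, can be packed almost as well as nested
  intervals. Let \<open>M\<close> bound all the projections of \<open>H n\<close>.

  Stability. On an atom, a spline is dominated by the sum of the moduli of the coefficients \<open>a\<close>
  of those B-splines whose tile \<open>E\<close> contains the atom (\<open>poly_bound_bcoef\<close>). Such a coefficient can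
  be computed from the polynomial piece on any single atom inside \<open>E\<close>: it is the apolar pairing
  of that piece with the product of the factors \<open>\<tau> - y\<close> over the interior knots \<open>\<tau>\<close> of \<open>E\<close>, and
  passing from one atom of \<open>E\<close> to the next adds to the piece a multiple of \<open>(x - \<tau>)^d\<close>, which pairs to
  zero (\<open>bcoef_eq_on_support\<close>). Interpolation on an atom that makes up at least the
  fraction \<open>1 / k\<close> of \<open>E\<close> therefore yields a set \<open>G \<subseteq> E\<close> whose measure is comparable to that of \<open>E\<close> and on which \<open>a \<le> C * \<bar>f n\<bar>\<close>
  (\<open>bcoef_good_set\<close>). An atom may be much shorter than the tiles that contain it, which is why tiles,
  not atoms, carry the argument.

  Carleson condition. For a non-negative spline \<open>g\<close> of level \<open>n\<close> the integral of \<open>H n * g\<close> equals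
  that of the projection of \<open>H n\<close> times \<open>g\<close>, hence is at most \<open>M\<close> times the integral of \<open>g\<close>. A
  difference of two step splines is such a \<open>g\<close> that equals \<open>1\<close> on the tile \<open>E\<close> and
  vanishes away from neighbouring tiles, and regularity makes these comparable to \<open>E\<close>. So the
  integral of \<open>H n\<close> over \<open>E\<close> is at most \<open>C * M * \<bar>E\<bar>\<close> (\<open>support_carleson_bound\<close>).

  Packing. In a finite family of tiles call a tile fresh if the tiles of lower levels in
  the family do not cover it. Breakpoints of one level are breakpoints of all
  later levels, and a tile has at most \<open>d\<close> breakpoints in its interior; hence only boundedly many
  fresh tiles contain a given point (\<open>fresh_overlap\<close>). If every tile of the family meets
  a set \<open>S\<close> in a fixed proportion, the Carleson condition, applied to the fresh tiles only, bounds
  the sum of the integrals of \<open>h n ^ 2\<close> over all tiles by \<open>C * M * \<bar>S\<bar>\<close> (\<open>carleson_packing\<close>).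

  Conclusion (\<open>tile_square_function_inequality\<close>). For a tile of level \<open>n\<close> with coefficient \<open>a\<close> let
  \<open>1 / s\<close> be the harmonic mean of \<open>X n\<close> over \<open>G\<close>, and split
  \<open>a * \<bar>h n\<bar> \<le> (sqrt M * a^2 * s + h n ^ 2 / (sqrt M * s)) / 2\<close>. Since \<open>a^2 * s * \<bar>E\<bar>\<close> is at most a
  constant times the integral of \<open>f n ^ 2 / X n\<close> over \<open>G\<close>, and \<open>f n ^ 2 / X n \<le> 2 * (X n - X (n - 1))\<close>, the
  first terms add up to at most a constant times the integral of \<open>X N\<close>. A tile with \<open>1 / s > \<theta>\<close>
  has at least half of its \<open>G\<close> in \<open>{X N > \<theta> / 2}\<close>, so packing bounds the integrals of \<open>h n ^ 2\<close> over these
  tiles by \<open>C * M * \<bar>{X N > \<theta> / 2}\<bar>\<close>; integration over \<open>\<theta>\<close> bounds the second terms.\<close>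

section \<open>The apolar pairing of polynomials\<close>

lemma higher_pderiv_linear_mult:
  fixes q Q :: "real poly"
  assumes "pderiv q = [:e:]"
  shows "(pderiv ^^ n) (q * Q) = q * (pderiv ^^ n) Q + smult (of_nat n * e) ((pderiv ^^ (n - 1)) Q)"
proof (induction n)
  case (Suc n)
  show ?case
  proof (cases n)
    case 0
    then show ?thesis by (simp add: pderiv_mult assms)
  next
    case (Suc m)
    have "(pderiv ^^ Suc n) (q * Q) = pderiv ((pderiv ^^ n) (q * Q))" by simp
    also have "\<dots> = q * (pderiv ^^ Suc n) Q + smult e ((pderiv ^^ n) Q)
        + smult (of_nat n * e) ((pderiv ^^ n) Q)"
      unfolding Suc.IH by (simp add: pderiv_add pderiv_mult pderiv_smult assms Suc)
    finally show ?thesis by (simp add: smult_add_left [symmetric] algebra_simps)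
  qed
qed simp

text \<open>The base of the constant is crude, but the power of \<open>R\<close> has to be exact: \<open>R\<close> will be the length
  of a tile, and its powers must cancel against those from interpolation. With the factor \<open>R ^ n\<close> on the left
  the estimate reproduces itself when a linear factor is added, because the Leibniz rule leaves
  \<open>(n + 1) ^ s + n * (n + 1) ^ s = (n + 1) ^ Suc s\<close>.\<close>

lemma higher_pderiv_prod_linear_bound:
  fixes q :: "'a \<Rightarrow> real poly"
  assumes "finite S" and "0 \<le> R"
    and "\<And>l. l \<in> S \<Longrightarrow> \<bar>poly (q l) \<xi>\<bar> \<le> R"
    and "\<And>l. l \<in> S \<Longrightarrow> \<exists>e. pderiv (q l) = [:e:] \<and> \<bar>e\<bar> \<le> 1"
  shows "\<bar>poly ((pderiv ^^ n) (\<Prod>l\<in>S. q l)) \<xi>\<bar> * R ^ n \<le> (real n + 1) ^ card S * R ^ card S"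
  using assms(1,3,4)
proof (induction S arbitrary: n rule: finite_induct)
  case empty
  then show ?case by (cases n) (simp_all add: funpow_Suc_right del: funpow.simps)
next
  case (insert l S)
  let ?Q = "\<Prod>l\<in>S. q l"
  obtain e where e: "pderiv (q l) = [:e:]" "\<bar>e\<bar> \<le> 1" using insert.prems(2) by blast
  have q: "\<bar>poly (q l) \<xi>\<bar> \<le> R" using insert.prems(1) by blast
  have IH: "\<bar>poly ((pderiv ^^ n) ?Q) \<xi>\<bar> * R ^ n \<le> (real n + 1) ^ card S * R ^ card S" for n
    using insert by blast
  define A where "A = \<bar>poly ((pderiv ^^ n) ?Q) \<xi>\<bar> * R ^ n"
  have "\<bar>poly ((pderiv ^^ n) (q l * ?Q)) \<xi>\<bar> * R ^ n
     \<le> (\<bar>poly (q l) \<xi>\<bar> * \<bar>poly ((pderiv ^^ n) ?Q) \<xi>\<bar>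
          + real n * (\<bar>e\<bar> * \<bar>poly ((pderiv ^^ (n - 1)) ?Q) \<xi>\<bar>)) * R ^ n"
    unfolding higher_pderiv_linear_mult [OF e(1)]
    by (intro mult_right_mono) (auto simp: abs_mult assms(2) intro!: order_trans [OF abs_triangle_ineq])
  also have "\<dots> \<le> (R * \<bar>poly ((pderiv ^^ n) ?Q) \<xi>\<bar>
          + real n * (1 * \<bar>poly ((pderiv ^^ (n - 1)) ?Q) \<xi>\<bar>)) * R ^ n"
    using q e(2) assms(2) by (intro mult_right_mono add_mono mult_left_mono) auto
  also have "\<dots> \<le> R * ((real n + 1) ^ card S * R ^ card S) + real n * ((real n + 1) ^ card S * R ^ Suc (card S))"
  proof (cases n)
    case 0
    have "R * \<bar>poly ?Q \<xi>\<bar> \<le> R * R ^ card S"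
      using IH[of 0] assms(2) by (intro mult_left_mono) auto
    then show ?thesis using 0 by simp
  next
    case (Suc m)
    have a: "R * (\<bar>poly ((pderiv ^^ n) ?Q) \<xi>\<bar> * R ^ n) \<le> R * ((real n + 1) ^ card S * R ^ card S)"
      using IH[of n] assms(2) by (intro mult_left_mono) auto
    have "\<bar>poly ((pderiv ^^ m) ?Q) \<xi>\<bar> * R ^ m \<le> (real m + 1) ^ card S * R ^ card S" by (rule IH)
    also have "\<dots> \<le> (real n + 1) ^ card S * R ^ card S"
      using assms(2) Suc by (intro mult_right_mono power_mono) auto
    finally have "real n * (R * (\<bar>poly ((pderiv ^^ m) ?Q) \<xi>\<bar> * R ^ m)) \<le> real n * (R * ((real n + 1) ^ card S * R ^ card S))"
      using assms(2) by (intro mult_left_mono) auto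
    with a show ?thesis unfolding Suc by (simp add: algebra_simps)
  qed
  also have "\<dots> = (real n + 1) ^ Suc (card S) * R ^ Suc (card S)" by (simp add: algebra_simps)
  finally show ?case using insert.hyps by simp
qed

text \<open>The de Boor--Fix form of the classical apolar pairing. Up to sign and the factor \<open>d!\<close> it evaluates the blossom
  of \<open>p\<close> at \<open>\<tau>\<^sub>1, \<dots>, \<tau>\<^sub>d\<close> if \<open>\<psi>\<close> is the product of the factors \<open>\<tau>\<^sub>l - y\<close>. It is kept as a polynomial so that
  it can be evaluated at any convenient point.\<close>

definition apolar :: "nat \<Rightarrow> real poly \<Rightarrow> real poly \<Rightarrow> real poly" where
  "apolar d p \<psi> = (\<Sum>\<nu>\<le>d. smult ((-1) ^ \<nu>) ((pderiv ^^ (d - \<nu>)) \<psi> * (pderiv ^^ \<nu>) p))"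

lemma poly_apolar:
  "poly (apolar d p \<psi>) \<xi> = (\<Sum>\<nu>\<le>d. (-1) ^ \<nu> * (poly ((pderiv ^^ (d - \<nu>)) \<psi>) \<xi> * poly ((pderiv ^^ \<nu>) p) \<xi>))"
  by (simp add: apolar_def poly_sum)

lemma higher_pderiv_eq_0:
  fixes p :: "real poly"
  assumes "degree p < n"
  shows "(pderiv ^^ n) p = 0"
proof -
  obtain m where n: "n = Suc m" using assms by (cases n) auto
  have "degree ((pderiv ^^ m) p) = 0" using assms n by (simp add: degree_higher_pderiv)
  then show ?thesis unfolding n by (simp add: pderiv_eq_0_iff)
qed

text \<open>The derivative of the sum telescopes, and both remaining terms contain a derivative of order \<open>Suc d\<close>.\<close>

lemma apolar_const:
  assumes "degree p \<le> d" "degree \<psi> \<le> d"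
  shows "poly (apolar d p \<psi>) x = poly (apolar d p \<psi>) y"
proof -
  define T where "T \<nu> = (-1) ^ \<nu> * ((pderiv ^^ (Suc d - \<nu>)) \<psi> * (pderiv ^^ \<nu>) p)" for \<nu>
  have step: "pderiv (smult ((-1) ^ \<nu>) ((pderiv ^^ (d - \<nu>)) \<psi> * (pderiv ^^ \<nu>) p)) = T \<nu> - T (Suc \<nu>)"
    if "\<nu> \<le> d" for \<nu>
  proof -
    have *: "smult ((-1) ^ \<nu>) q = (-1) ^ \<nu> * q" for q :: "real poly"
      by (cases "even \<nu>") auto
    have "Suc d - \<nu> = Suc (d - \<nu>)" using that by simp
    then show ?thesis by (simp add: T_def * pderiv_mult pderiv_smult del: smult_minus_left)
        (cases "even \<nu>"; simp add: pderiv_mult pderiv_minus algebra_simps)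
  qed
  have "pderiv (apolar d p \<psi>) = (\<Sum>\<nu>\<le>d. T \<nu> - T (Suc \<nu>))"
    using step unfolding apolar_def by (simp add: higher_pderiv_sum [where n = 1, simplified])
  also have "\<dots> = T 0 - T (Suc d)"
    by (rule sum_telescope)
  also have "\<dots> = 0"
    using higher_pderiv_eq_0 [of p "Suc d"] higher_pderiv_eq_0 [of \<psi> "Suc d"] assms
    by (simp add: T_def del: funpow.simps)
  finally have "degree (apolar d p \<psi>) = 0" by (simp add: pderiv_eq_0_iff)
  then obtain c where "apolar d p \<psi> = [:c:]" by (metis degree_eq_zeroE)
  then show ?thesis by simp
qed

lemma smult_sum_right: "smult c (\<Sum>j\<in>A. f j) = (\<Sum>j\<in>A. smult c (f j :: real poly))"
  by (induction A rule: infinite_finite_induct) (simp_all add: smult_add_right)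

lemma apolar_sum_left: "apolar d (\<Sum>j\<in>A. smult (c j) (q j)) \<psi> = (\<Sum>j\<in>A. smult (c j) (apolar d (q j) \<psi>))"
  unfolding apolar_def higher_pderiv_sum higher_pderiv_smult
  by (simp add: sum_distrib_left smult_sum_right mult.commute) (rule sum.swap)

lemma apolar_sum_right: "apolar d p (\<Sum>j\<in>A. smult (c j) (q j)) = (\<Sum>j\<in>A. smult (c j) (apolar d p (q j)))"
  unfolding apolar_def higher_pderiv_sum higher_pderiv_smult
  by (simp add: sum_distrib_right smult_sum_right) (subst sum.swap, simp add: mult.commute)

lemma higher_pderiv_linear_power:
  fixes q :: "real poly"
  assumes "pderiv q = [:e:]" "n \<le> m"
  shows "(pderiv ^^ n) (q ^ m) = smult (fact m / fact (m - n) * e ^ n) (q ^ (m - n))"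
  using assms(2)
proof (induction n)
  case (Suc n)
  have m: "m - n = Suc (m - Suc n)" using Suc.prems by simp
  have "(pderiv ^^ Suc n) (q ^ m) = pderiv (smult (fact m / fact (m - n) * e ^ n) (q ^ (m - n)))"
    using Suc by simp
  also have "\<dots> = smult (fact m / fact (m - n) * e ^ n * (real (m - n) * e)) (q ^ (m - Suc n))"
    unfolding pderiv_smult m pderiv_power_Suc by (simp add: assms(1) mult_ac)
  also have "fact m / fact (m - n) * e ^ n * (real (m - n) * e) = fact m / fact (m - Suc n) * e ^ Suc n"
    unfolding m by (simp add: field_simps del: of_nat_Suc)
  finally show ?case .
qed simp

text \<open>Evaluated at \<open>x\<close>, only the derivative of order \<open>d\<close> of the power survives.\<close>

lemma apolar_linear_power:
  "poly (apolar d p ([:x, -1:] ^ d)) x = (-1) ^ d * fact d * poly p x"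
proof -
  have pd: "pderiv [:x, -1 :: real:] = [:-1:]" by (simp add: pderiv_pCons)
  have "poly ((pderiv ^^ (d - \<nu>)) ([:x, -1:] ^ d)) x = (if \<nu> = 0 then (-1) ^ d * fact d else 0)" if "\<nu> \<le> d" for \<nu>
    using that by (auto simp: higher_pderiv_linear_power [OF pd])
  then have "poly (apolar d p ([:x, -1:] ^ d)) x
      = (\<Sum>\<nu>\<le>d. if \<nu> = 0 then (-1) ^ d * fact d * poly p x else 0)"
    unfolding poly_apolar by (intro sum.cong) auto
  then show ?thesis by simp
qed

text \<open>Two polynomial pieces that meet smoothly at a knot \<open>s\<close> have the same pairing with every \<open>\<psi>\<close> that
  vanishes at \<open>s\<close>: the derivative of order \<open>d\<close>, in which they may differ, is multiplied by \<open>\<psi>(s)\<close>.\<close>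

lemma apolar_common_jet:
  assumes "\<And>\<nu>. \<nu> < d \<Longrightarrow> poly ((pderiv ^^ \<nu>) p) s = poly ((pderiv ^^ \<nu>) q) s"
    and "poly \<psi> s = 0"
  shows "poly (apolar d p \<psi>) s = poly (apolar d q \<psi>) s"
  unfolding poly_apolar
proof (intro sum.cong refl)
  fix \<nu> assume "\<nu> \<in> {..d}"
  then consider "\<nu> < d" | "\<nu> = d" by force
  then show "(-1) ^ \<nu> * (poly ((pderiv ^^ (d - \<nu>)) \<psi>) s * poly ((pderiv ^^ \<nu>) p) s)
    = (-1) ^ \<nu> * (poly ((pderiv ^^ (d - \<nu>)) \<psi>) s * poly ((pderiv ^^ \<nu>) q) s)"
    by cases (auto simp: assms)
qed

lemma apolar_prod_bound:
  fixes q \<rho> :: "'a \<Rightarrow> real poly"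
  assumes "finite S" "card S = d" "finite S'" "card S' = d" "0 < R"
    and "\<And>l. l \<in> S \<Longrightarrow> \<bar>poly (q l) \<xi>\<bar> \<le> R \<and> (\<exists>e. pderiv (q l) = [:e:] \<and> \<bar>e\<bar> \<le> 1)"
    and "\<And>l. l \<in> S' \<Longrightarrow> \<bar>poly (\<rho> l) \<xi>\<bar> \<le> R \<and> (\<exists>e. pderiv (\<rho> l) = [:e:] \<and> \<bar>e\<bar> \<le> 1)"
  shows "\<bar>poly (apolar d (\<Prod>l\<in>S. q l) (\<Prod>l\<in>S'. \<rho> l)) \<xi>\<bar> \<le> (real d + 1) ^ (2 * d + 1) * R ^ d"
proof -
  let ?P = "\<Prod>l\<in>S. q l" and ?Q = "\<Prod>l\<in>S'. \<rho> l"
  have bP: "\<bar>poly ((pderiv ^^ n) ?P) \<xi>\<bar> * R ^ n \<le> (real d + 1) ^ d * R ^ d" if "n \<le> d" for n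
  proof -
    have "\<bar>poly ((pderiv ^^ n) ?P) \<xi>\<bar> * R ^ n \<le> (real n + 1) ^ d * R ^ d"
      using higher_pderiv_prod_linear_bound [of S R q \<xi> n] assms by auto
    also have "\<dots> \<le> (real d + 1) ^ d * R ^ d"
      using that assms(5) by (intro mult_right_mono power_mono) auto
    finally show ?thesis .
  qed
  have bQ: "\<bar>poly ((pderiv ^^ n) ?Q) \<xi>\<bar> * R ^ n \<le> (real d + 1) ^ d * R ^ d" if "n \<le> d" for n
  proof -
    have "\<bar>poly ((pderiv ^^ n) ?Q) \<xi>\<bar> * R ^ n \<le> (real n + 1) ^ d * R ^ d"
      using higher_pderiv_prod_linear_bound [of S' R \<rho> \<xi> n] assms by auto
    also have "\<dots> \<le> (real d + 1) ^ d * R ^ d"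
      using that assms(5) by (intro mult_right_mono power_mono) auto
    finally show ?thesis .
  qed
  have summand: "\<bar>poly ((pderiv ^^ (d - \<nu>)) ?Q) \<xi> * poly ((pderiv ^^ \<nu>) ?P) \<xi>\<bar> \<le> (real d + 1) ^ (2 * d) * R ^ d"
    if "\<nu> \<le> d" for \<nu>
  proof -
    have "\<bar>poly ((pderiv ^^ (d - \<nu>)) ?Q) \<xi> * poly ((pderiv ^^ \<nu>) ?P) \<xi>\<bar> * R ^ d
       = (\<bar>poly ((pderiv ^^ (d - \<nu>)) ?Q) \<xi>\<bar> * R ^ (d - \<nu>)) * (\<bar>poly ((pderiv ^^ \<nu>) ?P) \<xi>\<bar> * R ^ \<nu>)"
      using that by (simp add: abs_mult power_add [symmetric] mult_ac)
    also have "\<dots> \<le> ((real d + 1) ^ d * R ^ d) * ((real d + 1) ^ d * R ^ d)"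
      using that assms(5) by (intro mult_mono bP bQ) auto
    also have "\<dots> = ((real d + 1) ^ (2 * d) * R ^ d) * R ^ d"
      unfolding mult_2 power_add by (simp only: mult_ac)
    finally show ?thesis using assms(5) by (simp del: abs_mult)
  qed
  have "\<bar>poly (apolar d ?P ?Q) \<xi>\<bar> \<le> (\<Sum>\<nu>\<le>d. (real d + 1) ^ (2 * d) * R ^ d)"
    unfolding poly_apolar by (rule order_trans [OF sum_abs sum_mono]) (use summand in \<open>auto simp: abs_mult power_abs\<close>)
  also have "\<dots> = (real d + 1) ^ (2 * d + 1) * R ^ d" by (simp add: mult_ac)
  finally show ?thesis .
qed

section \<open>Interpolation at separated points of a set\<close>

text \<open>Greedy choice: take a point close to the infimum of \<open>B\<close> and continue with what lies at least \<open>\<delta>\<close> to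
  its right; this costs only slightly more than \<open>\<delta>\<close> in measure.\<close>

lemma separated_points:
  fixes B :: "real set"
  assumes "B \<in> lmeasurable" "bounded B" "0 < \<delta>" "real n * \<delta> < measure lebesgue B"
  shows "\<exists>x :: nat \<Rightarrow> real. (\<forall>j\<le>n. x j \<in> B) \<and> (\<forall>j<n. x j + \<delta> \<le> x (Suc j))"
  using assms(1,2,4)
proof (induction n arbitrary: B)
  case 0
  then have "B \<noteq> {}" by auto
  then obtain y where "y \<in> B" by blast
  then show ?case by (intro exI [of _ "\<lambda>_. y"]) auto
next
  case (Suc n)
  define \<epsilon> where "\<epsilon> = measure lebesgue B - real (Suc n) * \<delta>"
  have "\<epsilon> > 0" using Suc.prems by (simp add: \<epsilon>_def)
  have "0 < measure lebesgue B" using Suc.prems(3) assms(3) by (smt (verit) mult_nonneg_nonneg of_nat_0_le_iff)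
  then have ne: "B \<noteq> {}" by auto
  have bdd: "bdd_below B" using Suc.prems(2) by (rule bounded_imp_bdd_below)
  obtain y where y: "y \<in> B" "y < Inf B + \<epsilon>"
    using cInf_lessD [OF ne, of "Inf B + \<epsilon>"] \<open>\<epsilon> > 0\<close> by auto
  have Infy: "Inf B \<le> y" using y bdd by (simp add: cInf_lower)
  let ?B = "B \<inter> {y + \<delta>..}"
  have meas: "?B \<in> lmeasurable"
    using Suc.prems(1) by (intro fmeasurable_Int_fmeasurable) auto
  have "B \<subseteq> ?B \<union> {Inf B..y + \<delta>}"
    using cInf_lower [OF _ bdd] by auto
  then have "measure lebesgue B \<le> measure lebesgue (?B \<union> {Inf B..y + \<delta>})"
    using Suc.prems(1) meas by (intro measure_mono_fmeasurable) auto
  also have "\<dots> \<le> measure lebesgue ?B + measure lebesgue {Inf B..y + \<delta>}"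
    using meas by (intro measure_Un_le) auto
  also have "measure lebesgue {Inf B..y + \<delta>} = y + \<delta> - Inf B"
    using Infy assms(3) by simp
  finally have "real n * \<delta> < measure lebesgue ?B"
    using y(2) by (simp add: \<epsilon>_def algebra_simps)
  moreover have "bounded ?B" using Suc.prems(2) by (auto intro: bounded_subset)
  ultimately obtain x where x: "\<forall>j\<le>n. x j \<in> ?B" "\<forall>j<n. x j + \<delta> \<le> x (Suc j)"
    using Suc.IH [of ?B] meas by blast
  define x' where "x' j = (case j of 0 \<Rightarrow> y | Suc i \<Rightarrow> x i)" for j
  have "x' j \<in> B" if "j \<le> Suc n" for j
    using that x(1) y(1) by (cases j) (auto simp: x'_def)
  moreover have "x' j + \<delta> \<le> x' (Suc j)" if "j < Suc n" for j
    using that x by (cases j) (auto simp: x'_def)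
  ultimately show ?case by blast
qed

lemma separated_points_dist:
  fixes x :: "nat \<Rightarrow> real"
  assumes "0 < \<delta>" "\<forall>j<n. x j + \<delta> \<le> x (Suc j)" "i \<le> n" "j \<le> n" "i \<noteq> j"
  shows "\<delta> \<le> \<bar>x i - x j\<bar>"
proof -
  have *: "x i + \<delta> \<le> x j" if "i < j" "j \<le> n" for i j
    using that
  proof (induction j)
    case (Suc j)
    then show ?case
      using assms(1,2) by (cases "i = j") (force, smt (verit) Suc_le_lessD Suc_leD less_antisym)
  qed simp
  show ?thesis using *[of i j] *[of j i] assms by (cases "i < j") auto
qed

lemma lagrange_interpolation:
  fixes p :: "real poly" and x :: "nat \<Rightarrow> real"
  assumes "degree p \<le> d" "inj_on x {..d}"
  shows "p = (\<Sum>j\<le>d. smult (poly p (x j) * (\<Prod>l\<in>{..d} - {j}. 1 / (x j - x l))) (\<Prod>l\<in>{..d} - {j}. [:- x l, 1:]))"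
    (is "p = ?L")
proof (rule poly_eqI_degree [where A = "x ` {..d}"])
  have card: "card (x ` {..d}) = Suc d" using assms(2) by (simp add: card_image)
  show "degree p < card (x ` {..d})" using card assms(1) by simp
  have "degree (\<Prod>l\<in>{..d} - {j}. [:- x l, 1:]) \<le> d" if "j \<le> d" for j
    using degree_prod_sum_le [of "{..d} - {j}" "\<lambda>l. [:- x l, 1:]"] that by simp
  then have "degree ?L \<le> d"
    by (intro degree_sum_le) (auto intro: order_trans [OF degree_smult_le])
  then show "degree ?L < card (x ` {..d})" using card by simp
  fix y assume "y \<in> x ` {..d}"
  then obtain i where i: "i \<le> d" "y = x i" by auto
  have "poly p (x j) * (\<Prod>l\<in>{..d} - {j}. 1 / (x j - x l)) * (\<Prod>l\<in>{..d} - {j}. (x i - x l))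
     = (if j = i then poly p (x i) else 0)" if "j \<le> d" for j
  proof (cases "j = i")
    case True
    have "(\<Prod>l\<in>{..d} - {i}. 1 / (x i - x l)) * (\<Prod>l\<in>{..d} - {i}. (x i - x l)) = (\<Prod>l\<in>{..d} - {i}. 1)"
      unfolding prod.distrib [symmetric]
      using assms(2) i(1) by (intro prod.cong refl) (auto simp: inj_on_def)
    then show ?thesis using True by (simp add: mult.assoc)
  next
    case False
    then have "(\<Prod>l\<in>{..d} - {j}. (x i - x l)) = 0" using i(1) by (intro prod_zero) auto
    then show ?thesis using False by simp
  qed
  then have "poly ?L y = (\<Sum>j\<le>d. if j = i then poly p (x i) else 0)"
    unfolding poly_sum i(2) by (intro sum.cong refl) (simp add: poly_prod)
  then show "poly p y = poly ?L y" using i by simp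
qed

text \<open>Interpolation at \<open>d + 1\<close> points of \<open>B\<close> with gaps of at least \<open>\<delta>\<close> writes \<open>p\<close> as a combination, with coefficients of size at most
  \<open>\<eta> / \<delta> ^ d\<close>, of products of \<open>d\<close> linear factors, and those pair with the given product to at most a
  multiple of \<open>R ^ d\<close>.\<close>

lemma apolar_bound_of_bound_on_set:
  fixes p :: "real poly" and \<tau> :: "nat \<Rightarrow> real"
  assumes "degree p \<le> d" "B \<in> lmeasurable" "B \<subseteq> {a..a + R}" "0 < \<delta>" "0 < R"
    and "real d * \<delta> < measure lebesgue B" "\<And>x. x \<in> B \<Longrightarrow> \<bar>poly p x\<bar> \<le> \<eta>"
    and "\<And>l. l \<in> {1..d} \<Longrightarrow> \<tau> l \<in> {a..a + R}"
  shows "\<bar>poly (apolar d p (\<Prod>l\<in>{1..d}. [:\<tau> l, -1:])) y\<bar> \<le> \<eta> * ((real d + 1) ^ (2 * d + 2) * (R / \<delta>) ^ d)"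
proof -
  let ?\<psi> = "\<Prod>l\<in>{1..d}. [:\<tau> l, -1:]"
  have "bounded B" using assms(3) by (rule bounded_subset [rotated]) simp
  then obtain x where x: "\<And>j. j \<le> d \<Longrightarrow> x j \<in> B" "\<forall>j<d. x j + \<delta> \<le> x (Suc j)"
    using separated_points [OF assms(2) _ assms(4,6)] by blast
  have dist: "\<delta> \<le> \<bar>x i - x j\<bar>" if "i \<le> d" "j \<le> d" "i \<noteq> j" for i j
    using separated_points_dist [OF assms(4) x(2)] that by blast
  have inj: "inj_on x {..d}" by (rule inj_onI) (use dist assms(4) in force)
  define \<xi> where "\<xi> = x 0"
  have \<xi>: "\<xi> \<in> {a..a + R}" using x(1)[of 0] assms(3) by (auto simp: \<xi>_def)
  have "0 \<le> \<eta>" using assms(7)[OF x(1)[of 0]] by auto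
  have deg\<psi>: "degree ?\<psi> \<le> d" using degree_prod_sum_le [of "{1..d}" "\<lambda>l. [:\<tau> l, -1:]"] by simp
  define c where "c j = poly p (x j) * (\<Prod>l\<in>{..d} - {j}. 1 / (x j - x l))" for j
  define q where "q j = (\<Prod>l\<in>{..d} - {j}. [:- x l, 1:])" for j
  have c: "\<bar>c j\<bar> \<le> \<eta> * (1 / \<delta>) ^ d" if "j \<le> d" for j
  proof -
    have "\<bar>\<Prod>l\<in>{..d} - {j}. 1 / (x j - x l)\<bar> \<le> (\<Prod>l\<in>{..d} - {j}. 1 / \<delta>)"
      unfolding abs_prod using dist that assms(4)
      by (intro prod_mono) (auto simp: divide_simps)
    also have "\<dots> = (1 / \<delta>) ^ d" using that by simp
    finally show ?thesis unfolding c_def abs_mult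
      using assms(7)[OF x(1)[OF that]] \<open>0 \<le> \<eta>\<close> by (intro mult_mono) auto
  qed
  have q: "\<bar>poly (apolar d (q j) ?\<psi>) \<xi>\<bar> \<le> (real d + 1) ^ (2 * d + 1) * R ^ d" if "j \<le> d" for j
    unfolding q_def
  proof (rule apolar_prod_bound)
    fix l assume "l \<in> {..d} - {j}"
    then have "x l \<in> {a..a + R}" using x(1)[of l] assms(3) by auto
    then show "\<bar>poly [:- x l, 1:] \<xi>\<bar> \<le> R \<and> (\<exists>e. pderiv [:- x l, 1:] = [:e:] \<and> \<bar>e\<bar> \<le> 1)"
      using \<xi> by (auto simp: pderiv_pCons intro!: exI [of _ 1])
  next
    fix l assume "l \<in> {1..d}"
    then have "\<tau> l \<in> {a..a + R}" using assms(8) by blast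
    then show "\<bar>poly [:\<tau> l, -1:] \<xi>\<bar> \<le> R \<and> (\<exists>e. pderiv [:\<tau> l, -1:] = [:e:] \<and> \<bar>e\<bar> \<le> 1)"
      using \<xi> by (auto simp: pderiv_pCons intro!: exI [of _ "-1"])
  qed (use that assms in auto)
  have p: "p = (\<Sum>j\<le>d. smult (c j) (q j))"
    unfolding c_def q_def by (rule lagrange_interpolation [OF assms(1) inj])
  have "poly (apolar d p ?\<psi>) y = poly (apolar d p ?\<psi>) \<xi>"
    using assms(1) deg\<psi> by (rule apolar_const)
  also have "\<dots> = poly (apolar d (\<Sum>j\<le>d. smult (c j) (q j)) ?\<psi>) \<xi>"
    by (rule arg_cong [OF p])
  also have "\<dots> = (\<Sum>j\<le>d. c j * poly (apolar d (q j) ?\<psi>) \<xi>)"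
    unfolding apolar_sum_left poly_sum by simp
  finally have "\<bar>poly (apolar d p ?\<psi>) y\<bar> = \<bar>\<Sum>j\<le>d. c j * poly (apolar d (q j) ?\<psi>) \<xi>\<bar>"
    by simp
  also have "\<dots> \<le> (\<Sum>j\<le>d. (\<eta> * (1 / \<delta>) ^ d) * ((real d + 1) ^ (2 * d + 1) * R ^ d))"
  proof (rule order_trans [OF sum_abs sum_mono])
    fix j assume "j \<in> {..d}"
    then show "\<bar>c j * poly (apolar d (q j) ?\<psi>) \<xi>\<bar> \<le> (\<eta> * (1 / \<delta>) ^ d) * ((real d + 1) ^ (2 * d + 1) * R ^ d)"
      unfolding abs_mult using c q assms(4) \<open>0 \<le> \<eta>\<close> by (intro mult_mono) auto
  qed
  also have "\<dots> = (real d + 1) * ((\<eta> * (1 / \<delta>) ^ d) * ((real d + 1) ^ (2 * d + 1) * R ^ d))"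
    by simp
  also have "\<dots> = \<eta> * ((real d + 1) ^ (2 * d + 2) * (R / \<delta>) ^ d)"
    by (simp add: power_divide mult_ac)
  finally show ?thesis .
qed

section \<open>B-spline coefficients on a grid\<close>

locale spline_grid =
  fixes d m :: nat and b :: "nat \<Rightarrow> real"
  assumes b_less_Suc: "\<And>r. r < m \<Longrightarrow> b r < b (Suc r)" and m_pos: "0 < m"
begin

text \<open>The knot sequence in which both ends of the grid have multiplicity \<open>d + 1\<close>. The truncated subtraction
  and the minimum repeat the end points, and beyond the last knot the sequence stays constant.\<close>

definition t :: "nat \<Rightarrow> real" where "t j = b (min m (j - d))"

lemma b_less: "r < r' \<Longrightarrow> r' \<le> m \<Longrightarrow> b r < b r'"
proof (induction r')
  case (Suc r')
  then show ?case using b_less_Suc [of r'] by (cases "r = r'") auto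
qed simp

lemma b_le: "r \<le> r' \<Longrightarrow> r' \<le> m \<Longrightarrow> b r \<le> b r'"
  using b_less [of r r'] by (cases "r = r'") auto

lemma t_mono: "j \<le> j' \<Longrightarrow> t j \<le> t j'"
  unfolding t_def by (rule b_le) auto

lemma t_shift: "r \<le> m \<Longrightarrow> t (r + d) = b r"
  by (simp add: t_def)

lemma t_less_iff_atom: "t j < t (Suc j) \<longleftrightarrow> d \<le> j \<and> j < m + d"
proof
  assume "t j < t (Suc j)"
  then have "min m (j - d) \<noteq> min m (Suc j - d)" by (auto simp: t_def)
  then show "d \<le> j \<and> j < m + d" by linarith
next
  assume *: "d \<le> j \<and> j < m + d"
  then have "min m (j - d) = j - d" "min m (Suc j - d) = Suc (j - d)" by linarith+
  then show "t j < t (Suc j)" using * b_less_Suc by (simp add: t_def)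
qed

lemma support_nonempty: "i < m + d \<Longrightarrow> t i < t (i + d + 1)"
  unfolding t_def by (rule b_less) (use m_pos in \<open>auto simp: min_def\<close>)

text \<open>The roots of \<open>\<psi> i\<close> are the inner knots of the \<open>i\<close>-th B-spline. By de Boor and Fix, \<open>bcoef p i\<close> is, up to sign, the coefficient of that B-spline in a spline with the piece \<open>p\<close>.\<close>

definition \<psi> :: "nat \<Rightarrow> real poly" where "\<psi> i = (\<Prod>l\<in>{1..d}. [:t (i + l), -1:])"

definition bcoef :: "real poly \<Rightarrow> nat \<Rightarrow> real" where "bcoef p i = poly (apolar d p (\<psi> i)) 0 / fact d"

lemma degree_\<psi>: "degree (\<psi> i) \<le> d"
  unfolding \<psi>_def using degree_prod_sum_le [of "{1..d}" "\<lambda>l. [:t (i + l), -1:]"] by simp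

text \<open>Marsden's identity \<open>(x - y)^d = (\<Sum>i. N i x * \<psi> i y)\<close>, as a statement about convex
  combinations. One factor \<open>x - y\<close> is removed at a time: \<open>x\<close> lies between
  the next knot to the left and the next knot to the right of the run of knots present, so
  \<open>x - y\<close> is a convex combination of the two factors that extend the run.\<close>

lemma marsden_step:
  assumes r: "r < m" "b r \<le> x" "x \<le> b (Suc r)" and "n \<le> d" "r + n \<le> i" "i \<le> r + d"
  shows "\<exists>w. (\<forall>j. 0 \<le> w j) \<and> (\<Sum>j\<in>{r..r + d}. w j) = (1::real) \<and>
    [:x, -1:] ^ n * (\<Prod>l\<in>{1..d - n}. [:t (i + l), -1:]) = (\<Sum>j\<in>{r..r + d}. smult (w j) (\<psi> j))"
  using assms(4-6)
proof (induction n arbitrary: i)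
  case 0
  have "(\<Sum>j\<in>{r..r + d}. smult (if j = i then 1 else 0) (\<psi> j)) = (\<Sum>j\<in>{r..r + d}. if j = i then \<psi> j else 0)"
    by (intro sum.cong) auto
  then show ?case using 0 by (intro exI [of _ "\<lambda>j. if j = i then 1 else 0"]) (auto simp: \<psi>_def)
next
  case (Suc n)
  define s e where "s = t i" and "e = t (i + (d - n))"
  have s: "s \<le> x" using t_mono [of i "r + d"] t_shift [of r] Suc.prems r by (simp add: s_def)
  have e: "x \<le> e"
  proof -
    have "b (Suc r) \<le> e"
      unfolding e_def t_shift [OF Suc_leI [OF r(1)], symmetric] using Suc.prems by (intro t_mono) linarith
    then show ?thesis using r by simp
  qed
  have "s < e"
  proof -
    have "s \<le> b r" using t_mono [of i "r + d"] t_shift [of r] Suc.prems r by (simp add: s_def)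
    moreover have "b (Suc r) \<le> e"
      unfolding e_def t_shift [OF Suc_leI [OF r(1)], symmetric] using Suc.prems by (intro t_mono) linarith
    ultimately show ?thesis using b_less_Suc [OF r(1)] by simp
  qed
  define \<theta> where "\<theta> = (e - x) / (e - s)"
  have \<theta>: "0 \<le> \<theta>" "\<theta> \<le> 1" using s e \<open>s < e\<close> by (auto simp: \<theta>_def divide_simps)
  have "\<theta> * s + (1 - \<theta>) * e = x" using \<open>s < e\<close> by (simp add: \<theta>_def divide_simps) (simp add: algebra_simps)
  then have split: "[:x, -1:] = smult \<theta> [:s, -1:] + smult (1 - \<theta>) [:e, -1:]"
    by simp
  define Q where "Q = (\<Prod>l\<in>{1..d - Suc n}. [:t (i + l), -1:])"
  have dn: "d - n = Suc (d - Suc n)" using Suc.prems by simp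
  have Qs: "[:s, -1:] * Q = (\<Prod>l\<in>{1..d - n}. [:t ((i - 1) + l), -1:])"
  proof -
    have "(\<Prod>l\<in>{1..d - n}. [:t ((i - 1) + l), -1:]) = (\<Prod>l\<in>{0..d - Suc n}. [:t (i - 1 + Suc l), -1:])"
      unfolding dn One_nat_def prod.atLeast_Suc_atMost_Suc_shift comp_def ..
    also have "\<dots> = (\<Prod>l\<in>{0..d - Suc n}. [:t (i + l), -1:])"
      using Suc.prems by (intro prod.cong) auto
    also have "\<dots> = [:t i, -1:] * Q" unfolding Q_def by (subst prod.atLeast_Suc_atMost) auto
    finally show ?thesis by (simp add: s_def)
  qed
  have Qe: "[:e, -1:] * Q = (\<Prod>l\<in>{1..d - n}. [:t (i + l), -1:])"
    unfolding dn Q_def e_def by (simp add: mult.commute)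
  obtain u where u: "\<And>j. 0 \<le> u j" "(\<Sum>j\<in>{r..r + d}. u j) = (1::real)"
    "[:x, -1:] ^ n * ([:s, -1:] * Q) = (\<Sum>j\<in>{r..r + d}. smult (u j) (\<psi> j))"
  proof -
    have "n \<le> d" "r + n \<le> i - 1" "i - 1 \<le> r + d" using Suc.prems by auto
    then show ?thesis using Suc.IH [of "i - 1"] that unfolding Qs by blast
  qed
  obtain v where v: "\<And>j. 0 \<le> v j" "(\<Sum>j\<in>{r..r + d}. v j) = (1::real)"
    "[:x, -1:] ^ n * ([:e, -1:] * Q) = (\<Sum>j\<in>{r..r + d}. smult (v j) (\<psi> j))"
  proof -
    have "n \<le> d" "r + n \<le> i" "i \<le> r + d" using Suc.prems by auto
    then show ?thesis using Suc.IH [of i] that unfolding Qe by blast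
  qed
  have "[:x, -1:] ^ Suc n * Q = [:x, -1:] ^ n * ([:x, -1:] * Q)" by (simp only: power_Suc mult_ac)
  also have "[:x, -1:] * Q = smult \<theta> ([:s, -1:] * Q) + smult (1 - \<theta>) ([:e, -1:] * Q)"
    unfolding split by (simp only: distrib_right mult_smult_left)
  also have "[:x, -1:] ^ n * \<dots> = smult \<theta> (\<Sum>j\<in>{r..r + d}. smult (u j) (\<psi> j)) + smult (1 - \<theta>) (\<Sum>j\<in>{r..r + d}. smult (v j) (\<psi> j))"
    unfolding u(3) [symmetric] v(3) [symmetric] by (simp only: distrib_left mult_smult_right)
  also have "\<dots> = (\<Sum>j\<in>{r..r + d}. smult (\<theta> * u j + (1 - \<theta>) * v j) (\<psi> j))"
    by (simp add: smult_sum_right smult_add_left sum.distrib)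
  finally have "[:x, -1:] ^ Suc n * Q = (\<Sum>j\<in>{r..r + d}. smult (\<theta> * u j + (1 - \<theta>) * v j) (\<psi> j))" .
  moreover have "(\<Sum>j\<in>{r..r + d}. \<theta> * u j + (1 - \<theta>) * v j) = 1"
    by (simp add: sum.distrib sum_distrib_left [symmetric] u(2) v(2))
  moreover have "\<forall>j. 0 \<le> \<theta> * u j + (1 - \<theta>) * v j" using \<theta> u(1) v(1) by simp
  ultimately show ?case unfolding Q_def by (intro exI [of _ "\<lambda>j. \<theta> * u j + (1 - \<theta>) * v j"] conjI)
qed

text \<open>Pair \<open>p\<close> with both sides of Marsden's identity; on the left this gives the value of \<open>p\<close> at \<open>x\<close>.\<close>

lemma poly_bound_bcoef:
  assumes r: "r < m" "b r \<le> x" "x \<le> b (Suc r)" and p: "degree p \<le> d"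
  shows "\<bar>poly p x\<bar> \<le> (\<Sum>i\<in>{r..r + d}. \<bar>bcoef p i\<bar>)"
proof -
  obtain w where w: "\<And>j. 0 \<le> w j" "(\<Sum>j\<in>{r..r + d}. w j) = (1::real)"
    "[:x, -1:] ^ d = (\<Sum>j\<in>{r..r + d}. smult (w j) (\<psi> j))"
    using marsden_step [OF r, of d "r + d"] by auto
  have w1: "w j \<le> 1" if "j \<in> {r..r + d}" for j
    using member_le_sum [of j "{r..r + d}" w] w that by auto
  have "(-1) ^ d * fact d * poly p x = poly (apolar d p ([:x, -1:] ^ d)) x"
    by (rule apolar_linear_power [symmetric])
  also have "\<dots> = (\<Sum>j\<in>{r..r + d}. w j * poly (apolar d p (\<psi> j)) x)"
    unfolding w(3) apolar_sum_right poly_sum by simp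
  also have "\<dots> = (\<Sum>j\<in>{r..r + d}. w j * (fact d * bcoef p j))"
    using apolar_const [OF p degree_\<psi>, of _ x 0] by (simp add: bcoef_def)
  also have "\<dots> = fact d * (\<Sum>j\<in>{r..r + d}. w j * bcoef p j)"
    by (simp add: sum_distrib_left mult_ac)
  finally have "\<bar>fact d * poly p x\<bar> = \<bar>fact d * (\<Sum>j\<in>{r..r + d}. w j * bcoef p j)\<bar>"
    by (cases "even d") auto
  then have "\<bar>poly p x\<bar> = \<bar>\<Sum>j\<in>{r..r + d}. w j * bcoef p j\<bar>" by (simp add: abs_mult)
  also have "\<dots> \<le> (\<Sum>j\<in>{r..r + d}. \<bar>bcoef p j\<bar>)"
    using w w1 by (intro order_trans [OF sum_abs sum_mono]) (auto simp: abs_mult intro!: mult_left_le_one_le)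
  finally show ?thesis .
qed

text \<open>The knot shared by two neighbouring atoms of the support is a root of \<open>\<psi> i\<close>.\<close>

lemma bcoef_eq_on_support:
  assumes deg: "\<And>r. r < m \<Longrightarrow> degree (p r) \<le> d"
    and jet: "\<And>r \<nu>. Suc r < m \<Longrightarrow> \<nu> < d \<Longrightarrow>
      poly ((pderiv ^^ \<nu>) (p r)) (b (Suc r)) = poly ((pderiv ^^ \<nu>) (p (Suc r))) (b (Suc r))"
    and "r \<le> r'" "r' < m" "r' \<le> i" "i \<le> r + d"
  shows "bcoef (p r) i = bcoef (p r') i"
  using assms(3-6)
proof (induction r' rule: dec_induct)
  case (step r')
  have mem: "Suc r' + d - i \<in> {1..d}" "i + (Suc r' + d - i) = Suc r' + d" using step by auto
  have zero: "poly (\<psi> i) (b (Suc r')) = 0"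
    unfolding \<psi>_def poly_prod using step mem t_shift [of "Suc r'"]
    by (intro prod_zero bexI [of _ "Suc r' + d - i"]) auto
  have "poly (apolar d (p r') (\<psi> i)) (b (Suc r')) = poly (apolar d (p (Suc r')) (\<psi> i)) (b (Suc r'))"
    using step.prems by (intro apolar_common_jet jet zero) auto
  then have "bcoef (p r') i = bcoef (p (Suc r')) i"
    using apolar_const [OF deg degree_\<psi>, of r' i "b (Suc r')" 0]
      apolar_const [OF deg degree_\<psi>, of "Suc r'" i "b (Suc r')" 0] step.prems
    by (simp add: bcoef_def)
  then show ?case using step by simp
qed simp

lemma large_atom_in_support:
  assumes "i < m + d"
  obtains r where "r < m" "r \<le> i" "i \<le> r + d" "t (i + d + 1) - t i \<le> (real d + 1) * (b (Suc r) - b r)"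
proof -
  let ?L = "t (i + d + 1) - t i"
  have L: "0 < ?L" using support_nonempty [OF assms] by simp
  have tel: "(\<Sum>j<Suc d. t (Suc (i + j)) - t (i + j)) = ?L"
    using sum_lessThan_telescope [of "\<lambda>j. t (i + j)" "Suc d"] by simp
  have "\<exists>j<Suc d. ?L / (real d + 1) \<le> t (Suc (i + j)) - t (i + j)"
  proof (rule ccontr)
    assume "\<not> ?thesis"
    then have "(\<Sum>j<Suc d. t (Suc (i + j)) - t (i + j)) < (\<Sum>j<Suc d. ?L / (real d + 1))"
      by (intro sum_strict_mono) auto
    also have "\<dots> = real (Suc d) * (?L / real (Suc d))" by (simp add: add.commute)
    also have "\<dots> = ?L" by (simp del: of_nat_Suc)
    finally show False using tel by simp
  qed
  then obtain j where j: "j \<le> d" "?L / (real d + 1) \<le> t (Suc (i + j)) - t (i + j)" by (auto simp: less_Suc_eq_le)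
  moreover have "0 < ?L / (real d + 1)" using L by simp
  ultimately have "t (i + j) < t (Suc (i + j))" by linarith
  then have *: "d \<le> i + j" "i + j < m + d" using t_less_iff_atom by auto
  define r where "r = i + j - d"
  have r: "r < m" "i + j = r + d" using * by (auto simp: r_def)
  have "?L \<le> (real d + 1) * (b (Suc r) - b r)"
  proof -
    have "b r = t (i + j)" "b (Suc r) = t (Suc (i + j))"
      using t_shift [of r] t_shift [of "Suc r"] r by auto
    moreover have "0 < real d + 1" by simp
    ultimately show ?thesis using j(2) by (metis pos_divide_le_eq mult.commute)
  qed
  moreover have "r \<le> i" "i \<le> r + d" using j r by auto
  ultimately show ?thesis using that r by blast
qed

definition stability_const :: real where
  "stability_const = (real d + 1) ^ (2 * d + 2) * (2 * (real d + 1)\<^sup>2) ^ d"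

lemma bcoef_bound_on_half:
  assumes r: "r < m" "r \<le> i" "i \<le> r + d" "t (i + d + 1) - t i \<le> (real d + 1) * (b (Suc r) - b r)"
    and p: "degree p \<le> d"
    and B: "B \<in> lmeasurable" "B \<subseteq> {b r..b (Suc r)}" "(b (Suc r) - b r) / 2 \<le> measure lebesgue B"
      "\<And>x. x \<in> B \<Longrightarrow> \<bar>poly p x\<bar> \<le> \<eta>"
  shows "\<bar>bcoef p i\<bar> \<le> \<eta> * stability_const"
proof -
  let ?J = "b (Suc r) - b r" and ?R = "t (i + d + 1) - t i"
  define \<delta> where "\<delta> = ?J / (2 * (real d + 1))"
  have J: "0 < ?J" using b_less_Suc r by simp
  then have \<delta>: "0 < \<delta>" by (simp add: \<delta>_def)
  have "real d * \<delta> < ?J / 2" using J by (simp add: \<delta>_def field_simps)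
  then have d\<delta>: "real d * \<delta> < measure lebesgue B" using B(3) by linarith
  have R: "0 < ?R" using support_nonempty [of i] r by simp
  have sub: "b r \<ge> t i" "b (Suc r) \<le> t (i + d + 1)"
    using t_mono [of i "r + d"] t_mono [of "Suc r + d" "i + d + 1"] t_shift [of r] t_shift [of "Suc r"] r by auto
  have Bs: "B \<subseteq> {t i..t i + ?R}" using B(2) sub by auto
  have \<tau>: "t (i + l) \<in> {t i..t i + ?R}" if "l \<in> {1..d}" for l
    using t_mono [of i "i + l"] t_mono [of "i + l" "i + d + 1"] that by auto
  have "0 \<le> \<eta>"
  proof -
    have "B \<noteq> {}" using B(3) J by auto
    then show ?thesis using B(4) by fastforce
  qed
  have "\<bar>poly (apolar d p (\<psi> i)) 0\<bar> \<le> \<eta> * ((real d + 1) ^ (2 * d + 2) * (?R / \<delta>) ^ d)"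
    unfolding \<psi>_def by (rule apolar_bound_of_bound_on_set [OF p B(1) Bs \<delta> R d\<delta> B(4) \<tau>])
  also have "?R / \<delta> \<le> 2 * (real d + 1)\<^sup>2"
  proof -
    have "?R / \<delta> \<le> ((real d + 1) * ?J) / \<delta>" using r(4) \<delta> by (intro divide_right_mono) auto
    also have "\<dots> = 2 * (real d + 1)\<^sup>2" using J by (simp add: \<delta>_def power2_eq_square)
    finally show ?thesis .
  qed
  then have "\<eta> * ((real d + 1) ^ (2 * d + 2) * (?R / \<delta>) ^ d) \<le> \<eta> * stability_const"
    unfolding stability_const_def using R \<delta> \<open>0 \<le> \<eta>\<close> by (intro mult_left_mono power_mono) auto
  finally have "\<bar>poly (apolar d p (\<psi> i)) 0\<bar> \<le> \<eta> * stability_const" .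
  moreover have "\<bar>bcoef p i\<bar> \<le> \<bar>poly (apolar d p (\<psi> i)) 0\<bar>"
  proof -
    have "\<bar>bcoef p i\<bar> = \<bar>poly (apolar d p (\<psi> i)) 0\<bar> / fact d" by (simp add: bcoef_def)
    also have "\<dots> \<le> \<bar>poly (apolar d p (\<psi> i)) 0\<bar> / 1" by (intro divide_left_mono) auto
    finally show ?thesis by simp
  qed
  ultimately show ?thesis by simp
qed

text \<open>Otherwise \<open>\<bar>p\<bar>\<close> would be less than \<open>\<bar>bcoef p i\<bar> / (2 * stability_const)\<close> on half of the atom, and the
  preceding lemma would bound \<open>\<bar>bcoef p i\<bar>\<close> by half of itself.\<close>

lemma bcoef_good_set:
  assumes r: "r < m" "r \<le> i" "i \<le> r + d" "t (i + d + 1) - t i \<le> (real d + 1) * (b (Suc r) - b r)"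
    and p: "degree p \<le> d" and nz: "bcoef p i \<noteq> 0"
  defines "G \<equiv> {x\<in>{b r<..<b (Suc r)}. \<bar>bcoef p i\<bar> \<le> 2 * stability_const * \<bar>poly p x\<bar>}"
  shows "G \<in> lmeasurable" "t (i + d + 1) - t i \<le> 2 * (real d + 1) * measure lebesgue G"
proof -
  have "G = {b r<..<b (Suc r)} \<inter> {x. \<bar>bcoef p i\<bar> \<le> 2 * stability_const * \<bar>poly p x\<bar>}"
    unfolding G_def by blast
  moreover have "closed {x. \<bar>bcoef p i\<bar> \<le> 2 * stability_const * \<bar>poly p x\<bar>}"
    by (intro closed_Collect_le continuous_intros)
  then have "{x. \<bar>bcoef p i\<bar> \<le> 2 * stability_const * \<bar>poly p x\<bar>} \<in> sets lebesgue"
    by (simp add: borel_closed sets_completionI_sets)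
  then have "{b r<..<b (Suc r)} \<inter> {x. \<bar>bcoef p i\<bar> \<le> 2 * stability_const * \<bar>poly p x\<bar>} \<in> lmeasurable"
    by (intro fmeasurable_Int_fmeasurable) (use lmeasurable_box [of "b r" "b (Suc r)"] in simp_all)
  ultimately show G: "G \<in> lmeasurable" by simp
  let ?J = "b (Suc r) - b r"
  have J: "0 < ?J" using b_less_Suc r by simp
  have K: "0 < stability_const" by (simp add: stability_const_def)
  have "?J / 2 \<le> measure lebesgue G"
  proof (rule ccontr)
    assume less: "\<not> ?thesis"
    define B where "B = {b r<..<b (Suc r)} - G"
    have sub: "G \<subseteq> {b r<..<b (Suc r)}" by (auto simp: G_def)
    have B: "B \<in> lmeasurable" unfolding B_def using G by (intro fmeasurable.Diff) auto
    have "measure lebesgue B = measure lebesgue {b r<..<b (Suc r)} - measure lebesgue G"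
      unfolding B_def using G sub by (intro measurable_measure_Diff) auto
    then have "?J / 2 \<le> measure lebesgue B" using less J by simp
    moreover have "\<bar>poly p x\<bar> \<le> \<bar>bcoef p i\<bar> / (2 * stability_const)" if "x \<in> B" for x
      using that K by (auto simp: B_def G_def field_simps)
    ultimately have "\<bar>bcoef p i\<bar> \<le> \<bar>bcoef p i\<bar> / (2 * stability_const) * stability_const"
      by (intro bcoef_bound_on_half [OF r p B]) (auto simp: B_def)
    then show False using K nz by simp
  qed
  then have "(real d + 1) * (?J / 2) \<le> (real d + 1) * measure lebesgue G" by (intro mult_left_mono) auto
  then show "t (i + d + 1) - t i \<le> 2 * (real d + 1) * measure lebesgue G" using r(4) by linarith
qed

end

section \<open>The grid of an interval \<open>\<sigma>\<close>-algebra\<close>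

lemma sigma_sets_partition_cases:
  assumes "partition_on \<Omega> P" "X \<in> sigma_sets \<Omega> P" "B \<in> P"
  shows "B \<subseteq> X \<or> B \<inter> X = {}"
  using assms(2)
proof (induction rule: sigma_sets.induct)
  case (Basic a)
  then show ?case using assms by (auto simp: partition_on_def disjoint_def)
next
  case (Compl a)
  have "B \<subseteq> \<Omega>" using assms by (auto simp: partition_on_def)
  then show ?case using Compl by blast
next
  case (Union a)
  then show ?case by blast
qed simp

lemma atoms_sigma_sets_partition:
  assumes "partition_on {0..1} P"
  shows "atoms (sigma_sets {0..1} P) = P"
proof (intro subset_antisym subsetI)
  fix A assume A: "A \<in> P"
  then have "A \<noteq> {}" using assms by (auto simp: partition_on_def)
  then show "A \<in> atoms (sigma_sets {0..1} P)"
    using sigma_sets_partition_cases [OF assms _ A] A unfolding atoms_def by auto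
next
  fix A assume A: "A \<in> atoms (sigma_sets {0..1} P)"
  have "A \<subseteq> {0..1}"
    using A sigma_sets_into_sp [of P "{0..1}" A] assms by (auto simp: atoms_def partition_on_def)
  moreover obtain x where x: "x \<in> A" using A by (auto simp: atoms_def)
  ultimately obtain B where B: "B \<in> P" "x \<in> B" using assms by (auto simp: partition_on_def)
  have "B \<subseteq> A" using sigma_sets_partition_cases [OF assms _ B(1), of A] A x B by (auto simp: atoms_def)
  then show "A \<in> P" using A B by (auto simp: atoms_def)
qed

lemma interval_sigma_algebra_atoms:
  assumes "interval_sigma_algebra \<F>"
  shows "finite (atoms \<F>)" "partition_on {0..1} (atoms \<F>)" "\<F> = sigma_sets {0..1} (atoms \<F>)"
    "A \<in> atoms \<F> \<Longrightarrow> is_interval A \<and> 0 < measure lebesgue A"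
proof -
  obtain P where P: "finite P" "partition_on {0..1} P"
    "\<forall>A\<in>P. is_interval A \<and> 0 < measure lebesgue A" "\<F> = sigma_sets {0..1} P"
    using assms unfolding interval_sigma_algebra_def by blast
  have "atoms \<F> = P" unfolding P(4) by (rule atoms_sigma_sets_partition [OF P(2)])
  then show "finite (atoms \<F>)" "partition_on {0..1} (atoms \<F>)" "\<F> = sigma_sets {0..1} (atoms \<F>)"
    "A \<in> atoms \<F> \<Longrightarrow> is_interval A \<and> 0 < measure lebesgue A"
    using P by auto
qed

lemma atom_containing:
  assumes "interval_sigma_algebra \<F>" "x \<in> {0..1}"
  obtains A where "A \<in> atoms \<F>" "x \<in> A"
proof -
  have "\<Union>(atoms \<F>) = {0..1}"
    using interval_sigma_algebra_atoms(2) [OF assms(1)] by (auto simp: partition_on_def)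
  then show ?thesis using assms(2) that by blast
qed

lemma atom_between_endpoints:
  assumes "interval_sigma_algebra \<F>" "A \<in> atoms \<F>"
  shows "Inf A < Sup A" "{Inf A<..<Sup A} \<subseteq> A" "A \<subseteq> {Inf A..Sup A}" "0 \<le> Inf A" "Sup A \<le> 1"
proof -
  note P = interval_sigma_algebra_atoms [OF assms(1)]
  have A: "is_interval A" "0 < measure lebesgue A" using P(4) assms(2) by auto
  have sub: "A \<subseteq> {0..1}" "A \<noteq> {}" using P(2) assms(2) by (auto simp: partition_on_def)
  have bdd: "bdd_below A" "bdd_above A"
    using sub(1) by (auto intro: bdd_below_mono [of "{0..1}"] bdd_above_mono [of "{0..1}"])
  show in_hull: "A \<subseteq> {Inf A..Sup A}" using bdd by (auto intro: cInf_lower cSup_upper)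
  show "0 \<le> Inf A" using sub by (intro cInf_greatest) auto
  show "Sup A \<le> 1" using sub by (intro cSup_least) auto
  show "{Inf A<..<Sup A} \<subseteq> A"
  proof
    fix x assume "x \<in> {Inf A<..<Sup A}"
    then obtain y z where "y \<in> A" "z \<in> A" "y < x" "x < z"
      using cInf_less_iff [OF sub(2) bdd(1)] less_cSup_iff [OF sub(2) bdd(2)] by auto
    then show "x \<in> A" using A(1) by (meson less_imp_le mem_is_interval_1_I)
  qed
  show "Inf A < Sup A"
  proof (rule ccontr)
    assume "\<not> ?thesis"
    then have "A \<subseteq> {Inf A}" using in_hull by fastforce
    then have "negligible A" by (meson finite.emptyI finite_insert negligible_finite negligible_subset)
    then show False using A(2) by (simp add: negligible_imp_measure0)
  qed
qed

abbreviation endpoints :: "real set set \<Rightarrow> real set" where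
  "endpoints \<F> \<equiv> Inf ` atoms \<F> \<union> Sup ` atoms \<F>"

text \<open>An atom that begins or ends inside \<open>A\<close> would have to overlap \<open>A\<close>.\<close>

lemma endpoints_not_inside_atom:
  assumes \<F>: "interval_sigma_algebra \<F>" and "A \<in> atoms \<F>" "y \<in> endpoints \<F>"
  shows "\<not> (Inf A < y \<and> y < Sup A)"
proof
  assume y: "Inf A < y \<and> y < Sup A"
  obtain B where B: "B \<in> atoms \<F>" "y = Inf B \<or> y = Sup B" using assms(3) by auto
  note A' = atom_between_endpoints [OF \<F> assms(2)] and B' = atom_between_endpoints [OF \<F> B(1)]
  have "A \<inter> B \<noteq> {}"
  proof (cases "y = Inf B")
    case True
    define z where "z = (y + min (Sup A) (Sup B)) / 2"
    have "Inf A < z" "z < Sup A" "Inf B < z" "z < Sup B"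
      using y True B'(1) by (auto simp: z_def min_def field_simps)
    then have "z \<in> A \<inter> B" using A'(2) B'(2) by auto
    then show ?thesis by blast
  next
    case False
    then have y2: "y = Sup B" using B by simp
    define z where "z = (y + max (Inf A) (Inf B)) / 2"
    have "Inf A < z" "z < Sup A" "Inf B < z" "z < Sup B"
      using y y2 B'(1) by (auto simp: z_def max_def field_simps)
    then have "z \<in> A \<inter> B" using A'(2) B'(2) by auto
    then show ?thesis by blast
  qed
  then have "A = B" using interval_sigma_algebra_atoms(2) [OF \<F>] assms(2) B(1)
    by (auto simp: partition_on_def disjoint_def)
  then show False using y B(2) by auto
qed

definition grid_size :: "real set set \<Rightarrow> nat" where "grid_size \<F> = length (breakpoints \<F>) - 1"
definition grid_pt :: "real set set \<Rightarrow> nat \<Rightarrow> real" where "grid_pt \<F> r = breakpoints \<F> ! r"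

lemma grid_of_interval_sigma_algebra:
  assumes \<F>: "interval_sigma_algebra \<F>"
  shows length_breakpoints: "length (breakpoints \<F>) = Suc (grid_size \<F>)"
    and spline_grid_sigma_algebra: "spline_grid (grid_size \<F>) (grid_pt \<F>)"
    and grid_pt_image: "grid_pt \<F> ` {..grid_size \<F>} = endpoints \<F>"
    and grid_pt_0: "grid_pt \<F> 0 = 0" and grid_pt_last: "grid_pt \<F> (grid_size \<F>) = 1"
proof -
  let ?D = "endpoints \<F>" and ?L = "breakpoints \<F>"
  note P = interval_sigma_algebra_atoms [OF \<F>]
  have fin: "finite ?D" using P(1) by simp
  have set: "set ?L = ?D" using fin by (simp add: breakpoints_def)
  have len: "length ?L = card ?D" by (simp add: breakpoints_def)
  have sorted: "sorted_wrt (<) ?L" by (simp add: breakpoints_def)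
  obtain A0 where A0: "A0 \<in> atoms \<F>" "0 \<in> A0" using atom_containing [OF \<F>, of 0] by auto
  obtain A1 where A1: "A1 \<in> atoms \<F>" "1 \<in> A1" using atom_containing [OF \<F>, of 1] by auto
  have range: "0 \<le> y \<and> y \<le> 1" if y: "y \<in> ?D" for y
  proof -
    obtain A where A: "A \<in> atoms \<F>" "y = Inf A \<or> y = Sup A" using y by blast
    show ?thesis using atom_between_endpoints(1,4,5) [OF \<F> A(1)] A(2) by auto
  qed
  have D0: "0 \<in> ?D" using atom_between_endpoints [OF \<F> A0(1)] A0 by (auto intro!: image_eqI [of _ _ A0])
  have D1: "1 \<in> ?D" using atom_between_endpoints [OF \<F> A1(1)] A1 by (auto intro!: image_eqI [of _ _ A1])
  have "card {0, 1 :: real} \<le> card ?D" using D0 D1 fin by (intro card_mono) auto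
  then have len2: "2 \<le> length ?L" using len by simp
  then show length_L: "length ?L = Suc (grid_size \<F>)" by (simp add: grid_size_def)
  show "spline_grid (grid_size \<F>) (grid_pt \<F>)"
    using sorted_wrt_nth_less [OF sorted] len2 length_L
    by unfold_locales (auto simp: grid_pt_def)
  show im: "grid_pt \<F> ` {..grid_size \<F>} = ?D"
    unfolding set [symmetric] set_conv_nth length_L grid_pt_def by (auto simp: less_Suc_eq_le)
  have mono: "grid_pt \<F> r \<le> grid_pt \<F> s" if "r \<le> s" "s \<le> grid_size \<F>" for r s
    using sorted_wrt_nth_less [OF sorted, of r s] that length_L by (cases "r = s") (auto simp: grid_pt_def)
  obtain r0 r1 where r: "r0 \<le> grid_size \<F>" "grid_pt \<F> r0 = 0" "r1 \<le> grid_size \<F>" "grid_pt \<F> r1 = 1"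
    using D0 D1 unfolding im [symmetric] by auto
  have rng: "0 \<le> grid_pt \<F> r \<and> grid_pt \<F> r \<le> 1" if "r \<le> grid_size \<F>" for r
    using that range im by (metis atMost_iff image_eqI)
  show "grid_pt \<F> 0 = 0" using mono [of 0 r0] r rng [of 0] by simp
  show "grid_pt \<F> (grid_size \<F>) = 1" using mono [of r1 "grid_size \<F>"] r rng [of "grid_size \<F>"] by simp
qed

lemma atom_is_grid_interval:
  assumes \<F>: "interval_sigma_algebra \<F>" and A: "A \<in> atoms \<F>"
  obtains r where "r < grid_size \<F>" "Inf A = grid_pt \<F> r" "Sup A = grid_pt \<F> (Suc r)"
proof -
  interpret spline_grid 0 "grid_size \<F>" "grid_pt \<F>" by (rule spline_grid_sigma_algebra [OF \<F>])
  have "Inf A \<in> endpoints \<F>" "Sup A \<in> endpoints \<F>" using A by auto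
  then obtain r s where rs: "r \<le> grid_size \<F>" "Inf A = grid_pt \<F> r" "s \<le> grid_size \<F>" "Sup A = grid_pt \<F> s"
    unfolding grid_pt_image [OF \<F>, symmetric] by auto
  have "r < s"
    using atom_between_endpoints(1) [OF \<F> A] b_le [of s r] rs by (cases "r < s") auto
  have "s = Suc r"
  proof (rule ccontr)
    assume "s \<noteq> Suc r"
    then have "Suc r < s" using \<open>r < s\<close> by simp
    then have "Inf A < grid_pt \<F> (Suc r)" "grid_pt \<F> (Suc r) < Sup A"
      using b_less [of r "Suc r"] b_less [of "Suc r" s] rs by auto
    moreover have "grid_pt \<F> (Suc r) \<in> endpoints \<F>"
      unfolding grid_pt_image [OF \<F>, symmetric] using \<open>Suc r < s\<close> rs by auto
    ultimately show False using endpoints_not_inside_atom [OF \<F> A] by blast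
  qed
  then show ?thesis using that [of r] rs by simp
qed

lemma mem_atom_of_grid_interval:
  assumes \<F>: "interval_sigma_algebra \<F>" and A: "A \<in> atoms \<F>"
    and r: "r < grid_size \<F>" and x: "x \<in> {grid_pt \<F> r<..<grid_pt \<F> (Suc r)}"
  shows "x \<in> A \<longleftrightarrow> Inf A = grid_pt \<F> r" "x \<in> A \<longleftrightarrow> Sup A = grid_pt \<F> (Suc r)"
proof -
  interpret spline_grid 0 "grid_size \<F>" "grid_pt \<F>" by (rule spline_grid_sigma_algebra [OF \<F>])
  obtain s where s: "s < grid_size \<F>" "Inf A = grid_pt \<F> s" "Sup A = grid_pt \<F> (Suc s)"
    using atom_is_grid_interval [OF \<F> A] .
  note A' = atom_between_endpoints [OF \<F> A]
  have "x \<in> A \<longleftrightarrow> s = r"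
  proof
    assume "x \<in> A"
    then have "grid_pt \<F> s \<le> x" "x \<le> grid_pt \<F> (Suc s)" using A'(3) s by auto
    then have "\<not> Suc r \<le> s" "\<not> Suc s \<le> r"
      using x b_le [of "Suc r" s] b_le [of "Suc s" r] s r by auto
    then show "s = r" by simp
  qed (use A'(2) s x in auto)
  moreover have "Inf A = grid_pt \<F> r \<longleftrightarrow> s = r" "Sup A = grid_pt \<F> (Suc r) \<longleftrightarrow> s = r"
    using s r b_less [of s r] b_less [of r s] b_less [of "Suc s" "Suc r"] b_less [of "Suc r" "Suc s"]
    by (auto, (metis less_irrefl linorder_neqE_nat less_imp_le_nat Suc_leI Suc_mono)+)
  ultimately show "x \<in> A \<longleftrightarrow> Inf A = grid_pt \<F> r" "x \<in> A \<longleftrightarrow> Sup A = grid_pt \<F> (Suc r)" by auto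
qed

lemma grid_interval_in_atom:
  assumes \<F>: "interval_sigma_algebra \<F>" and r: "r < grid_size \<F>"
  obtains A where "A \<in> atoms \<F>" "Inf A = grid_pt \<F> r" "Sup A = grid_pt \<F> (Suc r)"
    "{grid_pt \<F> r<..<grid_pt \<F> (Suc r)} \<subseteq> A"
proof -
  interpret spline_grid 0 "grid_size \<F>" "grid_pt \<F>" by (rule spline_grid_sigma_algebra [OF \<F>])
  define x where "x = (grid_pt \<F> r + grid_pt \<F> (Suc r)) / 2"
  have x: "x \<in> {grid_pt \<F> r<..<grid_pt \<F> (Suc r)}" using b_less_Suc [OF r] by (simp add: x_def)
  have "x \<in> {0..1}" using x b_le [of 0 r] b_le [of "Suc r" "grid_size \<F>"] r
      grid_pt_0 [OF \<F>] grid_pt_last [OF \<F>] by auto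
  then obtain A where A: "A \<in> atoms \<F>" "x \<in> A" by (rule atom_containing [OF \<F>])
  then have "Inf A = grid_pt \<F> r" "Sup A = grid_pt \<F> (Suc r)"
    using mem_atom_of_grid_interval [OF \<F> A(1) r x] by auto
  then show ?thesis using that [of A] A atom_between_endpoints(2) [OF \<F> A(1)] by auto
qed

text \<open>Every atom of the coarser \<open>\<sigma>\<close>-algebra is a finite union of atoms of the finer one, so its infimum and its supremum are among theirs.\<close>

lemma endpoints_mono:
  assumes \<F>: "interval_sigma_algebra \<F>" and \<G>: "interval_sigma_algebra \<G>" and "\<F> \<subseteq> \<G>"
  shows "endpoints \<F> \<subseteq> endpoints \<G>"
proof -
  note P = interval_sigma_algebra_atoms [OF \<G>]
  have *: "Inf A \<in> endpoints \<G> \<and> Sup A \<in> endpoints \<G>" if A: "A \<in> atoms \<F>" for A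
  proof -
    have "A \<in> \<G>" using A assms(3) by (auto simp: atoms_def)
    then have cases: "B \<subseteq> A \<or> B \<inter> A = {}" if "B \<in> atoms \<G>" for B
      using sigma_sets_partition_cases [OF P(2) _ that] P(3) by auto
    define Q where "Q = {B \<in> atoms \<G>. B \<subseteq> A}"
    have finQ: "finite Q" using P(1) by (simp add: Q_def)
    have "A \<subseteq> {0..1}" using interval_sigma_algebra_atoms(2) [OF \<F>] A by (auto simp: partition_on_def)
    then have A_eq: "A = \<Union>Q" using cases P(2) unfolding Q_def partition_on_def by blast
    have "A \<noteq> {}" using A by (auto simp: atoms_def)
    then have neQ: "Q \<noteq> {}" using A_eq by auto
    note A' = atom_between_endpoints [OF \<F> A]
    have inQ: "Inf A \<le> Inf B \<and> Sup B \<le> Sup A" if "B \<in> Q" for B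
    proof -
      have B: "B \<in> atoms \<G>" "B \<subseteq> A" using that by (auto simp: Q_def)
      note B' = atom_between_endpoints [OF \<G> B(1)]
      have "\<not> Inf B < Inf A"
      proof
        assume less: "Inf B < Inf A"
        then have "(Inf B + min (Inf A) (Sup B)) / 2 \<in> {Inf B<..<Sup B}" using B'(1) by (auto simp: min_def field_simps)
        then have "(Inf B + min (Inf A) (Sup B)) / 2 \<in> A" using B'(2) B(2) by blast
        then show False using A'(3) less by (auto simp: min_def field_simps split: if_splits)
      qed
      moreover have "\<not> Sup A < Sup B"
      proof
        assume less: "Sup A < Sup B"
        then have "(Sup B + max (Sup A) (Inf B)) / 2 \<in> {Inf B<..<Sup B}" using B'(1) by (auto simp: max_def field_simps)
        then have "(Sup B + max (Sup A) (Inf B)) / 2 \<in> A" using B'(2) B(2) by blast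
        then show False using A'(3) less by (auto simp: max_def field_simps split: if_splits)
      qed
      ultimately show ?thesis by auto
    qed
    have "Min (Inf ` Q) \<le> Inf A"
    proof (intro cInf_greatest)
      fix x assume "x \<in> A"
      then obtain B where B: "B \<in> Q" "x \<in> B" using A_eq by blast
      then have "Inf B \<le> x" using atom_between_endpoints(3) [OF \<G>, of B] by (auto simp: Q_def)
      then show "Min (Inf ` Q) \<le> x" using B finQ by (meson Min_le finite_imageI image_eqI order_trans)
    qed fact
    moreover have "Inf A \<le> Min (Inf ` Q)" using finQ neQ inQ by (subst Min_ge_iff) auto
    ultimately have "Inf A = Min (Inf ` Q)" by simp
    then have inf: "Inf A \<in> Inf ` Q" using Min_in [of "Inf ` Q"] finQ neQ by simp
    have "Sup A \<le> Max (Sup ` Q)"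
    proof (intro cSup_least)
      fix x assume "x \<in> A"
      then obtain B where B: "B \<in> Q" "x \<in> B" using A_eq by blast
      then have "x \<le> Sup B" using atom_between_endpoints(3) [OF \<G>, of B] by (auto simp: Q_def)
      then show "x \<le> Max (Sup ` Q)" using B finQ by (meson Max_ge finite_imageI image_eqI order_trans)
    qed fact
    moreover have "Max (Sup ` Q) \<le> Sup A" using finQ neQ inQ by (subst Max_le_iff) auto
    ultimately have "Sup A = Max (Sup ` Q)" by simp
    then have "Sup A \<in> Sup ` Q" using Max_in [of "Sup ` Q"] finQ neQ by simp
    with inf show ?thesis by (auto simp: Q_def)
  qed
  then show ?thesis by auto
qed

section \<open>Supports of the B-splines and regularity\<close>

lemma knots_nth:
  assumes \<F>: "interval_sigma_algebra \<F>"
  shows "length (knots (Suc d) \<F>) = grid_size \<F> + 2 * d + 1"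
    and "j \<le> grid_size \<F> + 2 * d \<Longrightarrow> knots (Suc d) \<F> ! j = spline_grid.t d (grid_size \<F>) (grid_pt \<F>) j"
    and "num_bsplines (Suc d) \<F> = grid_size \<F> + d"
proof -
  interpret spline_grid d "grid_size \<F>" "grid_pt \<F>" by (rule spline_grid_sigma_algebra [OF \<F>])
  note L = length_breakpoints [OF \<F>]
  show len: "length (knots (Suc d) \<F>) = grid_size \<F> + 2 * d + 1"
    by (simp add: knots_def L)
  show "num_bsplines (Suc d) \<F> = grid_size \<F> + d"
    unfolding num_bsplines_def len by simp
  assume j: "j \<le> grid_size \<F> + 2 * d"
  show "knots (Suc d) \<F> ! j = t j"
  proof (cases "j < d")
    case True
    then show ?thesis by (simp add: knots_def nth_append t_def grid_pt_0 [OF \<F>])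
  next
    case False
    show ?thesis
    proof (cases "j - d \<le> grid_size \<F>")
      case True
      then show ?thesis using False by (simp add: knots_def nth_append t_def L grid_pt_def)
    next
      case F2: False
      then have "j - d - Suc (grid_size \<F>) < d" using j by linarith
      then show ?thesis using False F2 by (simp add: knots_def nth_append t_def L grid_pt_last [OF \<F>])
    qed
  qed
qed

text \<open>In the interior of an atom the recursion is the usual one and combines non-negative terms with positive
  weights. Breakpoints are left out: there the value depends on which of the two atoms owns the
  point, and finitely many points do not change the measure of the support.\<close>

lemma bspline_deg_sign:
  assumes \<F>: "interval_sigma_algebra \<F>"
    and r: "r < grid_size \<F>" and x: "x \<in> {grid_pt \<F> r<..<grid_pt \<F> (Suc r)}"
    and "i + e + 1 \<le> grid_size \<F> + 2 * d"
  shows "if i \<le> r + d \<and> r + d \<le> i + e then 0 < bspline_deg \<F> (knots (Suc d) \<F>) e i x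
    else bspline_deg \<F> (knots (Suc d) \<F>) e i x = 0"
  using assms(4)
proof (induction e arbitrary: i)
  interpret spline_grid d "grid_size \<F>" "grid_pt \<F>" by (rule spline_grid_sigma_algebra [OF \<F>])
  case 0
  have kn: "knots (Suc d) \<F> ! i = t i" "knots (Suc d) \<F> ! (i + 1) = t (i + 1)"
    using 0 by (simp_all add: knots_nth(2) [OF \<F>])
  have tr: "t (r + d) = grid_pt \<F> r" "t (r + d + 1) = grid_pt \<F> (Suc r)"
    using t_shift [of r] t_shift [of "Suc r"] r by auto
  let ?U = "\<Union>{A\<in>atoms \<F>. Inf A = t i \<and> Sup A = t (i + 1)}"
  have "x \<in> ?U \<longleftrightarrow> i = r + d"
  proof
    assume "x \<in> ?U"
    then obtain A where A: "A \<in> atoms \<F>" "Inf A = t i" "Sup A = t (i + 1)" "x \<in> A" by auto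
    then have *: "t i = t (r + d)" "t (i + 1) = t (r + d + 1)"
      using mem_atom_of_grid_interval [OF \<F> A(1) r x] tr by auto
    have lt: "t (r + d) < t (r + d + 1)" using b_less_Suc [OF r] tr by simp
    have "\<not> i < r + d" using t_mono [of "i + 1" "r + d"] * lt by auto
    moreover have "\<not> r + d < i" using t_mono [of "r + d + 1" i] * lt by auto
    ultimately show "i = r + d" by simp
  next
    assume i: "i = r + d"
    obtain A where "A \<in> atoms \<F>" "Inf A = grid_pt \<F> r" "Sup A = grid_pt \<F> (Suc r)"
      "{grid_pt \<F> r<..<grid_pt \<F> (Suc r)} \<subseteq> A"
      using grid_interval_in_atom [OF \<F> r] .
    then show "x \<in> ?U" using i tr x by auto
  qed
  moreover have "bspline_deg \<F> (knots (Suc d) \<F>) 0 i x = indicator ?U x"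
    by (simp only: bspline_deg.simps kn)
  ultimately show ?case by (auto simp: indicator_def)
next
  interpret spline_grid d "grid_size \<F>" "grid_pt \<F>" by (rule spline_grid_sigma_algebra [OF \<F>])
  case (Suc e)
  let ?N = "bspline_deg \<F> (knots (Suc d) \<F>)"
  have kn: "knots (Suc d) \<F> ! i = t i" "knots (Suc d) \<F> ! (i + 1) = t (i + 1)"
    "knots (Suc d) \<F> ! (i + e + 1) = t (i + e + 1)" "knots (Suc d) \<F> ! (i + e + 2) = t (i + e + 2)"
    using Suc.prems by (simp_all add: knots_nth(2) [OF \<F>])
  have tr: "t (r + d) < x" "x < t (r + d + 1)"
    using t_shift [of r] t_shift [of "Suc r"] r x by auto
  have rec: "?N (Suc e) i x = (x - t i) / (t (i + e + 1) - t i) * ?N e i x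
      + (t (i + e + 2) - x) / (t (i + e + 2) - t (i + 1)) * ?N e (i + 1) x"
    by (simp only: bspline_deg.simps kn)
  have IH1: "if i \<le> r + d \<and> r + d \<le> i + e then 0 < ?N e i x else ?N e i x = 0"
    using Suc.prems by (intro Suc.IH) auto
  have IH2: "if i + 1 \<le> r + d \<and> r + d \<le> i + 1 + e then 0 < ?N e (i + 1) x else ?N e (i + 1) x = 0"
    using Suc.prems by (intro Suc.IH) auto
  have f1: "if i \<le> r + d \<and> r + d \<le> i + e then 0 < (x - t i) / (t (i + e + 1) - t i) * ?N e i x
      else (x - t i) / (t (i + e + 1) - t i) * ?N e i x = 0"
  proof (cases "i \<le> r + d \<and> r + d \<le> i + e")
    case True
    then have "t i < x" "x < t (i + e + 1)"
      using tr t_mono [of i "r + d"] t_mono [of "r + d + 1" "i + e + 1"] by auto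
    then show ?thesis using True IH1 by simp
  qed (use IH1 in auto)
  have f2: "if i + 1 \<le> r + d \<and> r + d \<le> i + 1 + e
      then 0 < (t (i + e + 2) - x) / (t (i + e + 2) - t (i + 1)) * ?N e (i + 1) x
      else (t (i + e + 2) - x) / (t (i + e + 2) - t (i + 1)) * ?N e (i + 1) x = 0"
  proof (cases "i + 1 \<le> r + d \<and> r + d \<le> i + 1 + e")
    case True
    then have "t (i + 1) < x" "x < t (i + e + 2)"
      using tr t_mono [of "i + 1" "r + d"] t_mono [of "r + d + 1" "i + e + 2"] by auto
    then show ?thesis using True IH2 by simp
  qed (use IH2 in auto)
  show ?case unfolding rec using f1 f2 by (auto split: if_splits)
qed

lemma measure_bspline_supp:
  assumes \<F>: "interval_sigma_algebra \<F>" and i: "i < num_bsplines (Suc d) \<F>"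
  defines "t \<equiv> spline_grid.t d (grid_size \<F>) (grid_pt \<F>)"
  shows "measure lebesgue (bspline_supp (Suc d) \<F> i) = t (i + d + 1) - t i"
proof -
  interpret G: spline_grid d "grid_size \<F>" "grid_pt \<F>" by (rule spline_grid_sigma_algebra [OF \<F>])
  have i: "i < grid_size \<F> + d" using i knots_nth(3) [OF \<F>] by simp
  let ?N = "bspline (Suc d) \<F> i" and ?D = "grid_pt \<F> ` {..grid_size \<F>}"
  let ?S = "{x\<in>{0..1}. ?N x \<noteq> 0}"
  have lt: "t i < t (i + d + 1)" unfolding t_def using G.support_nonempty [OF i] .
  have N: "?N x \<noteq> 0 \<longleftrightarrow> x \<in> {t i<..<t (i + d + 1)}" if x: "x \<in> {0..1} - ?D" for x
  proof -
    obtain A where A: "A \<in> atoms \<F>" "x \<in> A" using x atom_containing [OF \<F>, of x] by auto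
    obtain r where r: "r < grid_size \<F>" "Inf A = grid_pt \<F> r" "Sup A = grid_pt \<F> (Suc r)"
      using atom_is_grid_interval [OF \<F> A(1)] .
    have "x \<in> {grid_pt \<F> r..grid_pt \<F> (Suc r)}"
      using atom_between_endpoints(3) [OF \<F> A(1)] A r by auto
    moreover have "x \<noteq> grid_pt \<F> r" "x \<noteq> grid_pt \<F> (Suc r)" using x r(1) by auto
    ultimately have xr: "x \<in> {grid_pt \<F> r<..<grid_pt \<F> (Suc r)}" by auto
    have tr: "t (r + d) < x" "x < t (r + d + 1)"
      using G.t_shift [of r] G.t_shift [of "Suc r"] r xr by (auto simp: t_def)
    have "?N x \<noteq> 0 \<longleftrightarrow> i \<le> r + d \<and> r + d \<le> i + d"
      using bspline_deg_sign [OF \<F> r(1) xr, of i d d] i by (auto simp: bspline_def split: if_splits)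
    also have "\<dots> \<longleftrightarrow> x \<in> {t i<..<t (i + d + 1)}"
    proof
      assume "i \<le> r + d \<and> r + d \<le> i + d"
      then show "x \<in> {t i<..<t (i + d + 1)}"
        using tr G.t_mono [of i "r + d"] G.t_mono [of "r + d + 1" "i + d + 1"] unfolding t_def [symmetric] by auto
    next
      assume x: "x \<in> {t i<..<t (i + d + 1)}"
      have "\<not> r + d + 1 \<le> i" using tr x G.t_mono [of "r + d + 1" i] unfolding t_def [symmetric] by auto
      moreover have "\<not> i + d + 1 \<le> r + d" using tr x G.t_mono [of "i + d + 1" "r + d"] unfolding t_def [symmetric] by auto
      ultimately show "i \<le> r + d \<and> r + d \<le> i + d" by linarith
    qed
    finally show ?thesis .
  qed
  have t01: "0 \<le> t i" "t (i + d + 1) \<le> 1"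
    using G.b_le [of 0 "min (grid_size \<F>) (i - d)"] G.b_le [of "min (grid_size \<F>) (i + 1)" "grid_size \<F>"]
      grid_pt_0 [OF \<F>] grid_pt_last [OF \<F>] by (auto simp: t_def G.t_def)
  have sub: "?S \<subseteq> {t i..t (i + d + 1)} \<union> ?D"
  proof
    fix x assume "x \<in> ?S"
    then show "x \<in> {t i..t (i + d + 1)} \<union> ?D" using N [of x] by (cases "x \<in> ?D") auto
  qed
  have "closed ({t i..t (i + d + 1)} \<union> ?D)" by (intro closed_Un closed_atLeastAtMost finite_imp_closed) auto
  then have upper: "closure ?S \<subseteq> {t i..t (i + d + 1)} \<union> ?D" using sub by (rule closure_minimal [rotated])
  have lower: "{t i<..<t (i + d + 1)} - ?D \<subseteq> closure ?S"
  proof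
    fix x assume x: "x \<in> {t i<..<t (i + d + 1)} - ?D"
    then have "x \<in> ?S" using N [of x] t01 by auto
    then show "x \<in> closure ?S" by (rule subsetD [OF closure_subset])
  qed
  have negD: "negligible ?D" by (intro negligible_finite) auto
  have "measure lebesgue (closure ?S) = measure lebesgue {t i..t (i + d + 1)}"
  proof (rule measure_negligible_symdiff)
    show "{t i..t (i + d + 1)} \<in> lmeasurable" by simp
    have "sym_diff {t i..t (i + d + 1)} (closure ?S) \<subseteq> ?D \<union> {t i, t (i + d + 1)}"
    proof
      fix x assume x: "x \<in> sym_diff {t i..t (i + d + 1)} (closure ?S)"
      show "x \<in> ?D \<union> {t i, t (i + d + 1)}"
      proof (cases "x \<in> closure ?S")
        case True
        then show ?thesis using x upper by blast
      next
        case False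
        then have "x \<notin> {t i<..<t (i + d + 1)} - ?D" using lower by blast
        then show ?thesis using x False by auto
      qed
    qed
    then show "negligible (sym_diff {t i..t (i + d + 1)} (closure ?S))"
      by (rule negligible_subset [rotated]) (rule negligible_finite, simp)
  qed
  then show ?thesis using lt by (simp add: bspline_supp_def)
qed

lemma regularity_bounds:
  fixes d :: nat
  assumes \<F>: "interval_sigma_algebra \<F>"
  defines "t \<equiv> spline_grid.t d (grid_size \<F>) (grid_pt \<F>)"
  shows "1 \<le> regularity (Suc d) \<F>"
    and "i + 1 < grid_size \<F> + d \<Longrightarrow> t (i + d + 1) - t i \<le> regularity (Suc d) \<F> * (t (i + d + 2) - t (i + 1))"
    and "i + 1 < grid_size \<F> + d \<Longrightarrow> t (i + d + 2) - t (i + 1) \<le> regularity (Suc d) \<F> * (t (i + d + 1) - t i)"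
proof -
  interpret G: spline_grid d "grid_size \<F>" "grid_pt \<F>" by (rule spline_grid_sigma_algebra [OF \<F>])
  note num = knots_nth(3) [OF \<F>, of d]
  define \<rho> where "\<rho> i = max (measure lebesgue (bspline_supp (Suc d) \<F> i) / measure lebesgue (bspline_supp (Suc d) \<F> (i + 1)))
                 (measure lebesgue (bspline_supp (Suc d) \<F> (i + 1)) / measure lebesgue (bspline_supp (Suc d) \<F> i))" for i
  have reg: "regularity (Suc d) \<F> = Max (insert 1 (\<rho> ` {i. i + 1 < grid_size \<F> + d}))"
    by (simp add: regularity_def num \<rho>_def)
  have fin: "finite {i. i + 1 < grid_size \<F> + d}" by (rule finite_subset [of _ "{..grid_size \<F> + d}"]) auto
  show "1 \<le> regularity (Suc d) \<F>" unfolding reg using fin by (intro Max_ge) auto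
  assume i: "i + 1 < grid_size \<F> + d"
  define u v where "u = t (i + d + 1) - t i" and "v = t (i + d + 2) - t (i + 1)"
  have "\<rho> i \<le> regularity (Suc d) \<F>" unfolding reg using fin i by (intro Max_ge) auto
  moreover have "measure lebesgue (bspline_supp (Suc d) \<F> i) = u"
    "measure lebesgue (bspline_supp (Suc d) \<F> (i + 1)) = v"
    using measure_bspline_supp [OF \<F>, of i d] measure_bspline_supp [OF \<F>, of "i + 1" d] i num
    by (auto simp: t_def u_def v_def)
  ultimately have "u / v \<le> regularity (Suc d) \<F>" "v / u \<le> regularity (Suc d) \<F>"
    unfolding \<rho>_def by auto
  moreover have "0 < u" "0 < v"
    using G.support_nonempty [of i] G.support_nonempty [of "i + 1"] i by (auto simp: t_def u_def v_def)
  ultimately have "u \<le> regularity (Suc d) \<F> * v" "v \<le> regularity (Suc d) \<F> * u"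
    by (metis pos_divide_le_eq)+
  then show "t (i + d + 1) - t i \<le> regularity (Suc d) \<F> * (t (i + d + 2) - t (i + 1))"
    "t (i + d + 2) - t (i + 1) \<le> regularity (Suc d) \<F> * (t (i + d + 1) - t i)"
    by (simp_all only: u_def v_def)
qed

section \<open>Polynomial pieces of a spline\<close>

lemma C_on_const: "C_on n S (\<lambda>x. c)"
proof (induction n arbitrary: c)
  case (Suc n)
  then show ?case by (auto intro!: exI [of _ "\<lambda>x. 0"])
qed simp

lemma C_on_lincomb:
  assumes "C_on n S f" "C_on n S g"
  shows "C_on n S (\<lambda>x. a * f x + b * g x)"
  using assms
proof (induction n arbitrary: f g)
  case 0
  then show ?case by (auto intro!: continuous_intros)
next
  case (Suc n)
  then obtain f' g' where *: "\<forall>x\<in>S. (f has_real_derivative f' x) (at x within S)" "C_on n S f'"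
    "\<forall>x\<in>S. (g has_real_derivative g' x) (at x within S)" "C_on n S g'" by auto
  have "C_on n S (\<lambda>x. a * f' x + b * g' x)" using Suc.IH * by blast
  moreover have "\<forall>x\<in>S. ((\<lambda>x. a * f x + b * g x) has_real_derivative a * f' x + b * g' x) (at x within S)"
    using * by (auto intro!: derivative_eq_intros)
  ultimately show ?case by auto
qed

lemma C_on_truncated_power: "C_on n S (\<lambda>x. (max 0 (x - s)) ^ Suc n)"
proof (induction n)
  case 0
  then show ?case by (auto intro!: continuous_intros)
next
  case (Suc n)
  have "((\<lambda>x. (max 0 (x - s)) ^ Suc (Suc n)) has_real_derivative real (Suc (Suc n)) * (max 0 (x - s)) ^ Suc n) (at x)" for x
  proof (cases x s rule: linorder_cases)
    case less
    have "((\<lambda>x. 0) has_real_derivative real (Suc (Suc n)) * (max 0 (x - s)) ^ Suc n) (at x)"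
      using less by simp
    then show ?thesis
      by (rule has_field_derivative_transform_within_open [of _ _ _ "{..<s}"]) (use less in auto)
  next
    case greater
    have "((\<lambda>x. x - s) has_real_derivative 1) (at x)" by (auto intro!: derivative_eq_intros)
    from DERIV_power [OF this, of "Suc (Suc n)"]
    have "((\<lambda>x. (x - s) ^ Suc (Suc n)) has_real_derivative real (Suc (Suc n)) * (x - s) ^ Suc n) (at x)"
      by (simp del: power_Suc)
    then have "((\<lambda>x. (max 0 (x - s)) ^ Suc (Suc n)) has_real_derivative real (Suc (Suc n)) * (x - s) ^ Suc n) (at x)"
      by (rule has_field_derivative_transform_within_open [of _ _ _ "{s<..}"]) (use greater in auto)
    then show ?thesis using greater by simp
  next
    case equal
    have "((\<lambda>y. \<bar>y - s\<bar> ^ Suc n) \<longlongrightarrow> \<bar>s - s\<bar> ^ Suc n) (at s)"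
      by (intro tendsto_intros)
    then have lim: "((\<lambda>y. \<bar>y - s\<bar> ^ Suc n) \<longlongrightarrow> 0) (at s)" by simp
    have "((\<lambda>y. ((max 0 (y - s)) ^ Suc (Suc n) - (max 0 (s - s)) ^ Suc (Suc n)) / (y - s)) \<longlongrightarrow> 0) (at s)"
    proof (rule Lim_null_comparison [OF always_eventually lim], intro allI)
      fix y
      have "(max 0 (y - s)) ^ Suc n * \<bar>max 0 (y - s) / (y - s)\<bar> \<le> \<bar>y - s\<bar> ^ Suc n * 1"
        by (intro mult_mono power_mono) (auto simp: max_def)
      then show "norm (((max 0 (y - s)) ^ Suc (Suc n) - (max 0 (s - s)) ^ Suc (Suc n)) / (y - s)) \<le> \<bar>y - s\<bar> ^ Suc n"
        by (simp add: abs_mult power_abs abs_divide mult_ac)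
    qed
    then show ?thesis using equal by (simp add: has_field_derivative_iff)
  qed
  then have "\<forall>x\<in>S. ((\<lambda>x. (max 0 (x - s)) ^ Suc (Suc n)) has_real_derivative real (Suc (Suc n)) * (max 0 (x - s)) ^ Suc n) (at x within S)"
    by (blast intro: has_field_derivative_at_within)
  moreover have "C_on n S (\<lambda>x. real (Suc (Suc n)) * (max 0 (x - s)) ^ Suc n)"
    using C_on_lincomb [OF Suc.IH C_on_const, of "real (Suc (Suc n))" 0 0] by simp
  ultimately show ?case
    unfolding C_on.simps by (intro exI [of _ "\<lambda>x. real (Suc (Suc n)) * (max 0 (x - s)) ^ Suc n"] conjI)
qed

text \<open>Inside either interval the derivative of \<open>f\<close> is that of the polynomial, so the derivatives can be
  compared one order after the other; each comparison at \<open>\<tau>\<close> is a matter of continuity.\<close>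

lemma C_on_common_jet:
  assumes "C_on n {0..1} f" "0 \<le> a" "a < \<tau>" "\<tau> < c" "c \<le> 1"
    and "\<And>x. x \<in> {a<..<\<tau>} \<Longrightarrow> f x = poly p x" "\<And>x. x \<in> {\<tau><..<c} \<Longrightarrow> f x = poly q x"
    and "\<nu> \<le> n"
  shows "poly ((pderiv ^^ \<nu>) p) \<tau> = poly ((pderiv ^^ \<nu>) q) \<tau>"
  using assms(1,6-8)
proof (induction n arbitrary: f p q \<nu>)
  have base: "poly p \<tau> = poly q \<tau>"
    if f: "continuous_on {0..1} f" and p: "\<And>x. x \<in> {a<..<\<tau>} \<Longrightarrow> f x = poly p x"
      and q: "\<And>x. x \<in> {\<tau><..<c} \<Longrightarrow> f x = poly q x" for f p q
  proof -
    have "isCont f \<tau>" using f assms(2-5) by (intro continuous_on_interior) (auto simp: interior_atLeastAtMost_real)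
    then have lim: "(f \<longlongrightarrow> f \<tau>) (at_left \<tau>)" "(f \<longlongrightarrow> f \<tau>) (at_right \<tau>)"
      by (auto simp: isCont_def intro: filterlim_at_split [THEN iffD1, THEN conjunct1] filterlim_at_split [THEN iffD1, THEN conjunct2])
    have "(poly p \<longlongrightarrow> poly p \<tau>) (at_left \<tau>)" "(poly q \<longlongrightarrow> poly q \<tau>) (at_right \<tau>)"
      by (rule tendsto_within_subset [OF poly_isCont [unfolded isCont_def]], simp)+
    moreover have "eventually (\<lambda>x. poly p x = f x) (at_left \<tau>)"
      using eventually_at_left_real [OF assms(3)] by eventually_elim (use p in auto)
    moreover have "eventually (\<lambda>x. poly q x = f x) (at_right \<tau>)"
      using eventually_at_right_real [OF assms(4)] by eventually_elim (use q in auto)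
    ultimately have "(f \<longlongrightarrow> poly p \<tau>) (at_left \<tau>)" "(f \<longlongrightarrow> poly q \<tau>) (at_right \<tau>)"
      by (auto intro: Lim_transform_eventually)
    then show ?thesis using lim tendsto_unique [of "at_left \<tau>" f] tendsto_unique [of "at_right \<tau>" f] by force
  qed
  {
    case 0
    then show ?case using base [of f p q] by auto
  next
    case (Suc n)
    obtain f' where f'': "\<forall>x\<in>{0..1}. (f has_real_derivative f' x) (at x within {0..1})" "C_on n {0..1} f'"
      using Suc.prems(1) by auto
    then have f': "\<And>x. x \<in> {0..1} \<Longrightarrow> (f has_real_derivative f' x) (at x within {0..1})" "C_on n {0..1} f'"
      by blast+
    have deriv: "f' x = poly (pderiv r) x"
      if "open U" "x \<in> U" "U \<subseteq> {0<..<1}" "\<And>y. y \<in> U \<Longrightarrow> f y = poly r y" for x U r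
    proof -
      have "(f has_real_derivative f' x) (at x within {0..1})" using that by (intro f'(1)) auto
      then have "(f has_real_derivative f' x) (at x)"
        using that by (subst (asm) at_within_interior) (auto simp: interior_atLeastAtMost_real)
      moreover have "(f has_real_derivative poly (pderiv r) x) (at x)"
        by (rule has_field_derivative_transform_within_open [OF poly_DERIV that(1,2)]) (use that(4) in auto)
      ultimately show ?thesis by (rule DERIV_unique)
    qed
    show ?case
    proof (cases \<nu>)
      case 0
      have "continuous_on {0..1} f"
        unfolding continuous_on_eq_continuous_within by (intro ballI DERIV_continuous [OF f'(1)])
      then show ?thesis using base [of f p q] Suc.prems 0 by auto
    next
      case (Suc \<mu>)
      have "poly ((pderiv ^^ \<mu>) (pderiv p)) \<tau> = poly ((pderiv ^^ \<mu>) (pderiv q)) \<tau>"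
      proof (rule Suc.IH [OF f'(2)])
        show "f' x = poly (pderiv p) x" if "x \<in> {a<..<\<tau>}" for x
          using that assms(2-5) Suc.prems(2) by (intro deriv [of "{a<..<\<tau>}"]) auto
        show "f' x = poly (pderiv q) x" if "x \<in> {\<tau><..<c}" for x
          using that assms(2-5) Suc.prems(3) by (intro deriv [of "{\<tau><..<c}"]) auto
        show "\<mu> \<le> n" using Suc.prems(4) Suc by simp
      qed
      then show ?thesis unfolding Suc by (simp add: funpow_swap1)
    qed
  }
qed

lemma spline_pieces:
  assumes \<F>: "interval_sigma_algebra \<F>" and f: "f \<in> spline_space (Suc d) \<F>"
  obtains p where "\<And>r. r < grid_size \<F> \<Longrightarrow> degree (p r) \<le> d"
    and "\<And>r x. r < grid_size \<F> \<Longrightarrow> x \<in> {grid_pt \<F> r<..<grid_pt \<F> (Suc r)} \<Longrightarrow> f x = poly (p r) x"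
    and "\<And>r \<nu>. Suc r < grid_size \<F> \<Longrightarrow> \<nu> < d \<Longrightarrow>
      poly ((pderiv ^^ \<nu>) (p r)) (grid_pt \<F> (Suc r)) = poly ((pderiv ^^ \<nu>) (p (Suc r))) (grid_pt \<F> (Suc r))"
proof -
  interpret spline_grid d "grid_size \<F>" "grid_pt \<F>" by (rule spline_grid_sigma_algebra [OF \<F>])
  have "\<exists>p. degree p \<le> d \<and> (\<forall>x\<in>{grid_pt \<F> r<..<grid_pt \<F> (Suc r)}. f x = poly p x)" if r: "r < grid_size \<F>" for r
  proof -
    obtain A where A: "A \<in> atoms \<F>" "{grid_pt \<F> r<..<grid_pt \<F> (Suc r)} \<subseteq> A"
      using grid_interval_in_atom [OF \<F> r] by metis
    then obtain p where "degree p \<le> d" "\<forall>x\<in>A. f x = poly p x" using f unfolding spline_space_def by auto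
    then show ?thesis using A by blast
  qed
  then obtain p where p: "\<And>r. r < grid_size \<F> \<Longrightarrow> degree (p r) \<le> d"
    "\<And>r x. r < grid_size \<F> \<Longrightarrow> x \<in> {grid_pt \<F> r<..<grid_pt \<F> (Suc r)} \<Longrightarrow> f x = poly (p r) x"
    by metis
  moreover have "poly ((pderiv ^^ \<nu>) (p r)) (grid_pt \<F> (Suc r)) = poly ((pderiv ^^ \<nu>) (p (Suc r))) (grid_pt \<F> (Suc r))"
    if r: "Suc r < grid_size \<F>" and \<nu>: "\<nu> < d" for r \<nu>
  proof (rule C_on_common_jet)
    show "C_on (d - 1) {0..1} f" using f \<nu> unfolding spline_space_def by (auto simp: numeral_2_eq_2)
    show "0 \<le> grid_pt \<F> r" "grid_pt \<F> (Suc (Suc r)) \<le> 1"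
      using b_le [of 0 r] b_le [of "Suc (Suc r)" "grid_size \<F>"] r grid_pt_0 [OF \<F>] grid_pt_last [OF \<F>] by auto
    show "grid_pt \<F> r < grid_pt \<F> (Suc r)" "grid_pt \<F> (Suc r) < grid_pt \<F> (Suc (Suc r))"
      using r b_less_Suc by auto
    show "\<nu> \<le> d - 1" using \<nu> by simp
  qed (use p(2) r in auto)
  ultimately show ?thesis by (rule that)
qed

lemma spline_space_lincomb:
  assumes "f \<in> spline_space k \<F>" "g \<in> spline_space k \<F>"
  shows "(\<lambda>x. a * f x + b * g x) \<in> spline_space k \<F>"
proof -
  have "\<exists>p. degree p \<le> k - 1 \<and> (\<forall>x\<in>A. a * f x + b * g x = poly p x)" if A: "A \<in> atoms \<F>" for A
  proof -
    obtain p where "degree p \<le> k - 1" "\<forall>x\<in>A. f x = poly p x"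
      using assms(1) A unfolding spline_space_def by auto
    moreover obtain q where "degree q \<le> k - 1" "\<forall>x\<in>A. g x = poly q x"
      using assms(2) A unfolding spline_space_def by auto
    ultimately show ?thesis
      by (intro exI [of _ "smult a p + smult b q"]) (auto intro!: degree_add_le order_trans [OF degree_smult_le])
  qed
  then show ?thesis using assms C_on_lincomb unfolding spline_space_def by auto
qed

lemma const_in_spline_space: "(\<lambda>x. c) \<in> spline_space k \<F>"
  unfolding spline_space_def by (auto intro!: C_on_const exI [of _ "[:c:]"])

lemma spline_space_sum:
  assumes "\<And>j. j \<in> J \<Longrightarrow> g j \<in> spline_space k \<F>"
  shows "(\<lambda>x. \<Sum>j\<in>J. c j * g j x) \<in> spline_space k \<F>"
  using assms
proof (induction J rule: infinite_finite_induct)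
  case (insert j J)
  then have "(\<lambda>x. c j * g j x + 1 * (\<Sum>j\<in>J. c j * g j x)) \<in> spline_space k \<F>"
    by (intro spline_space_lincomb) auto
  then show ?case using insert.hyps by simp
qed (use const_in_spline_space [of 0] in simp_all)

section \<open>Step splines and covering splines\<close>

text \<open>The indicator function of the points to the right of \<open>s\<close>. At \<open>x = s\<close> the atom that contains \<open>s\<close>
  decides, so that splines of degree \<open>0\<close> are constant on atoms; in higher degrees the factor
  \<open>(x - s) ^ d\<close> makes this value irrelevant.\<close>

definition right_of :: "real set set \<Rightarrow> real \<Rightarrow> real \<Rightarrow> real" where
  "right_of \<F> s x = of_bool (if x \<in> {0..1} then \<exists>A\<in>atoms \<F>. x \<in> A \<and> s \<le> Inf A else s < x)"

lemma right_of_on_atom: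
  assumes \<F>: "interval_sigma_algebra \<F>" and A: "A \<in> atoms \<F>" "x \<in> A"
  shows "right_of \<F> s x = of_bool (s \<le> Inf A)"
proof -
  have dis: "disjoint (atoms \<F>)" "\<Union>(atoms \<F>) = {0..1}"
    using interval_sigma_algebra_atoms(2) [OF \<F>] by (auto simp: partition_on_def)
  have "x \<in> {0..1}" using A dis(2) by blast
  moreover have "(\<exists>B\<in>atoms \<F>. x \<in> B \<and> s \<le> Inf B) \<longleftrightarrow> s \<le> Inf A"
  proof
    assume "\<exists>B\<in>atoms \<F>. x \<in> B \<and> s \<le> Inf B"
    then obtain B where B: "B \<in> atoms \<F>" "x \<in> B" "s \<le> Inf B" by blast
    then have "B = A" using dis(1) A unfolding disjoint_def by blast
    then show "s \<le> Inf A" using B(3) by simp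
  qed (use A in blast)
  ultimately show ?thesis unfolding right_of_def by simp
qed

lemma right_of_values:
  assumes \<F>: "interval_sigma_algebra \<F>" and s: "s \<in> endpoints \<F>"
  shows "s < x \<Longrightarrow> right_of \<F> s x = 1" "x < s \<Longrightarrow> right_of \<F> s x = 0"
proof -
  show "right_of \<F> s x = 1" if "s < x"
  proof (cases "x \<in> {0..1}")
    case True
    then obtain A where A: "A \<in> atoms \<F>" "x \<in> A" by (rule atom_containing [OF \<F>])
    have "x \<le> Sup A" using atom_between_endpoints(3) [OF \<F> A(1)] A(2) by auto
    then have "s \<le> Inf A" using endpoints_not_inside_atom [OF \<F> A(1) s] that by auto
    then show ?thesis using right_of_on_atom [OF \<F> A] by simp
  qed (use that in \<open>auto simp: right_of_def\<close>)
  show "right_of \<F> s x = 0" if "x < s"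
  proof (cases "x \<in> {0..1}")
    case True
    then obtain A where A: "A \<in> atoms \<F>" "x \<in> A" by (rule atom_containing [OF \<F>])
    have "Inf A \<le> x" using atom_between_endpoints(3) [OF \<F> A(1)] A(2) by auto
    then show ?thesis using right_of_on_atom [OF \<F> A] that by simp
  qed (use that in \<open>auto simp: right_of_def\<close>)
qed

lemma truncated_power_in_spline_space:
  assumes \<F>: "interval_sigma_algebra \<F>" and s: "s \<in> endpoints \<F>"
  shows "(\<lambda>x. (x - s) ^ d * right_of \<F> s x) \<in> spline_space (Suc d) \<F>"
proof -
  have "C_on (Suc d - 2) {0..1} (\<lambda>x. (x - s) ^ d * right_of \<F> s x)" if "2 \<le> Suc d"
  proof -
    have "(x - s) ^ d * right_of \<F> s x = (max 0 (x - s)) ^ Suc (Suc d - 2)" for x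
    proof -
      have d: "Suc (Suc d - 2) = d" "0 < d" using that by auto
      show ?thesis unfolding d(1) using right_of_values [OF \<F> s, of x] d(2)
        by (cases x s rule: linorder_cases) (auto simp: max_def)
    qed
    then show ?thesis using C_on_truncated_power by simp
  qed
  moreover have "\<exists>p. degree p \<le> Suc d - 1 \<and> (\<forall>x\<in>A. (x - s) ^ d * right_of \<F> s x = poly p x)" if A: "A \<in> atoms \<F>" for A
  proof (intro exI conjI ballI)
    show "degree (smult (of_bool (s \<le> Inf A)) ([:- s, 1:] ^ d)) \<le> Suc d - 1"
      by (rule order_trans [OF degree_smult_le]) (simp add: degree_linear_power)
    show "(x - s) ^ d * right_of \<F> s x = poly (smult (of_bool (s \<le> Inf A)) ([:- s, 1:] ^ d)) x" if "x \<in> A" for x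
      using right_of_on_atom [OF \<F> A that, of s] by (simp add: poly_power)
  qed
  ultimately show ?thesis unfolding spline_space_def by auto
qed

text \<open>Neville's recursion for the divided difference over \<open>s 0, \<dots>, s e\<close> of \<open>y \<mapsto> (x - y) ^ e\<close>, truncated
  to \<open>y < x\<close> and normalized so that the value to the right of \<open>s e\<close> is \<open>1\<close>. The
  recursion forms convex combinations and thereby keeps the values in the unit interval; the closed form in the next lemma shows
  that the function is a smooth spline.\<close>

primrec step_spline :: "(real \<Rightarrow> real \<Rightarrow> real) \<Rightarrow> nat \<Rightarrow> (nat \<Rightarrow> real) \<Rightarrow> real \<Rightarrow> real" where
  "step_spline \<rho> 0 s x = \<rho> (s 0) x"
| "step_spline \<rho> (Suc e) s x = (x - s 0) / (s (Suc e) - s 0) * step_spline \<rho> e s x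
     + (s (Suc e) - x) / (s (Suc e) - s 0) * step_spline \<rho> e (\<lambda>j. s (Suc j)) x"

lemma step_spline_truncated_powers:
  assumes "\<And>i j. i < j \<Longrightarrow> j \<le> e \<Longrightarrow> s i < s j"
  shows "step_spline \<rho> e s x = (\<Sum>j\<le>e. (\<Prod>l\<in>{..e} - {j}. 1 / (s l - s j)) * ((x - s j) ^ e * \<rho> (s j) x))"
  using assms
proof (induction e arbitrary: s)
  case (Suc e)
  define c where "c j = (\<Prod>l\<in>{..Suc e} - {j}. 1 / (s l - s j))" for j
  define u where "u j = (x - s j) ^ e * \<rho> (s j) x" for j
  have ne: "s i \<noteq> s j" if "i \<noteq> j" "i \<le> Suc e" "j \<le> Suc e" for i j
    using Suc.prems [of i j] Suc.prems [of j i] that by (cases "i < j") auto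
  have D: "0 < s (Suc e) - s 0" using Suc.prems [of 0 "Suc e"] by simp
  have lower: "(\<Prod>l\<in>{..e} - {j}. 1 / (s l - s j)) = c j * (s (Suc e) - s j)" if "j \<le> e" for j
  proof -
    have "{..Suc e} - {j} = insert (Suc e) ({..e} - {j})" using that by auto
    then show ?thesis using ne [of "Suc e" j] that by (simp add: c_def)
  qed
  have upper: "(\<Prod>l\<in>{..e} - {j}. 1 / (s (Suc l) - s (Suc j))) = c (Suc j) * (s 0 - s (Suc j))" if "j \<le> e" for j
  proof -
    have "{..Suc e} - {Suc j} = insert 0 (Suc ` ({..e} - {j}))"
      unfolding atMost_Suc_eq_insert_0 by auto
    moreover have "(\<Prod>l\<in>Suc ` ({..e} - {j}). 1 / (s l - s (Suc j))) = (\<Prod>l\<in>{..e} - {j}. 1 / (s (Suc l) - s (Suc j)))"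
      by (subst prod.reindex) auto
    ultimately show ?thesis using ne [of 0 "Suc j"] that by (simp add: c_def)
  qed
  have "step_spline \<rho> e s x = (\<Sum>j\<le>e. c j * (s (Suc e) - s j) * u j)"
    using Suc.prems unfolding u_def by (subst Suc.IH) (auto intro!: sum.cong simp: lower)
  also have "\<dots> = (\<Sum>j\<le>Suc e. c j * (s (Suc e) - s j) * u j)" by simp
  finally have 1: "step_spline \<rho> e s x = (\<Sum>j\<le>Suc e. c j * (s (Suc e) - s j) * u j)" .
  have "step_spline \<rho> e (\<lambda>j. s (Suc j)) x = (\<Sum>j\<le>e. c (Suc j) * (s 0 - s (Suc j)) * u (Suc j))"
    using Suc.prems unfolding u_def by (subst Suc.IH) (auto intro!: sum.cong simp: upper)
  also have "\<dots> = (\<Sum>j\<le>Suc e. c j * (s 0 - s j) * u j)"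
    by (simp only: sum.atMost_Suc_shift) simp
  finally have 2: "step_spline \<rho> e (\<lambda>j. s (Suc j)) x = (\<Sum>j\<le>Suc e. c j * (s 0 - s j) * u j)" .
  have key: "(x - s 0) / (s (Suc e) - s 0) * (c j * (s (Suc e) - s j) * u j)
      + (s (Suc e) - x) / (s (Suc e) - s 0) * (c j * (s 0 - s j) * u j) = c j * ((x - s j) * u j)" for j
  proof -
    have "(x - s 0) * (s (Suc e) - s j) + (s (Suc e) - x) * (s 0 - s j) = (s (Suc e) - s 0) * (x - s j)"
      by (simp add: algebra_simps)
    then have "((x - s 0) * (s (Suc e) - s j) + (s (Suc e) - x) * (s 0 - s j)) / (s (Suc e) - s 0) = x - s j"
      using D by simp
    then have "(x - s 0) / (s (Suc e) - s 0) * (s (Suc e) - s j) + (s (Suc e) - x) / (s (Suc e) - s 0) * (s 0 - s j) = x - s j"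
      by (simp add: add_divide_distrib)
    then have "c j * u j * ((x - s 0) / (s (Suc e) - s 0) * (s (Suc e) - s j) + (s (Suc e) - x) / (s (Suc e) - s 0) * (s 0 - s j))
      = c j * u j * (x - s j)" by simp
    then show ?thesis by (simp only: distrib_left mult_ac)
  qed
  have "step_spline \<rho> (Suc e) s x = (\<Sum>j\<le>Suc e. c j * ((x - s j) * u j))"
    unfolding step_spline.simps 1 2 sum_distrib_left sum.distrib [symmetric]
    by (rule sum.cong [OF refl key])
  also have "\<dots> = (\<Sum>j\<le>Suc e. c j * ((x - s j) ^ Suc e * \<rho> (s j) x))"
    by (simp add: u_def mult_ac)
  finally show ?case unfolding c_def .
qed simp

lemma step_spline_values:
  assumes "\<And>i j. i < j \<Longrightarrow> j \<le> e \<Longrightarrow> s i < s j"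
    and "\<And>j. j \<le> e \<Longrightarrow> s j < x \<Longrightarrow> \<rho> (s j) x = 1" "\<And>j. j \<le> e \<Longrightarrow> x < s j \<Longrightarrow> \<rho> (s j) x = 0"
    and "\<And>j. j \<le> e \<Longrightarrow> \<rho> (s j) x \<in> {0..1}"
  shows "(x < s 0 \<longrightarrow> step_spline \<rho> e s x = 0) \<and> (s e < x \<longrightarrow> step_spline \<rho> e s x = 1) \<and> step_spline \<rho> e s x \<in> {0..1}"
  using assms
proof (induction e arbitrary: s)
  case (Suc e)
  let ?G = "step_spline \<rho> e s x" and ?H = "step_spline \<rho> e (\<lambda>j. s (Suc j)) x"
  have G: "(x < s 0 \<longrightarrow> ?G = 0) \<and> (s e < x \<longrightarrow> ?G = 1) \<and> ?G \<in> {0..1}"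
    using Suc.prems by (intro Suc.IH) auto
  have H: "(x < s (Suc 0) \<longrightarrow> ?H = 0) \<and> (s (Suc e) < x \<longrightarrow> ?H = 1) \<and> ?H \<in> {0..1}"
    using Suc.prems by (intro Suc.IH) auto
  have lt: "s 0 < s (Suc e)" "s e < s (Suc e)" "s 0 < s (Suc 0)"
    using Suc.prems(1) [of 0 "Suc e"] Suc.prems(1) [of e "Suc e"] Suc.prems(1) [of 0 "Suc 0"] by auto
  define \<theta> where "\<theta> = (x - s 0) / (s (Suc e) - s 0)"
  have \<theta>': "(s (Suc e) - x) / (s (Suc e) - s 0) = 1 - \<theta>" using lt by (simp add: \<theta>_def field_simps)
  have eq: "step_spline \<rho> (Suc e) s x = \<theta> * ?G + (1 - \<theta>) * ?H" unfolding step_spline.simps \<theta>' \<theta>_def ..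
  consider "x < s 0" | "s (Suc e) < x" | "s 0 \<le> x" "x \<le> s (Suc e)" by linarith
  then show ?case
  proof cases
    case 1
    then show ?thesis unfolding eq using G H lt by auto
  next
    case 2
    then show ?thesis unfolding eq using G H lt by auto
  next
    case 3
    then have \<theta>: "0 \<le> \<theta>" "\<theta> \<le> 1" using lt by (auto simp: \<theta>_def)
    have "\<theta> * ?G + (1 - \<theta>) * ?H \<le> \<theta> * 1 + (1 - \<theta>) * 1"
      using \<theta> G H by (intro add_mono mult_left_mono) auto
    then show ?thesis unfolding eq using 3 \<theta> G H by auto
  qed
qed auto

text \<open>A step up over the \<open>d\<close> atoms to the left of the support minus a step up over the \<open>d\<close> atoms to the
  right of it. If there are fewer than \<open>d\<close> atoms on one side, the transition on that side is omitted,
  which is consistent with the stated support since the knot named there is then \<open>0\<close> or \<open>1\<close>.\<close>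

lemma cover_spline:
  assumes \<F>: "interval_sigma_algebra \<F>" and i: "i < grid_size \<F> + d"
  defines "t \<equiv> spline_grid.t d (grid_size \<F>) (grid_pt \<F>)"
  obtains \<Phi> where "\<Phi> \<in> spline_space (Suc d) \<F>" "\<And>x. 0 \<le> \<Phi> x" "\<And>x. \<Phi> x \<le> 1"
    "\<And>x. x \<in> {t i<..<t (i + d + 1)} \<Longrightarrow> \<Phi> x = 1"
    "\<And>x. x \<in> {0..1} \<Longrightarrow> x \<notin> {t (i - d)..t (i + 2 * d + 1)} \<Longrightarrow> \<Phi> x = 0"
proof -
  interpret G: spline_grid d "grid_size \<F>" "grid_pt \<F>" by (rule spline_grid_sigma_algebra [OF \<F>])
  let ?b = "grid_pt \<F>" and ?m = "grid_size \<F>" and ?\<rho> = "right_of \<F>"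
  have step: "step_spline ?\<rho> d (\<lambda>l. ?b (r + l)) \<in> spline_space (Suc d) \<F>
      \<and> (\<forall>x. step_spline ?\<rho> d (\<lambda>l. ?b (r + l)) x \<in> {0..1}
           \<and> (x < ?b r \<longrightarrow> step_spline ?\<rho> d (\<lambda>l. ?b (r + l)) x = 0)
           \<and> (?b (r + d) < x \<longrightarrow> step_spline ?\<rho> d (\<lambda>l. ?b (r + l)) x = 1))" if r: "r + d \<le> ?m" for r
  proof -
    have mono: "?b (r + i) < ?b (r + j)" if "i < j" "j \<le> d" for i j using that r by (intro G.b_less) auto
    have ep: "?b (r + j) \<in> endpoints \<F>" if "j \<le> d" for j
      unfolding grid_pt_image [OF \<F>, symmetric] using that r by auto
    have "(\<lambda>x. \<Sum>j\<le>d. (\<Prod>l\<in>{..d} - {j}. 1 / (?b (r + l) - ?b (r + j))) * ((x - ?b (r + j)) ^ d * ?\<rho> (?b (r + j)) x))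
        \<in> spline_space (Suc d) \<F>"
      using ep by (intro spline_space_sum truncated_power_in_spline_space [OF \<F>]) auto
    also have "(\<lambda>x. \<Sum>j\<le>d. (\<Prod>l\<in>{..d} - {j}. 1 / (?b (r + l) - ?b (r + j))) * ((x - ?b (r + j)) ^ d * ?\<rho> (?b (r + j)) x))
        = step_spline ?\<rho> d (\<lambda>l. ?b (r + l))"
      using mono by (intro ext step_spline_truncated_powers [symmetric]) auto
    finally have mem: "step_spline ?\<rho> d (\<lambda>l. ?b (r + l)) \<in> spline_space (Suc d) \<F>" .
    have val: "(x < ?b (r + 0) \<longrightarrow> step_spline ?\<rho> d (\<lambda>l. ?b (r + l)) x = 0)
      \<and> (?b (r + d) < x \<longrightarrow> step_spline ?\<rho> d (\<lambda>l. ?b (r + l)) x = 1) \<and> step_spline ?\<rho> d (\<lambda>l. ?b (r + l)) x \<in> {0..1}" for x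
      using mono right_of_values [OF \<F> ep] by (intro step_spline_values) (auto simp: right_of_def)
    show ?thesis using mem val by auto
  qed
  have lt: "t i < t (i + d + 1)" unfolding t_def by (rule G.support_nonempty [OF i])
  obtain L where L: "L \<in> spline_space (Suc d) \<F>" "\<And>x. L x \<in> {0..1}"
    "\<And>x. t i < x \<Longrightarrow> L x = 1" "\<And>x. x \<in> {0..1} \<Longrightarrow> x < t (i - d) \<Longrightarrow> L x = 0"
  proof (cases "2 * d \<le> i")
    case True
    have r: "i - 2 * d + d \<le> ?m" "i - 2 * d + d = i - d" using True i by auto
    have "t i = ?b (i - 2 * d + d)" "t (i - d) = ?b (i - 2 * d)"
      using True i by (auto simp: t_def G.t_def r mult_2)
    then show ?thesis using that [of "step_spline ?\<rho> d (\<lambda>l. ?b (i - 2 * d + l))"] step [OF r(1)] by auto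
  next
    case False
    then have "t (i - d) = 0" using grid_pt_0 [OF \<F>] by (simp add: t_def G.t_def)
    then show ?thesis using that [of "\<lambda>x. 1"] const_in_spline_space by auto
  qed
  obtain R where R: "R \<in> spline_space (Suc d) \<F>" "\<And>x. R x \<in> {0..1}"
    "\<And>x. x \<in> {0..1} \<Longrightarrow> t (i + 2 * d + 1) < x \<Longrightarrow> R x = 1" "\<And>x. x < t (i + d + 1) \<Longrightarrow> R x = 0"
  proof (cases "i + 1 + d \<le> ?m")
    case True
    have "t (i + d + 1) = ?b (i + 1)" "t (i + 2 * d + 1) = ?b (i + 1 + d)"
      using True by (auto simp: t_def G.t_def intro!: arg_cong [where f = ?b])
    then show ?thesis using that [of "step_spline ?\<rho> d (\<lambda>l. ?b (i + 1 + l))"] step [OF True] by auto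
  next
    case False
    then have "t (i + 2 * d + 1) = 1" using grid_pt_last [OF \<F>] by (simp add: t_def G.t_def)
    then show ?thesis using that [of "\<lambda>x. 0"] const_in_spline_space by auto
  qed
  show ?thesis
  proof (rule that [of "\<lambda>x. L x - R x"])
    show "(\<lambda>x. L x - R x) \<in> spline_space (Suc d) \<F>"
      using spline_space_lincomb [OF L(1) R(1), of 1 "-1"] by simp
    show "0 \<le> L x - R x" for x using L(2,3) [of x] R(2,4) [of x] lt by (cases "t i < x") auto
    show "L x - R x \<le> 1" for x using L(2) [of x] R(2) [of x] by auto
    show "L x - R x = 1" if "x \<in> {t i<..<t (i + d + 1)}" for x using L(3) R(4) that by auto
    show "L x - R x = 0" if "x \<in> {0..1}" "x \<notin> {t (i - d)..t (i + 2 * d + 1)}" for x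
    proof (cases "x < t (i - d)")
      case True
      have "t (i - d) \<le> t (i + d + 1)" unfolding t_def by (intro G.t_mono) auto
      then show ?thesis using True L(4) R(4) that by auto
    next
      case False
      then have "t (i + 2 * d + 1) < x" using that by auto
      moreover have "t i \<le> t (i + 2 * d + 1)" unfolding t_def by (intro G.t_mono) auto
      ultimately show ?thesis using L(3) R(3) that by auto
    qed
  qed
qed

text \<open>The interval is covered by the supports with numbers from \<open>i - d\<close> to \<open>i + d\<close>, and each step from one
  number to the next changes the length by a factor of at most \<open>\<gamma>\<close>.\<close>

lemma cover_spline_length:
  assumes \<F>: "interval_sigma_algebra \<F>" and i: "i < grid_size \<F> + d"
    and reg: "regularity (Suc d) \<F> \<le> \<gamma>"
  defines "t \<equiv> spline_grid.t d (grid_size \<F>) (grid_pt \<F>)"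
  shows "t (i + 2 * d + 1) - t (i - d) \<le> (2 * real d + 1) * \<gamma> ^ d * (t (i + d + 1) - t i)"
proof -
  interpret G: spline_grid d "grid_size \<F>" "grid_pt \<F>" by (rule spline_grid_sigma_algebra [OF \<F>])
  define E where "E j = t (j + d + 1) - t j" for j
  have \<gamma>: "1 \<le> \<gamma>" using regularity_bounds(1) [OF \<F>] reg by (rule order_trans)
  have E0: "0 \<le> E j" for j using G.t_mono [of j "j + d + 1"] by (simp add: E_def t_def)
  have up: "E j \<le> \<gamma> * E (Suc j)" and dn: "E (Suc j) \<le> \<gamma> * E j" if "Suc j < grid_size \<F> + d" for j
  proof -
    have "E j \<le> regularity (Suc d) \<F> * E (Suc j)" "E (Suc j) \<le> regularity (Suc d) \<F> * E j"
      using regularity_bounds(2,3) [OF \<F>, of j d] that by (auto simp: E_def t_def)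
    moreover have "regularity (Suc d) \<F> * E l \<le> \<gamma> * E l" for l using reg E0 by (intro mult_right_mono)
    ultimately show "E j \<le> \<gamma> * E (Suc j)" "E (Suc j) \<le> \<gamma> * E j" using order_trans by blast+
  qed
  have right: "E (i + n) \<le> \<gamma> ^ n * E i" for n
  proof (induction n)
    case (Suc n)
    show ?case
    proof (cases "Suc (i + n) < grid_size \<F> + d")
      case True
      have "E (Suc (i + n)) \<le> \<gamma> * E (i + n)" by (rule dn [OF True])
      also have "\<dots> \<le> \<gamma> * (\<gamma> ^ n * E i)" using Suc \<gamma> by (intro mult_left_mono) auto
      finally show ?thesis by (simp add: mult.assoc)
    next
      case False
      then have "min (grid_size \<F>) (i + Suc n - d) = grid_size \<F>"
        "min (grid_size \<F>) (i + Suc n + d + 1 - d) = grid_size \<F>" by linarith+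
      then have "E (i + Suc n) = 0" unfolding E_def t_def G.t_def by simp
      then show ?thesis using E0 \<gamma> by simp
    qed
  qed simp
  have left: "n \<le> i \<Longrightarrow> E (i - n) \<le> \<gamma> ^ n * E i" for n
  proof (induction n)
    case (Suc n)
    have "E (i - Suc n) \<le> \<gamma> * E (Suc (i - Suc n))" using Suc.prems i by (intro up) auto
    also have "Suc (i - Suc n) = i - n" using Suc.prems by simp
    also have "\<gamma> * E (i - n) \<le> \<gamma> * (\<gamma> ^ n * E i)" using Suc \<gamma> by (intro mult_left_mono) auto
    finally show ?case by (simp add: mult.assoc)
  qed simp
  have all: "E j \<le> \<gamma> ^ d * E i" if "j \<in> {i - d..i + d}" for j
  proof -
    have pow: "\<gamma> ^ n * E i \<le> \<gamma> ^ d * E i" if "n \<le> d" for n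
      using that \<gamma> E0 by (intro mult_right_mono power_increasing) auto
    show ?thesis
    proof (cases "i \<le> j")
      case True
      then have "i + (j - i) = j" "j - i \<le> d" using that by auto
      then show ?thesis using right [of "j - i"] pow [of "j - i"] by (metis order_trans)
    next
      case False
      then have "i - (i - j) = j" "i - j \<le> i" "i - j \<le> d" using that by auto
      then show ?thesis using left [of "i - j"] pow [of "i - j"] by (metis order_trans)
    qed
  qed
  have "t (i + 2 * d + 1) - t (i - d) = (t (i + d + d + 1) - t (i + d)) + (t (i + d) - t (i - d))"
    by (simp add: mult_2 add.assoc)
  also have "t (i + d + d + 1) - t (i + d) = E (i + d)" by (simp add: E_def)
  also have "t (i + d) - t (i - d) = (\<Sum>j\<in>{i - d..<i + d}. t (Suc j) - t j)"
    by (rule sum_Suc_diff' [symmetric]) simp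
  also have "\<dots> \<le> (\<Sum>j\<in>{i - d..<i + d}. E j)"
    unfolding E_def t_def by (intro sum_mono diff_right_mono G.t_mono) auto
  also have "\<dots> \<le> (\<Sum>j\<in>{i - d..<i + d}. \<gamma> ^ d * E i)" by (intro sum_mono all) auto
  also have "E (i + d) + \<dots> \<le> \<gamma> ^ d * E i + 2 * real d * (\<gamma> ^ d * E i)"
  proof (intro add_mono all)
    have "real (i + d - (i - d)) \<le> 2 * real d" by linarith
    then show "(\<Sum>j\<in>{i - d..<i + d}. \<gamma> ^ d * E i) \<le> 2 * real d * (\<gamma> ^ d * E i)"
      using mult_right_mono [of "real (i + d - (i - d))" "2 * real d" "\<gamma> ^ d * E i"] \<gamma> E0 by simp
  qed auto
  also have "\<dots> = (2 * real d + 1) * \<gamma> ^ d * E i" by (simp add: algebra_simps)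
  finally show ?thesis by (simp add: E_def)
qed

section \<open>The orthogonal projection\<close>

abbreviation \<mu>01 :: "real measure" where "\<mu>01 \<equiv> lebesgue_on {0..1}"

lemma finite_measure_\<mu>01: "finite_measure \<mu>01"
  by (intro finite_measure_lebesgue_on) simp

definition bounded_measurable :: "(real \<Rightarrow> real) set" where
  "bounded_measurable = {w \<in> borel_measurable \<mu>01. \<exists>B. \<forall>x\<in>{0..1}. \<bar>w x\<bar> \<le> B}"

lemma spline_bounded_measurable:
  assumes \<F>: "interval_sigma_algebra \<F>" and f: "f \<in> spline_space k \<F>"
  shows "f \<in> bounded_measurable"
proof -
  note P = interval_sigma_algebra_atoms [OF \<F>]
  have dis: "disjoint (atoms \<F>)" "\<Union>(atoms \<F>) = {0..1}"
    using P(2) by (auto simp: partition_on_def)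
  have "\<forall>A\<in>atoms \<F>. \<exists>p. \<forall>x\<in>A. f x = poly p x" using f unfolding spline_space_def by blast
  then obtain p where p: "\<And>A x. A \<in> atoms \<F> \<Longrightarrow> x \<in> A \<Longrightarrow> f x = poly (p A) x" by metis
  have "\<exists>B. \<forall>x\<in>{0..1}. \<bar>poly (p A) x\<bar> \<le> B" for A
  proof -
    have "bounded (poly (p A) ` {0..1})"
      by (intro compact_imp_bounded compact_continuous_image continuous_intros) simp
    then show ?thesis unfolding bounded_iff by auto
  qed
  then obtain B where B: "\<And>A x. x \<in> {0..1} \<Longrightarrow> \<bar>poly (p A) x\<bar> \<le> B A" by metis
  have B0: "0 \<le> B A" for A using B [of 0 A] by auto
  define g where "g x = (\<Sum>A\<in>atoms \<F>. indicator A x * poly (p A) x)" for x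
  have fg: "f x = g x" if x: "x \<in> {0..1}" for x
  proof -
    obtain A where A: "A \<in> atoms \<F>" "x \<in> A" using x by (rule atom_containing [OF \<F>])
    have "indicator A' x = (if A' = A then 1 else 0 :: real)" if "A' \<in> atoms \<F>" for A'
      using dis(1) A that by (auto simp: disjoint_def indicator_def)
    then have "g x = (\<Sum>A'\<in>atoms \<F>. if A' = A then poly (p A) x else 0)"
      unfolding g_def by (intro sum.cong) auto
    then show ?thesis using A P(1) p by simp
  qed
  have [measurable]: "A \<in> sets borel" if "A \<in> atoms \<F>" for A
    using P(4) that real_interval_borel_measurable by blast
  have "poly (p A) \<in> borel_measurable borel" for A
    by (intro borel_measurable_continuous_onI continuous_intros)
  then have "g \<in> borel_measurable borel" unfolding g_def by measurable
  then have "g \<in> borel_measurable \<mu>01"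
    by (intro measurable_restrict_space1 measurable_completion) simp
  also have "?this \<longleftrightarrow> f \<in> borel_measurable \<mu>01" by (rule measurable_cong) (simp add: fg)
  finally have "f \<in> borel_measurable \<mu>01" .
  moreover have "\<bar>f x\<bar> \<le> (\<Sum>A\<in>atoms \<F>. B A)" if x: "x \<in> {0..1}" for x
  proof -
    obtain A where A: "A \<in> atoms \<F>" "x \<in> A" using x by (rule atom_containing [OF \<F>])
    have "\<bar>f x\<bar> \<le> B A" using p [OF A] B [OF x] by simp
    also have "\<dots> \<le> (\<Sum>A\<in>atoms \<F>. B A)" using A P(1) B0 by (intro member_le_sum) auto
    finally show ?thesis .
  qed
  ultimately show ?thesis unfolding bounded_measurable_def by blast
qed

lemma integrable_mult_bounded_measurable:
  assumes "integrable \<mu>01 h" "w \<in> bounded_measurable"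
  shows "integrable \<mu>01 (\<lambda>x. h x * w x)"
proof -
  obtain B where B: "\<forall>x\<in>{0..1}. \<bar>w x\<bar> \<le> B" and w [measurable]: "w \<in> borel_measurable \<mu>01"
    using assms(2) unfolding bounded_measurable_def by blast
  have [measurable]: "h \<in> borel_measurable \<mu>01" using assms(1) by (rule borel_measurable_integrable)
  show ?thesis
  proof (rule Bochner_Integration.integrable_bound [where f = "\<lambda>x. B * h x"])
    show "AE x in \<mu>01. norm (h x * w x) \<le> norm (B * h x)"
    proof (rule AE_I2)
      fix x assume "x \<in> space \<mu>01"
      then have "x \<in> {0..1}" by simp
      then have "\<bar>w x\<bar> \<le> B" using B by blast
      then have "\<bar>w x\<bar> \<le> \<bar>B\<bar>" by linarith
      then show "norm (h x * w x) \<le> norm (B * h x)"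
        using mult_left_mono [of "\<bar>w x\<bar>" "\<bar>B\<bar>" "\<bar>h x\<bar>"] by (simp add: abs_mult mult.commute)
    qed
  qed (use assms(1) in \<open>auto\<close>)
qed

lemma integrable_bounded_measurable:
  assumes "w \<in> bounded_measurable"
  shows "integrable \<mu>01 w"
proof -
  interpret finite_measure \<mu>01 by (rule finite_measure_\<mu>01)
  show ?thesis using integrable_mult_bounded_measurable [of "\<lambda>x. 1" w] assms by simp
qed

context
begin

interpretation fs: vector_space "\<lambda>(c::real) (f::real \<Rightarrow> real). (\<lambda>x. c * f x)"
  by unfold_locales (auto simp: fun_eq_iff algebra_simps)

lemma subspace_bounded_measurable: "fs.subspace bounded_measurable"
proof (rule fs.subspaceI)
  show "0 \<in> bounded_measurable" unfolding bounded_measurable_def zero_fun_def by auto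
  show "f + g \<in> bounded_measurable" if fg: "f \<in> bounded_measurable" "g \<in> bounded_measurable" for f g
  proof -
    obtain B C where "f \<in> borel_measurable \<mu>01" "g \<in> borel_measurable \<mu>01"
      "\<forall>x\<in>{0..1}. \<bar>f x\<bar> \<le> B" "\<forall>x\<in>{0..1}. \<bar>g x\<bar> \<le> C"
      using fg [unfolded bounded_measurable_def] by blast
    moreover from this have "\<forall>x\<in>{0..1}. \<bar>f x + g x\<bar> \<le> B + C" by fastforce
    ultimately show ?thesis unfolding bounded_measurable_def plus_fun_def by auto
  qed
  show "(\<lambda>x. c * f x) \<in> bounded_measurable" if f: "f \<in> bounded_measurable" for c f
  proof -
    obtain B where "f \<in> borel_measurable \<mu>01" "\<forall>x\<in>{0..1}. \<bar>f x\<bar> \<le> B"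
      using f[unfolded bounded_measurable_def] by blast
    moreover from this have "\<forall>x\<in>{0..1}. \<bar>c * f x\<bar> \<le> \<bar>c\<bar> * B" by (auto simp: abs_mult intro: mult_left_mono)
    ultimately show ?thesis unfolding bounded_measurable_def by auto
  qed
qed

lemma subspace_orthogonal:
  assumes "integrable \<mu>01 h"
  shows "fs.subspace {g \<in> bounded_measurable. (\<integral>x. h x * g x \<partial>\<mu>01) = 0}"
proof (rule fs.subspaceI)
  note W = subspace_bounded_measurable
  note int = integrable_mult_bounded_measurable [OF assms]
  show "0 \<in> {g \<in> bounded_measurable. (\<integral>x. h x * g x \<partial>\<mu>01) = 0}"
    using fs.subspace_0 [OF W] by (simp add: zero_fun_def)
  show "f + g \<in> {g \<in> bounded_measurable. (\<integral>x. h x * g x \<partial>\<mu>01) = 0}"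
    if "f \<in> {g \<in> bounded_measurable. (\<integral>x. h x * g x \<partial>\<mu>01) = 0}"
      "g \<in> {g \<in> bounded_measurable. (\<integral>x. h x * g x \<partial>\<mu>01) = 0}" for f g
    using that fs.subspace_add [OF W, of f g] int [of f] int [of g] by (simp add: distrib_left)
  show "(\<lambda>x. c * f x) \<in> {g \<in> bounded_measurable. (\<integral>x. h x * g x \<partial>\<mu>01) = 0}"
    if "f \<in> {g \<in> bounded_measurable. (\<integral>x. h x * g x \<partial>\<mu>01) = 0}" for c f
    using that fs.subspace_scale [OF W, of f c] by (simp add: mult.left_commute)
qed

text \<open>Gram--Schmidt: the component \<open>r\<close> of the new function \<open>b\<close> orthogonal to the span of \<open>B\<close> is added with
  the coefficient \<open>c\<close>. If \<open>r\<close> vanishes almost everywhere, the quotient that defines \<open>c\<close> is \<open>0\<close>, which is the right value.\<close>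

lemma orthogonal_projection_exists:
  assumes "finite B" "B \<subseteq> bounded_measurable" "integrable \<mu>01 h"
  shows "\<exists>s\<in>fs.span B. \<forall>g\<in>fs.span B. (\<integral>x. (h x - s x) * g x \<partial>\<mu>01) = 0"
  using assms
proof (induction B arbitrary: h rule: finite_induct)
  case empty
  then show ?case by (auto simp: zero_fun_def)
next
  case (insert b B)
  have W: "fs.span B \<subseteq> bounded_measurable"
    using insert.prems(1) subspace_bounded_measurable by (intro fs.span_minimal) auto
  have bW: "b \<in> bounded_measurable" using insert.prems(1) by auto
  obtain sb where sb: "sb \<in> fs.span B" "\<And>g. g \<in> fs.span B \<Longrightarrow> (\<integral>x. (b x - sb x) * g x \<partial>\<mu>01) = 0"
    using insert.IH [of b] insert.prems integrable_bounded_measurable [OF bW] by blast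
  obtain s where s: "s \<in> fs.span B" "\<And>g. g \<in> fs.span B \<Longrightarrow> (\<integral>x. (h x - s x) * g x \<partial>\<mu>01) = 0"
    using insert.IH [of h] insert.prems by blast
  define r where "r x = b x - sb x" for x
  have r_eq: "r = b + (\<lambda>x. (-1) * sb x)" by (simp add: fun_eq_iff r_def)
  then have rW: "r \<in> bounded_measurable"
    using fs.subspace_add [OF subspace_bounded_measurable bW] fs.subspace_scale [OF subspace_bounded_measurable, of sb "-1"] W sb(1)
    by auto
  define c where "c = (\<integral>x. (h x - s x) * r x \<partial>\<mu>01) / (\<integral>x. r x * r x \<partial>\<mu>01)"
  define s' where "s' x = s x + c * r x" for x
  have up: "fs.span B \<subseteq> fs.span (insert b B)" by (rule fs.span_mono) blast
  have "r \<in> fs.span (insert b B)"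
    unfolding r_eq using sb(1) up by (intro fs.span_add [OF fs.span_base fs.span_scale]) auto
  moreover have "s' = s + (\<lambda>x. c * r x)" by (simp add: fun_eq_iff s'_def)
  ultimately have s'_span: "s' \<in> fs.span (insert b B)"
    using s(1) up fs.span_add [OF _ fs.span_scale, of s "insert b B" r c] by auto
  have ih: "integrable \<mu>01 (\<lambda>x. h x - s x)"
    using insert.prems(2) integrable_bounded_measurable [of s] W s(1) by auto
  have ih': "integrable \<mu>01 (\<lambda>x. h x - s' x)"
    unfolding s'_def using insert.prems(2) integrable_bounded_measurable [of s] integrable_bounded_measurable [of r] rW W s(1) by auto
  have split: "(\<integral>x. (h x - s' x) * g x \<partial>\<mu>01) = (\<integral>x. (h x - s x) * g x \<partial>\<mu>01) - c * (\<integral>x. r x * g x \<partial>\<mu>01)"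
    if "g \<in> bounded_measurable" for g
  proof -
    have "(h x - s' x) * g x = (h x - s x) * g x - c * (r x * g x)" for x by (simp add: s'_def algebra_simps)
    then show ?thesis
      using integrable_mult_bounded_measurable [OF ih that] integrable_mult_bounded_measurable [OF integrable_bounded_measurable [OF rW] that]
      by simp
  qed
  have old: "(\<integral>x. (h x - s' x) * g x \<partial>\<mu>01) = 0" if "g \<in> fs.span B" for g
    using split [of g] s(2) sb(2) that W unfolding r_def by auto
  have cr: "c * (\<integral>x. r x * r x \<partial>\<mu>01) = (\<integral>x. (h x - s x) * r x \<partial>\<mu>01)"
  proof (cases "(\<integral>x. r x * r x \<partial>\<mu>01) = 0")
    case True
    then have "AE x in \<mu>01. r x * r x = 0"
      using integral_nonneg_eq_0_iff_AE [OF integrable_mult_bounded_measurable [OF integrable_bounded_measurable [OF rW] rW]]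
      by simp
    then have "AE x in \<mu>01. (h x - s x) * r x = 0" by eventually_elim auto
    then have "(\<integral>x. (h x - s x) * r x \<partial>\<mu>01) = 0" by (rule integral_eq_zero_AE)
    then show ?thesis using True by simp
  qed (simp add: c_def)
  have "(\<integral>x. (h x - s' x) * b x \<partial>\<mu>01) = (\<integral>x. (h x - s' x) * r x + (h x - s' x) * sb x \<partial>\<mu>01)"
    by (simp add: r_def algebra_simps)
  also have "\<dots> = (\<integral>x. (h x - s' x) * r x \<partial>\<mu>01) + (\<integral>x. (h x - s' x) * sb x \<partial>\<mu>01)"
    using integrable_mult_bounded_measurable [OF ih'] rW W sb(1) by (intro Bochner_Integration.integral_add) auto
  also have "\<dots> = 0" using split [OF rW] cr old [OF sb(1)] by simp
  finally have new: "(\<integral>x. (h x - s' x) * b x \<partial>\<mu>01) = 0" .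
  have "insert b B \<subseteq> {g \<in> bounded_measurable. (\<integral>x. (h x - s' x) * g x \<partial>\<mu>01) = 0}"
    using new old fs.span_base insert.prems(1) by auto
  then have "fs.span (insert b B) \<subseteq> {g \<in> bounded_measurable. (\<integral>x. (h x - s' x) * g x \<partial>\<mu>01) = 0}"
    using subspace_orthogonal [OF ih'] by (rule fs.span_minimal)
  then show ?case using s'_span by blast
qed

lemma spline_space_cut_off:
  assumes "interval_sigma_algebra \<F>" "f \<in> spline_space k \<F>"
  shows "(\<lambda>x. if x \<in> {0..1} then f x else 0) \<in> spline_space k \<F>"
proof -
  have "C_on n {0..1} (\<lambda>x. if x \<in> {0..1} then f x else 0)" if "C_on n {0..1} f" for n
  proof (cases n)
    case 0
    have "continuous_on {0..1} (\<lambda>x. if x \<in> {0..1} then f x else 0) \<longleftrightarrow> continuous_on {0..1} f"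
      by (rule continuous_on_cong) auto
    then show ?thesis using that 0 by simp
  next
    case (Suc n')
    then obtain f' where f': "\<forall>x\<in>{0..1}. (f has_real_derivative f' x) (at x within {0..1})" "C_on n' {0..1} f'"
      using \<open>C_on n {0..1} f\<close> by auto
    have "\<forall>x\<in>{0..1}. ((\<lambda>x. if x \<in> {0..1} then f x else 0) has_real_derivative f' x) (at x within {0..1})"
    proof
      fix x :: real assume x: "x \<in> {0..1}"
      show "((\<lambda>x. if x \<in> {0..1} then f x else 0) has_real_derivative f' x) (at x within {0..1})"
        by (rule has_field_derivative_transform_within [of f _ _ _ 1]) (use f'(1) x in auto)
    qed
    then show ?thesis using f'(2) Suc by auto
  qed
  moreover have "A \<subseteq> {0..1}" if "A \<in> atoms \<F>" for A
    using interval_sigma_algebra_atoms(2) [OF assms(1)] that by (auto simp: partition_on_def)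
  then have "\<exists>p. degree p \<le> k - 1 \<and> (\<forall>x\<in>A. (if x \<in> {0..1} then f x else 0) = poly p x)" if "A \<in> atoms \<F>" for A
    using assms(2) that unfolding spline_space_def by fastforce
  ultimately show ?thesis using assms(2) unfolding spline_space_def by blast
qed

text \<open>Splines are unconstrained outside the unit interval, so the space itself is not finite-dimensional.
  The splines that vanish there form a subspace of the span of the monomials on the atoms, hence have
  a finite basis.\<close>

lemma spline_projection_exists:
  assumes \<F>: "interval_sigma_algebra \<F>" and h: "integrable \<mu>01 h"
  shows "\<exists>s\<in>spline_space k \<F>. \<forall>g\<in>spline_space k \<F>. (\<integral>x. (h x - s x) * g x \<partial>\<mu>01) = 0"
proof -
  note P = interval_sigma_algebra_atoms [OF \<F>]
  define V where "V = {v \<in> spline_space k \<F>. \<forall>x. x \<notin> {0..1} \<longrightarrow> v x = 0}"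
  have V: "fs.subspace V"
  proof (rule fs.subspaceI)
    show "0 \<in> V" using const_in_spline_space [of 0] by (simp add: V_def zero_fun_def)
    show "f + g \<in> V" if "f \<in> V" "g \<in> V" for f g
      using that spline_space_lincomb [of f k \<F> g 1 1] by (simp add: V_def plus_fun_def)
    show "(\<lambda>x. c * f x) \<in> V" if "f \<in> V" for c f
      using that spline_space_lincomb [of f k \<F> f c 0] by (simp add: V_def)
  qed
  define e where "e = (\<lambda>(A, j) x. indicator A x * x ^ j :: real)"
  define T where "T = e ` (atoms \<F> \<times> {..k - 1})"
  have finT: "finite T" using P(1) by (simp add: T_def)
  have sum_span: "(\<lambda>x. \<Sum>a\<in>A. c a * u a x) \<in> fs.span T" if "\<And>a. a \<in> A \<Longrightarrow> u a \<in> fs.span T"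
    for A :: "'c set" and u :: "'c \<Rightarrow> real \<Rightarrow> real" and c
    using that
  proof (induction A rule: infinite_finite_induct)
    case (insert a A)
    then have "(\<lambda>x. c a * u a x) + (\<lambda>x. \<Sum>a\<in>A. c a * u a x) \<in> fs.span T"
      by (intro fs.span_add fs.span_scale) auto
    then show ?case using insert.hyps by (simp add: plus_fun_def)
  qed (use fs.span_zero [of T] in \<open>simp_all add: zero_fun_def\<close>)
  have "V \<subseteq> fs.span T"
  proof
    fix v assume v: "v \<in> V"
    have "\<forall>A\<in>atoms \<F>. \<exists>p. degree p \<le> k - 1 \<and> (\<forall>x\<in>A. v x = poly p x)"
      using v by (simp add: V_def spline_space_def)
    then obtain p where p: "\<And>A. A \<in> atoms \<F> \<Longrightarrow> degree (p A) \<le> k - 1" "\<And>A x. A \<in> atoms \<F> \<Longrightarrow> x \<in> A \<Longrightarrow> v x = poly (p A) x"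
      by metis
    have "v x = (\<Sum>(A, j)\<in>atoms \<F> \<times> {..k - 1}. coeff (p A) j * e (A, j) x)" for x
    proof -
      have inner: "(\<Sum>j\<le>k - 1. coeff (p A) j * e (A, j) x) = indicator A x * poly (p A) x" if "A \<in> atoms \<F>" for A
      proof -
        have "poly (p A) x = (\<Sum>j\<le>k - 1. coeff (p A) j * x ^ j)"
          by (subst poly_as_sum_of_monoms' [OF p(1) [OF that], symmetric]) (simp add: poly_sum poly_monom)
        then show ?thesis by (simp add: e_def sum_distrib_left mult_ac)
      qed
      have "(\<Sum>(A, j)\<in>atoms \<F> \<times> {..k - 1}. coeff (p A) j * e (A, j) x)
        = (\<Sum>A\<in>atoms \<F>. \<Sum>j\<le>k - 1. coeff (p A) j * e (A, j) x)"
        by (rule sum.cartesian_product [symmetric])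
      also have "\<dots> = (\<Sum>A\<in>atoms \<F>. indicator A x * poly (p A) x)" by (intro sum.cong refl inner)
      also have "\<dots> = v x"
      proof (cases "x \<in> {0..1}")
        case True
        then obtain A where A: "A \<in> atoms \<F>" "x \<in> A" by (rule atom_containing [OF \<F>])
        have "indicator A' x = (if A' = A then 1 else 0 :: real)" if "A' \<in> atoms \<F>" for A'
          using P(2) A that by (auto simp: partition_on_def disjoint_def indicator_def)
        then have "(\<Sum>A\<in>atoms \<F>. indicator A x * poly (p A) x) = (\<Sum>A'\<in>atoms \<F>. if A' = A then poly (p A) x else 0)"
          by (intro sum.cong) auto
        then show ?thesis using A P(1) p by simp
      next
        case False
        then have "x \<notin> A" if "A \<in> atoms \<F>" for A using that P(2) unfolding partition_on_def by blast
        then have "(\<Sum>A\<in>atoms \<F>. indicator A x * poly (p A) x) = 0" by (intro sum.neutral) auto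
        then show ?thesis using v False by (simp add: V_def)
      qed
      finally show ?thesis ..
    qed
    then have "v = (\<lambda>x. \<Sum>a\<in>atoms \<F> \<times> {..k - 1}. coeff (p (fst a)) (snd a) * e a x)"
      by (simp add: case_prod_beta fun_eq_iff)
    also have "\<dots> \<in> fs.span T" by (rule sum_span) (auto simp: T_def intro!: fs.span_base)
    finally show "v \<in> fs.span T" .
  qed
  moreover obtain B where B: "B \<subseteq> V" "fs.independent B" "V \<subseteq> fs.span B"
    using fs.basis_exists [of V] by metis
  ultimately have "finite B" using fs.independent_span_bound [OF finT B(2)] by blast
  moreover have "B \<subseteq> bounded_measurable"
    using B(1) spline_bounded_measurable [OF \<F>] by (auto simp: V_def)
  ultimately have "\<exists>s\<in>fs.span B. \<forall>g\<in>fs.span B. (\<integral>x. (h x - s x) * g x \<partial>\<mu>01) = 0"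
    using h by (rule orthogonal_projection_exists)
  then obtain s where s: "s \<in> fs.span B" "\<And>g. g \<in> fs.span B \<Longrightarrow> (\<integral>x. (h x - s x) * g x \<partial>\<mu>01) = 0"
    by blast
  have "s \<in> V" using s(1) fs.span_minimal [OF B(1) V] by blast
  moreover have "(\<integral>x. (h x - s x) * g x \<partial>\<mu>01) = 0" if g: "g \<in> spline_space k \<F>" for g
  proof -
    have "(\<lambda>x. if x \<in> {0..1} then g x else 0) \<in> V" using spline_space_cut_off [OF \<F> g] by (simp add: V_def)
    then have "(\<integral>x. (h x - s x) * (if x \<in> {0..1} then g x else 0) \<partial>\<mu>01) = 0" using s(2) B(3) by blast
    also have "(\<integral>x. (h x - s x) * (if x \<in> {0..1} then g x else 0) \<partial>\<mu>01) = (\<integral>x. (h x - s x) * g x \<partial>\<mu>01)"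
      by (rule Bochner_Integration.integral_cong) auto
    finally show ?thesis .
  qed
  ultimately show ?thesis by (auto simp: V_def)
qed

end

text \<open>Testing with a spline cannot distinguish \<open>H\<close> from its projection, which is at most \<open>M\<close> almost everywhere.\<close>

lemma nonneg_spline_test:
  assumes \<F>: "interval_sigma_algebra \<F>" and g: "g \<in> spline_space k \<F>" "\<And>x. x \<in> {0..1} \<Longrightarrow> 0 \<le> g x"
    and M: "0 \<le> M" "spline_proj_norm k \<F> H \<le> ennreal M"
  shows "integrable \<mu>01 H" "(\<integral>x. H x * g x \<partial>\<mu>01) \<le> M * (\<integral>x. g x \<partial>\<mu>01)"
proof -
  show H: "integrable \<mu>01 H"
    using M(2) by (auto simp: spline_proj_norm_def top_unique split: if_splits)
  define s where "s = spline_proj k \<F> H"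
  have "\<exists>s. s \<in> spline_space k \<F> \<and> (\<forall>g\<in>spline_space k \<F>. (\<integral>x. (H x - s x) * g x \<partial>\<mu>01) = 0)"
    using spline_projection_exists [OF \<F> H] by blast
  from someI_ex [OF this] have s: "s \<in> spline_space k \<F>"
    "\<And>g. g \<in> spline_space k \<F> \<Longrightarrow> (\<integral>x. (H x - s x) * g x \<partial>\<mu>01) = 0"
    unfolding s_def spline_proj_def by blast+
  have sW: "s \<in> bounded_measurable" and gW: "g \<in> bounded_measurable"
    using spline_bounded_measurable [OF \<F>] s(1) g(1) by auto
  have "Linf_norm s \<le> ennreal M" using M(2) H by (simp add: spline_proj_norm_def s_def)
  then have sM: "AE x in \<mu>01. s x \<le> M"
    using esssup_AE [of "\<lambda>x. ennreal \<bar>s x\<bar>" \<mu>01] unfolding Linf_norm_def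
    by (auto elim!: eventually_mono) (smt (verit) M(1) ennreal_le_iff order_trans)
  note ig = integrable_mult_bounded_measurable [OF _ gW]
  have "(\<integral>x. H x * g x \<partial>\<mu>01) - (\<integral>x. s x * g x \<partial>\<mu>01) = (\<integral>x. (H x - s x) * g x \<partial>\<mu>01)"
    using ig [OF H] ig [OF integrable_bounded_measurable [OF sW]] by (simp add: left_diff_distrib)
  then have "(\<integral>x. H x * g x \<partial>\<mu>01) = (\<integral>x. s x * g x \<partial>\<mu>01)" using s(2) [OF g(1)] by simp
  also have "\<dots> \<le> (\<integral>x. M * g x \<partial>\<mu>01)"
  proof (rule integral_mono_AE)
    show "AE x in \<mu>01. s x * g x \<le> M * g x"
      using sM AE_space by eventually_elim (auto intro!: mult_right_mono g(2))
  qed (use ig [OF integrable_bounded_measurable [OF sW]] integrable_bounded_measurable [OF gW] in auto)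
  finally show "(\<integral>x. H x * g x \<partial>\<mu>01) \<le> M * (\<integral>x. g x \<partial>\<mu>01)" by simp
qed

text \<open>Test with the spline that covers the support.\<close>

lemma support_carleson_bound:
  assumes \<F>: "interval_sigma_algebra \<F>" and i: "i < grid_size \<F> + d"
    and reg: "regularity (Suc d) \<F> \<le> \<gamma>"
    and M: "0 \<le> M" "spline_proj_norm (Suc d) \<F> H \<le> ennreal M" and H: "\<And>x. 0 \<le> H x"
  defines "t \<equiv> spline_grid.t d (grid_size \<F>) (grid_pt \<F>)"
  shows "(\<integral>\<^sup>+x. ennreal (H x) * indicator {t i<..<t (i + d + 1)} x \<partial>\<mu>01)
    \<le> ennreal (M * ((2 * real d + 1) * \<gamma> ^ d * (t (i + d + 1) - t i)))"
proof -
  obtain \<Phi> where \<Phi>: "\<Phi> \<in> spline_space (Suc d) \<F>" "\<And>x. 0 \<le> \<Phi> x" "\<And>x. \<Phi> x \<le> 1"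
    "\<And>x. x \<in> {t i<..<t (i + d + 1)} \<Longrightarrow> \<Phi> x = 1"
    "\<And>x. x \<in> {0..1} \<Longrightarrow> x \<notin> {t (i - d)..t (i + 2 * d + 1)} \<Longrightarrow> \<Phi> x = 0"
    using cover_spline [OF \<F> i] unfolding t_def by blast
  have \<Phi>W: "\<Phi> \<in> bounded_measurable" by (rule spline_bounded_measurable [OF \<F> \<Phi>(1)])
  note test = nonneg_spline_test [OF \<F> \<Phi>(1) \<Phi>(2) M]
  interpret G: spline_grid d "grid_size \<F>" "grid_pt \<F>" by (rule spline_grid_sigma_algebra [OF \<F>])
  have le: "t (i - d) \<le> t (i + 2 * d + 1)" unfolding t_def by (intro G.t_mono) auto
  have int_ind: "integrable \<mu>01 (indicator {t (i - d)..t (i + 2 * d + 1)} :: real \<Rightarrow> real)"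
  proof (rule integrable_bounded_measurable)
    have "(indicator {t (i - d)..t (i + 2 * d + 1)} :: real \<Rightarrow> real) \<in> borel_measurable \<mu>01"
      by (intro measurable_restrict_space1 borel_measurable_indicator) simp
    then show "(indicator {t (i - d)..t (i + 2 * d + 1)} :: real \<Rightarrow> real) \<in> bounded_measurable"
      unfolding bounded_measurable_def by (auto simp: indicator_def intro!: exI [of _ 1])
  qed
  have "(\<integral>x. \<Phi> x \<partial>\<mu>01) \<le> (\<integral>x. indicator {t (i - d)..t (i + 2 * d + 1)} x \<partial>\<mu>01)"
    using \<Phi>(3,5) by (intro integral_mono integrable_bounded_measurable \<Phi>W int_ind) (auto simp: indicator_def)
  also have "\<dots> = measure \<mu>01 ({t (i - d)..t (i + 2 * d + 1)} \<inter> space \<mu>01)" by simp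
  also have "\<dots> = measure lebesgue ({t (i - d)..t (i + 2 * d + 1)} \<inter> {0..1})"
    by (subst measure_restrict_space) auto
  also have "\<dots> \<le> measure lebesgue {t (i - d)..t (i + 2 * d + 1)}"
    by (intro measure_mono_fmeasurable) auto
  also have "\<dots> = t (i + 2 * d + 1) - t (i - d)" using le by simp
  also have "\<dots> \<le> (2 * real d + 1) * \<gamma> ^ d * (t (i + d + 1) - t i)"
    unfolding t_def by (rule cover_spline_length [OF \<F> i reg])
  finally have int\<Phi>: "(\<integral>x. \<Phi> x \<partial>\<mu>01) \<le> (2 * real d + 1) * \<gamma> ^ d * (t (i + d + 1) - t i)" .
  have "(\<integral>\<^sup>+x. ennreal (H x) * indicator {t i<..<t (i + d + 1)} x \<partial>\<mu>01) \<le> (\<integral>\<^sup>+x. ennreal (H x * \<Phi> x) \<partial>\<mu>01)"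
    using \<Phi>(4) by (intro nn_integral_mono) (auto simp: indicator_def)
  also have "\<dots> = ennreal (\<integral>x. H x * \<Phi> x \<partial>\<mu>01)"
    using \<Phi>(2) H by (intro nn_integral_eq_integral integrable_mult_bounded_measurable test(1) \<Phi>W) auto
  also have "\<dots> \<le> ennreal (M * ((2 * real d + 1) * \<gamma> ^ d * (t (i + d + 1) - t i)))"
    using order_trans [OF test(2) mult_left_mono [OF int\<Phi> M(1)]] by (intro ennreal_leI)
  finally show ?thesis .
qed

section \<open>Packing of tiles\<close>

text \<open>Call \<open>n\<close> a record level if some interval of that level reaches further to the right than all intervals of lower
  levels. The right end points attained at the record levels increase, are breakpoints of
  the highest record level, and all but the last one lie strictly inside the interval of that level, as
  all the intervals contain \<open>x\<close>.\<close>

lemma right_records_bound: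
  fixes u v :: "'a \<Rightarrow> real" and lev :: "'a \<Rightarrow> nat"
  assumes "finite Q" "\<And>T. T \<in> Q \<Longrightarrow> u T < x \<and> x < v T"
    and D_mono: "\<And>T T'. T \<in> Q \<Longrightarrow> T' \<in> Q \<Longrightarrow> lev T \<le> lev T' \<Longrightarrow> D (lev T) \<subseteq> D (lev T')"
    and D: "\<And>T. T \<in> Q \<Longrightarrow> v T \<in> D (lev T) \<and> finite (D (lev T)) \<and> card (D (lev T) \<inter> {u T<..<v T}) \<le> d"
  shows "card {n. \<exists>T\<in>Q. lev T = n \<and> (\<forall>T'\<in>Q. lev T' < n \<longrightarrow> v T' < v T)} \<le> d + 1" (is "card ?R \<le> _")
proof (cases "?R = {}")
  case False
  define R where "R = ?R"
  note False = False [folded R_def]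
  have fin: "finite R" unfolding R_def by (rule finite_subset [of _ "lev ` Q"]) (use assms(1) in auto)
  have "\<forall>n\<in>R. \<exists>T. T \<in> Q \<and> lev T = n \<and> (\<forall>T'\<in>Q. lev T' < n \<longrightarrow> v T' < v T)" unfolding R_def by blast
  from bchoice [OF this] obtain \<tau> where
    "\<forall>n\<in>R. \<tau> n \<in> Q \<and> lev (\<tau> n) = n \<and> (\<forall>T'\<in>Q. lev T' < n \<longrightarrow> v T' < v (\<tau> n))" ..
  then have \<tau>: "\<tau> n \<in> Q \<and> lev (\<tau> n) = n \<and> (\<forall>T'\<in>Q. lev T' < n \<longrightarrow> v T' < v (\<tau> n))" if "n \<in> R" for n
    using that by (rule bspec)
  have less: "v (\<tau> n) < v (\<tau> n')" if "n \<in> R" "n' \<in> R" "n < n'" for n n'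
  proof -
    have "\<tau> n \<in> Q" "lev (\<tau> n) < n'" using \<tau> [OF that(1)] that(3) by auto
    then show ?thesis using \<tau> [OF that(2)] by simp
  qed
  define top where "top = Max R"
  have top: "top \<in> R" "\<And>n. n \<in> R \<Longrightarrow> n \<le> top"
    unfolding top_def using Max_in [OF fin False] Max_ge [OF fin] by blast+
  have inj: "inj_on (\<lambda>n. v (\<tau> n)) (R - {top})"
    by (rule linorder_inj_onI) (use less in \<open>auto simp: neq_iff\<close>)
  have "(\<lambda>n. v (\<tau> n)) ` (R - {top}) \<subseteq> D top \<inter> {u (\<tau> top)<..<v (\<tau> top)}"
  proof
    fix y assume "y \<in> (\<lambda>n. v (\<tau> n)) ` (R - {top})"
    then obtain n where n: "n \<in> R" "n \<noteq> top" "y = v (\<tau> n)" by blast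
    then have "n < top" using top(2) [OF n(1)] by simp
    have "D n \<subseteq> D top" using D_mono [of "\<tau> n" "\<tau> top"] \<tau> [OF n(1)] \<tau> [OF top(1)] \<open>n < top\<close> by auto
    then have "y \<in> D top" using D [of "\<tau> n"] \<tau> [OF n(1)] n(3) by auto
    moreover have "u (\<tau> top) < y" using assms(2) [of "\<tau> top"] assms(2) [of "\<tau> n"] \<tau> [OF n(1)] \<tau> [OF top(1)] n(3) by auto
    moreover have "y < v (\<tau> top)" using less [OF n(1) top(1) \<open>n < top\<close>] n(3) by simp
    ultimately show "y \<in> D top \<inter> {u (\<tau> top)<..<v (\<tau> top)}" by simp
  qed
  moreover have "finite (D top)" using D [of "\<tau> top"] \<tau> [OF top(1)] by auto
  ultimately have "card (R - {top}) \<le> card (D top \<inter> {u (\<tau> top)<..<v (\<tau> top)})"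
    using inj by (intro card_inj_on_le [of "\<lambda>n. v (\<tau> n)"]) auto
  also have "\<dots> \<le> d" using D [of "\<tau> top"] \<tau> [OF top(1)] by auto
  finally show ?thesis unfolding R_def [symmetric] using top(1) fin by (simp add: card_Diff_singleton)
next
  case True
  then show ?thesis by (simp only: card.empty)
qed

text \<open>What the packing argument uses of the supports of B-splines: \<open>D n\<close> are the breakpoints of level \<open>n\<close>, which
  persist on later levels, and an interval contains few breakpoints of its own level.\<close>

locale tile_system =
  fixes Tiles :: "'a set" and lev :: "'a \<Rightarrow> nat" and u v :: "'a \<Rightarrow> real" and D :: "nat \<Rightarrow> real set"
    and d N :: nat
  assumes finite_Tiles: "finite Tiles"
    and lev_range: "T \<in> Tiles \<Longrightarrow> lev T \<in> {1..N}"
    and D_mono: "T \<in> Tiles \<Longrightarrow> T' \<in> Tiles \<Longrightarrow> lev T \<le> lev T' \<Longrightarrow> D (lev T) \<subseteq> D (lev T')"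
    and D_finite: "T \<in> Tiles \<Longrightarrow> finite (D (lev T))"
    and endpoints_in_D: "T \<in> Tiles \<Longrightarrow> u T \<in> D (lev T) \<and> v T \<in> D (lev T)"
    and few_interior: "T \<in> Tiles \<Longrightarrow> card (D (lev T) \<inter> {u T<..<v T}) \<le> d"
    and level_overlap: "card {T \<in> Tiles. lev T = n \<and> x \<in> {u T<..<v T}} \<le> d + 1"
begin

abbreviation tile :: "'a \<Rightarrow> real set" where "tile T \<equiv> {u T<..<v T}"

definition fresh :: "'a set \<Rightarrow> 'a set" where
  "fresh Q = {T \<in> Q. \<not> tile T \<subseteq> (\<Union>T'\<in>{T' \<in> Q. lev T' < lev T}. tile T')}"

text \<open>The mirror image of the bound for right end points.\<close>

lemma left_records_bound:
  assumes "Q \<subseteq> Tiles" "\<And>T. T \<in> Q \<Longrightarrow> x \<in> tile T"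
  shows "card {n. \<exists>T\<in>Q. lev T = n \<and> (\<forall>T'\<in>Q. lev T' < n \<longrightarrow> u T < u T')} \<le> d + 1"
proof -
  have "card {n. \<exists>T\<in>Q. lev T = n \<and> (\<forall>T'\<in>Q. lev T' < n \<longrightarrow> - u T' < - u T)} \<le> d + 1"
  proof (rule right_records_bound [where u = "\<lambda>T. - v T" and x = "- x" and D = "\<lambda>n. uminus ` D n"])
    show "finite Q" using assms(1) finite_Tiles finite_subset by blast
    show "- v T < - x \<and> - x < - u T" if "T \<in> Q" for T using assms(2) [OF that] by simp
    show "uminus ` D (lev T) \<subseteq> uminus ` D (lev T')" if "T \<in> Q" "T' \<in> Q" "lev T \<le> lev T'" for T T'
      using D_mono [of T T'] assms(1) that by (intro image_mono) auto
    show "- u T \<in> uminus ` D (lev T) \<and> finite (uminus ` D (lev T)) \<and> card (uminus ` D (lev T) \<inter> {- v T<..<- u T}) \<le> d"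
      if T: "T \<in> Q" for T
    proof -
      have T': "T \<in> Tiles" using T assms(1) by blast
      have "uminus ` D (lev T) \<inter> {- v T<..<- u T} = uminus ` (D (lev T) \<inter> tile T)" by auto
      then have "card (uminus ` D (lev T) \<inter> {- v T<..<- u T}) = card (D (lev T) \<inter> tile T)"
        by (simp add: card_image)
      then show ?thesis using few_interior [OF T'] D_finite [OF T'] endpoints_in_D [OF T'] by auto
    qed
  qed
  then show ?thesis by simp
qed

text \<open>Let \<open>x\<close> lie in a fresh tile. If its level were a record level neither for right nor for left end points,
  there would be two tiles of lower levels around \<open>x\<close>, one reaching as far to the right and one as far to the
  left, and together they would cover it. So there are at most \<open>2 * (d + 1)\<close> levels, with at
  most \<open>d + 1\<close> tiles of each level.\<close>

lemma fresh_overlap: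
  assumes Q: "Q \<subseteq> Tiles"
  shows "card {T \<in> fresh Q. x \<in> tile T} \<le> 2 * (d + 1) ^ 2"
proof -
  define Qx where "Qx = {T \<in> Q. x \<in> tile T}"
  have Qx: "Qx \<subseteq> Tiles" "\<And>T. T \<in> Qx \<Longrightarrow> x \<in> tile T" using Q by (auto simp: Qx_def)
  have finQx: "finite Qx" using Qx(1) finite_Tiles finite_subset by blast
  define R where "R = {n. \<exists>T\<in>Qx. lev T = n \<and> (\<forall>T'\<in>Qx. lev T' < n \<longrightarrow> v T' < v T)}"
  define L where "L = {n. \<exists>T\<in>Qx. lev T = n \<and> (\<forall>T'\<in>Qx. lev T' < n \<longrightarrow> u T < u T')}"
  have cardR: "card R \<le> d + 1" unfolding R_def
  proof (rule right_records_bound [OF finQx, where D = D])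
    show "u T < x \<and> x < v T" if "T \<in> Qx" for T using Qx(2) [OF that] by simp
    show "D (lev T) \<subseteq> D (lev T')" if "T \<in> Qx" "T' \<in> Qx" "lev T \<le> lev T'" for T T'
      using D_mono Qx(1) that by blast
    show "v T \<in> D (lev T) \<and> finite (D (lev T)) \<and> card (D (lev T) \<inter> tile T) \<le> d" if "T \<in> Qx" for T
      using D_finite endpoints_in_D few_interior Qx(1) that by blast
  qed
  have cardL: "card L \<le> d + 1" unfolding L_def by (rule left_records_bound [OF Qx])
  have finLR: "finite (L \<union> R)"
    by (rule finite_subset [of _ "lev ` Qx"]) (use finQx in \<open>auto simp: L_def R_def\<close>)
  have "{T \<in> fresh Q. x \<in> tile T} \<subseteq> (\<Union>n\<in>L \<union> R. {T \<in> Tiles. lev T = n \<and> x \<in> tile T})"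
  proof
    fix T assume "T \<in> {T \<in> fresh Q. x \<in> tile T}"
    then have T: "T \<in> Q" "x \<in> tile T" "\<not> tile T \<subseteq> (\<Union>T'\<in>{T' \<in> Q. lev T' < lev T}. tile T')"
      by (auto simp: fresh_def)
    have TQx: "T \<in> Qx" using T by (simp add: Qx_def)
    have "lev T \<in> L \<union> R"
    proof (rule ccontr)
      assume "lev T \<notin> L \<union> R"
      then have "\<exists>T1\<in>Qx. lev T1 < lev T \<and> v T \<le> v T1" "\<exists>T2\<in>Qx. lev T2 < lev T \<and> u T2 \<le> u T"
        using TQx unfolding L_def R_def not_less [symmetric] by blast+
      then obtain T1 T2 where T12: "T1 \<in> Qx" "lev T1 < lev T" "v T \<le> v T1" "T2 \<in> Qx" "lev T2 < lev T" "u T2 \<le> u T"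
        by blast
      have "tile T \<subseteq> tile T1 \<union> tile T2"
        using T12(3,6) Qx(2) [OF T12(1)] Qx(2) [OF T12(4)] by auto
      then show False using T(3) T12 unfolding Qx_def by blast
    qed
    then show "T \<in> (\<Union>n\<in>L \<union> R. {T \<in> Tiles. lev T = n \<and> x \<in> tile T})"
      using T(1,2) Q by blast
  qed
  then have "card {T \<in> fresh Q. x \<in> tile T} \<le> card (\<Union>n\<in>L \<union> R. {T \<in> Tiles. lev T = n \<and> x \<in> tile T})"
    using finLR finite_Tiles by (intro card_mono) auto
  also have "\<dots> \<le> (\<Sum>n\<in>L \<union> R. card {T \<in> Tiles. lev T = n \<and> x \<in> tile T})"
    using finLR by (rule card_UN_le)
  also have "\<dots> \<le> (\<Sum>n\<in>L \<union> R. d + 1)" by (intro sum_mono level_overlap)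
  also have "\<dots> = card (L \<union> R) * (d + 1)" by simp
  also have "\<dots> \<le> (card L + card R) * (d + 1)" by (intro mult_right_mono card_Un_le) simp
  also have "\<dots> \<le> ((d + 1) + (d + 1)) * (d + 1)" using cardL cardR by (intro mult_right_mono add_mono) auto
  finally show ?thesis by (simp add: power2_eq_square mult_2 [symmetric] mult.assoc)
qed

lemma level_sum_bound:
  fixes g :: "nat \<Rightarrow> ennreal"
  assumes Q: "Q \<subseteq> Tiles"
  shows "(\<Sum>T\<in>Q. g (lev T) * indicator (tile T) x) \<le> of_nat (d + 1) * (\<Sum>n\<in>lev ` {T \<in> Q. x \<in> tile T}. g n)"
proof -
  have fin: "finite Q" using Q finite_Tiles finite_subset by blast
  define Qx where "Qx = {T \<in> Q. x \<in> tile T}"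
  have finx: "finite Qx" using fin by (simp add: Qx_def)
  have "(\<Sum>T\<in>Q. g (lev T) * indicator (tile T) x) = (\<Sum>T\<in>Qx. g (lev T))"
    unfolding Qx_def sum.inter_filter [OF fin] by (intro sum.cong) (auto simp: indicator_def)
  also have "\<dots> = (\<Sum>n\<in>lev ` Qx. \<Sum>T\<in>{T \<in> Qx. lev T = n}. g (lev T))" by (rule sum.image_gen [OF finx])
  also have "\<dots> \<le> (\<Sum>n\<in>lev ` Qx. of_nat (d + 1) * g n)"
  proof (rule sum_mono)
    fix n
    have "(\<Sum>T\<in>{T \<in> Qx. lev T = n}. g (lev T)) = (\<Sum>T\<in>{T \<in> Qx. lev T = n}. g n)" by (intro sum.cong) auto
    also have "\<dots> = of_nat (card {T \<in> Qx. lev T = n}) * g n" by simp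
    also have "card {T \<in> Qx. lev T = n} \<le> card {T \<in> Tiles. lev T = n \<and> x \<in> tile T}"
      using Q finite_Tiles by (intro card_mono) (auto simp: Qx_def)
    then have "card {T \<in> Qx. lev T = n} \<le> d + 1" using level_overlap [of n x] by linarith
    then have "of_nat (card {T \<in> Qx. lev T = n}) * g n \<le> of_nat (d + 1) * g n"
      by (intro mult_right_mono) (simp_all only: of_nat_le_iff zero_le)
    finally show "(\<Sum>T\<in>{T \<in> Qx. lev T = n}. g (lev T)) \<le> of_nat (d + 1) * g n" .
  qed
  finally show ?thesis by (simp only: Qx_def sum_distrib_left)
qed

text \<open>A tile of the lowest level among the tiles of \<open>Q\<close> around \<open>x\<close> is fresh, and its tail sum alone contains all the terms on the left.\<close>

lemma fresh_dominates:
  fixes g :: "nat \<Rightarrow> ennreal"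
  assumes Q: "Q \<subseteq> Tiles"
  shows "(\<Sum>T\<in>Q. g (lev T) * indicator (tile T) x)
    \<le> of_nat (d + 1) * (\<Sum>T\<in>fresh Q. (\<Sum>l\<in>{lev T..N}. g l) * indicator (tile T) x)"
proof (cases "{T \<in> Q. x \<in> tile T} = {}")
  case True
  then show ?thesis using level_sum_bound [OF Q, of g x] by (simp only: image_empty sum.empty mult_zero_right le_zero_eq) simp
next
  case False
  have fin: "finite Q" using Q finite_Tiles finite_subset by blast
  define Qx where "Qx = {T \<in> Q. x \<in> tile T}"
  have finx: "finite (lev ` Qx)" "lev ` Qx \<noteq> {}" using fin False by (auto simp: Qx_def)
  define m where "m = Min (lev ` Qx)"
  have m: "m \<in> lev ` Qx" "\<And>n. n \<in> lev ` Qx \<Longrightarrow> m \<le> n" using finx by (simp_all add: m_def)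
  obtain T0 where T0: "T0 \<in> Q" "x \<in> tile T0" "lev T0 = m" using m(1) by (auto simp: Qx_def)
  have "x \<notin> tile T'" if "T' \<in> Q" "lev T' < lev T0" for T'
    using m(2) [of "lev T'"] that T0(3) by (auto simp: Qx_def)
  then have fresh: "T0 \<in> fresh Q" using T0 unfolding fresh_def by blast
  have "lev ` Qx \<subseteq> {m..N}" using m(2) lev_range Q by (fastforce simp: Qx_def)
  then have "(\<Sum>n\<in>lev ` Qx. g n) \<le> (\<Sum>l\<in>{lev T0..N}. g l) * indicator (tile T0) x"
    using T0 by (simp add: sum_mono2)
  also have "\<dots> \<le> (\<Sum>T\<in>fresh Q. (\<Sum>l\<in>{lev T..N}. g l) * indicator (tile T) x)"
    using fresh fin by (intro member_le_sum) (auto simp: fresh_def)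
  finally have "of_nat (d + 1) * (\<Sum>n\<in>lev ` Qx. g n) \<le> of_nat (d + 1) * (\<Sum>T\<in>fresh Q. (\<Sum>l\<in>{lev T..N}. g l) * indicator (tile T) x)"
    by (intro mult_left_mono) auto
  then show ?thesis using level_sum_bound [OF Q, of g x] unfolding Qx_def by (rule order_trans [rotated])
qed

lemma carleson_packing:
  fixes M :: "real measure" and g :: "nat \<Rightarrow> real \<Rightarrow> ennreal"
  assumes Q: "Q \<subseteq> Tiles" and tile_sets: "\<And>T. T \<in> Tiles \<Longrightarrow> tile T \<in> sets M"
    and g: "\<And>n. n \<in> {1..N} \<Longrightarrow> g n \<in> borel_measurable M" and S: "S \<in> sets M"
    and carl: "\<And>T. T \<in> Tiles \<Longrightarrow> (\<integral>\<^sup>+x. (\<Sum>l\<in>{lev T..N}. g l x) * indicator (tile T) x \<partial>M) \<le> K * emeasure M (tile T)"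
    and dense: "\<And>T. T \<in> Q \<Longrightarrow> emeasure M (tile T) \<le> \<kappa> * emeasure M (tile T \<inter> S)"
  shows "(\<Sum>T\<in>Q. \<integral>\<^sup>+x. g (lev T) x * indicator (tile T) x \<partial>M) \<le> of_nat (2 * (d + 1) ^ 3) * K * \<kappa> * emeasure M S"
proof -
  have "fresh Q \<subseteq> Q" by (auto simp: fresh_def)
  moreover from this have "finite (fresh Q)" using Q by (intro finite_subset [OF _ finite_Tiles]) auto
  ultimately have fin: "finite (fresh Q)" "fresh Q \<subseteq> Q" by auto
  have meas: "(\<lambda>x. g (lev T) x * indicator (tile T) x) \<in> borel_measurable M" if "T \<in> Tiles" for T
    using g [OF lev_range [OF that]] tile_sets [OF that] by measurable
  have meas': "(\<lambda>x. (\<Sum>l\<in>{lev T..N}. g l x) * indicator (tile T) x) \<in> borel_measurable M" if "T \<in> Tiles" for T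
  proof -
    have "g l \<in> borel_measurable M" if "l \<in> {lev T..N}" for l
      using g that lev_range [OF \<open>T \<in> Tiles\<close>] by auto
    then have "(\<lambda>x. \<Sum>l\<in>{lev T..N}. g l x) \<in> borel_measurable M" by (rule borel_measurable_sum)
    then show ?thesis using tile_sets [OF that] by measurable
  qed
  have "(\<Sum>T\<in>Q. \<integral>\<^sup>+x. g (lev T) x * indicator (tile T) x \<partial>M) = (\<integral>\<^sup>+x. (\<Sum>T\<in>Q. g (lev T) x * indicator (tile T) x) \<partial>M)"
    using meas Q by (intro nn_integral_sum [symmetric]) auto
  also have "\<dots> \<le> (\<integral>\<^sup>+x. of_nat (d + 1) * (\<Sum>T\<in>fresh Q. (\<Sum>l\<in>{lev T..N}. g l x) * indicator (tile T) x) \<partial>M)"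
    by (intro nn_integral_mono fresh_dominates [OF Q])
  also have "\<dots> = of_nat (d + 1) * (\<Sum>T\<in>fresh Q. \<integral>\<^sup>+x. (\<Sum>l\<in>{lev T..N}. g l x) * indicator (tile T) x \<partial>M)"
  proof -
    have ms: "(\<lambda>x. (\<Sum>l\<in>{lev T..N}. g l x) * indicator (tile T) x) \<in> borel_measurable M" if "T \<in> fresh Q" for T
      using meas' that fin(2) Q by blast
    show ?thesis
      by (subst nn_integral_cmult) (use ms in \<open>auto simp: nn_integral_sum intro!: borel_measurable_sum\<close>)
  qed
  also have "\<dots> \<le> of_nat (d + 1) * (\<Sum>T\<in>fresh Q. K * (\<kappa> * emeasure M (tile T \<inter> S)))"
  proof (intro mult_left_mono sum_mono)
    fix T assume "T \<in> fresh Q"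
    then have T: "T \<in> Q" "T \<in> Tiles" using fin(2) Q by auto
    show "(\<integral>\<^sup>+x. (\<Sum>l\<in>{lev T..N}. g l x) * indicator (tile T) x \<partial>M) \<le> K * (\<kappa> * emeasure M (tile T \<inter> S))"
      by (rule order_trans [OF carl [OF T(2)] mult_left_mono [OF dense [OF T(1)]]]) simp
  qed simp
  also have "\<dots> = of_nat (d + 1) * (K * (\<kappa> * (\<Sum>T\<in>fresh Q. emeasure M (tile T \<inter> S))))"
    by (simp only: sum_distrib_left)
  also have "(\<Sum>T\<in>fresh Q. emeasure M (tile T \<inter> S)) = (\<integral>\<^sup>+x. (\<Sum>T\<in>fresh Q. indicator (tile T \<inter> S) x) \<partial>M)"
  proof -
    have sets: "tile T \<inter> S \<in> sets M" if "T \<in> fresh Q" for T using tile_sets S fin(2) Q that by auto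
    then have "(\<integral>\<^sup>+x. (\<Sum>T\<in>fresh Q. indicator (tile T \<inter> S) x) \<partial>M) = (\<Sum>T\<in>fresh Q. \<integral>\<^sup>+x. indicator (tile T \<inter> S) x \<partial>M)"
      by (intro nn_integral_sum) auto
    also have "\<dots> = (\<Sum>T\<in>fresh Q. emeasure M (tile T \<inter> S))" by (intro sum.cong refl nn_integral_indicator sets)
    finally show ?thesis ..
  qed
  also have "\<dots> \<le> (\<integral>\<^sup>+x. of_nat (2 * (d + 1) ^ 2) * indicator S x \<partial>M)"
  proof (rule nn_integral_mono)
    fix x
    have "(\<Sum>T\<in>fresh Q. indicator (tile T \<inter> S) x) = (\<Sum>T\<in>fresh Q. if x \<in> tile T then 1 else 0) * (indicator S x :: ennreal)"
      by (auto simp: indicator_def sum_distrib_right intro!: sum.cong)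
    also have "(\<Sum>T\<in>fresh Q. if x \<in> tile T then 1 else 0 :: ennreal) = of_nat (card {T \<in> fresh Q. x \<in> tile T})"
      using fin(1) by (simp add: sum.inter_filter [symmetric])
    also have "\<dots> * indicator S x \<le> of_nat (2 * (d + 1) ^ 2) * (indicator S x :: ennreal)"
      using fresh_overlap [OF Q, of x] by (intro mult_right_mono) (simp_all only: of_nat_le_iff zero_le)
    finally show "(\<Sum>T\<in>fresh Q. indicator (tile T \<inter> S) x) \<le> of_nat (2 * (d + 1) ^ 2) * (indicator S x :: ennreal)" .
  qed
  also have "\<dots> = of_nat (2 * (d + 1) ^ 2) * emeasure M S"
    using S by (subst nn_integral_cmult_indicator) auto
  finally have "(\<Sum>T\<in>Q. \<integral>\<^sup>+x. g (lev T) x * indicator (tile T) x \<partial>M)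
    \<le> of_nat (d + 1) * (K * (\<kappa> * (of_nat (2 * (d + 1) ^ 2) * emeasure M S)))"
    by (simp add: mult_left_mono)
  also have "\<dots> = of_nat (2 * (d + 1) ^ 3) * K * \<kappa> * emeasure M S"
    unfolding power3_eq_cube power2_eq_square of_nat_mult by (simp only: mult_ac)
  finally show ?thesis .
qed

end

section \<open>The square function inequality for tiles\<close>

definition square_fn :: "(nat \<Rightarrow> real \<Rightarrow> real) \<Rightarrow> nat \<Rightarrow> real \<Rightarrow> real" where
  "square_fn f n x = sqrt (\<Sum>l=1..n. (f l x)\<^sup>2)"

lemma square_fn_nonneg: "0 \<le> square_fn f n x"
  by (simp add: square_fn_def sum_nonneg)

lemma square_fn_mono: "m \<le> n \<Longrightarrow> square_fn f m x \<le> square_fn f n x"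
  unfolding square_fn_def by (intro real_sqrt_le_mono sum_mono2) auto

lemma abs_le_square_fn: "1 \<le> n \<Longrightarrow> \<bar>f n x\<bar> \<le> square_fn f n x"
proof -
  assume "1 \<le> n"
  then have "(f n x)\<^sup>2 \<le> (\<Sum>l=1..n. (f l x)\<^sup>2)" by (intro member_le_sum) auto
  then show ?thesis unfolding square_fn_def using real_sqrt_le_mono by fastforce
qed

text \<open>With \<open>a\<close> and \<open>b\<close> the square functions of orders \<open>n - 1\<close> and \<open>n\<close>,
  \<open>f n ^ 2 / b = (b - a) * (b + a) / b \<le> 2 * (b - a)\<close>, which telescopes.\<close>

lemma square_fn_sum:
  "(\<Sum>n=1..N. (f n x)\<^sup>2 / square_fn f n x) \<le> 2 * square_fn f N x"
proof (induction N)
  case 0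
  then show ?case by (simp add: square_fn_def)
next
  case (Suc N)
  let ?a = "square_fn f N x" and ?b = "square_fn f (Suc N) x"
  have "?b\<^sup>2 = ?a\<^sup>2 + (f (Suc N) x)\<^sup>2"
    by (simp add: square_fn_def sum_nonneg)
  then have "(f (Suc N) x)\<^sup>2 = (?b - ?a) * (?b + ?a)" by (simp add: power2_eq_square algebra_simps)
  also have "\<dots> \<le> (?b - ?a) * (2 * ?b)"
    using square_fn_mono [of N "Suc N" f x] by (intro mult_left_mono) auto
  finally have le: "(f (Suc N) x)\<^sup>2 \<le> (2 * (?b - ?a)) * ?b" by (simp only: mult_ac)
  have "(f (Suc N) x)\<^sup>2 / ?b \<le> 2 * (?b - ?a)"
  proof (cases "?b = 0")
    case True
    then show ?thesis using square_fn_mono [of N "Suc N" f x] square_fn_nonneg [of f N x] by simp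
  next
    case False
    then have "0 < ?b" using square_fn_nonneg [of f "Suc N" x] by simp
    then show ?thesis using le by (simp only: pos_divide_le_eq)
  qed
  then show ?case using Suc by simp
qed

lemma nn_integral_layer_cake:
  fixes X :: "'b \<Rightarrow> real"
  assumes "sigma_finite_measure M" and X [measurable]: "X \<in> borel_measurable M"
  shows "(\<integral>\<^sup>+\<theta>. emeasure M {x \<in> space M. 0 < \<theta> \<and> \<theta> < 2 * X x} \<partial>lborel) = 2 * (\<integral>\<^sup>+x. ennreal (X x) \<partial>M)"
proof -
  interpret M: sigma_finite_measure M by fact
  interpret pair_sigma_finite M lborel ..
  let ?A = "{p \<in> space (M \<Otimes>\<^sub>M lborel). 0 < snd p \<and> snd p < 2 * X (fst p)}"
  have A [measurable]: "?A \<in> sets (M \<Otimes>\<^sub>M lborel)" by measurable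
  have "(\<integral>\<^sup>+\<theta>. emeasure M {x \<in> space M. 0 < \<theta> \<and> \<theta> < 2 * X x} \<partial>lborel)
      = (\<integral>\<^sup>+\<theta>. (\<integral>\<^sup>+x. indicator ?A (x, \<theta>) \<partial>M) \<partial>lborel)"
  proof (rule nn_integral_cong)
    fix \<theta> :: real
    have "(\<integral>\<^sup>+x. indicator ?A (x, \<theta>) \<partial>M) = (\<integral>\<^sup>+x. indicator {x \<in> space M. 0 < \<theta> \<and> \<theta> < 2 * X x} x \<partial>M)"
      by (intro nn_integral_cong) (auto simp: indicator_def space_pair_measure)
    then show "emeasure M {x \<in> space M. 0 < \<theta> \<and> \<theta> < 2 * X x} = (\<integral>\<^sup>+x. indicator ?A (x, \<theta>) \<partial>M)" by simp
  qed
  also have "\<dots> = (\<integral>\<^sup>+x. (\<integral>\<^sup>+\<theta>. indicator ?A (x, \<theta>) \<partial>lborel) \<partial>M)"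
    by (rule Fubini') measurable
  also have "\<dots> = (\<integral>\<^sup>+x. ennreal (2 * X x) \<partial>M)"
  proof (rule nn_integral_cong)
    fix x assume x: "x \<in> space M"
    have "(\<integral>\<^sup>+\<theta>. indicator ?A (x, \<theta>) \<partial>lborel) = (\<integral>\<^sup>+\<theta>. indicator {0<..<2 * X x} \<theta> \<partial>lborel)"
      using x by (intro nn_integral_cong) (auto simp: indicator_def space_pair_measure)
    then show "(\<integral>\<^sup>+\<theta>. indicator ?A (x, \<theta>) \<partial>lborel) = ennreal (2 * X x)"
      by (cases "0 \<le> X x") (auto simp: ennreal_neg)
  qed
  also have "\<dots> = 2 * (\<integral>\<^sup>+x. ennreal (X x) \<partial>M)"
    by (subst nn_integral_cmult [symmetric]) (auto simp: ennreal_mult' intro!: nn_integral_cong)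
  finally show ?thesis .
qed

lemma weighted_am_gm:
  fixes \<alpha> \<eta> s \<epsilon> :: real
  assumes "0 < \<epsilon>" "0 < s"
  shows "\<alpha> * \<eta> \<le> (\<epsilon> / 2) * (\<alpha>\<^sup>2 * s) + (1 / (2 * \<epsilon>)) * (\<eta>\<^sup>2 * (1 / s))"
proof -
  have "0 \<le> (\<epsilon> * s * \<alpha> - \<eta>)\<^sup>2 / (2 * \<epsilon> * s)" using assms by simp
  also have "\<dots> = (\<epsilon> / 2) * (\<alpha>\<^sup>2 * s) + (1 / (2 * \<epsilon>)) * (\<eta>\<^sup>2 * (1 / s)) - \<alpha> * \<eta>"
    using assms by (simp add: field_simps power2_eq_square)
  finally show ?thesis by simp
qed

context tile_system
begin

text \<open>The hypotheses are the outcome of the stability of splines (\<open>f_le\<close>, \<open>f_ge\<close>, \<open>G_large\<close>) and of the Carleson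
  condition with constant \<open>\<epsilon>^2\<close>. After the weighted inequality between arithmetic and geometric
  means, the two resulting sums are estimated separately, the first through the growth of the square
  function and the second through packing on its level sets.\<close>

lemma tile_square_function_inequality:
  fixes M :: "real measure" and f h :: "nat \<Rightarrow> real \<Rightarrow> real" and G :: "'a \<Rightarrow> real set" and \<alpha> :: "'a \<Rightarrow> real"
  assumes "finite_measure M" and tile_sets: "\<And>T. T \<in> Tiles \<Longrightarrow> tile T \<in> sets M"
    and G_sets: "\<And>T. T \<in> Tiles \<Longrightarrow> G T \<in> sets M" and G_sub: "\<And>T. T \<in> Tiles \<Longrightarrow> G T \<subseteq> tile T"
    and f [measurable]: "\<And>n. n \<in> {1..N} \<Longrightarrow> f n \<in> borel_measurable M"
    and h [measurable]: "\<And>n. n \<in> {1..N} \<Longrightarrow> h n \<in> borel_measurable M"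
    and \<alpha>: "\<And>T. T \<in> Tiles \<Longrightarrow> 0 < \<alpha> T" and \<kappa>: "0 < \<kappa>" and \<epsilon>: "0 < \<epsilon>"
    and f_le: "\<And>n. n \<in> {1..N} \<Longrightarrow> AE x in M. \<bar>f n x\<bar> \<le> (\<Sum>T\<in>{T \<in> Tiles. lev T = n}. \<alpha> T * indicator (tile T) x)"
    and f_ge: "\<And>T x. T \<in> Tiles \<Longrightarrow> x \<in> G T \<Longrightarrow> \<alpha> T \<le> \<kappa> * \<bar>f (lev T) x\<bar>"
    and G_large: "\<And>T. T \<in> Tiles \<Longrightarrow> measure M (tile T) \<le> \<kappa> * measure M (G T)"
    and tile_pos: "\<And>T. T \<in> Tiles \<Longrightarrow> 0 < measure M (tile T)"
    and carl: "\<And>T. T \<in> Tiles \<Longrightarrow> (\<integral>\<^sup>+x. (\<Sum>l\<in>{lev T..N}. ennreal ((h l x)\<^sup>2)) * indicator (tile T) x \<partial>M)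
        \<le> ennreal (\<epsilon>\<^sup>2) * emeasure M (tile T)"
  shows "(\<Sum>n=1..N. \<integral>\<^sup>+x. ennreal \<bar>f n x * h n x\<bar> \<partial>M)
    \<le> ennreal (\<epsilon> * ((real d + 1) * \<kappa> ^ 3 + 4 * \<kappa> * (real d + 1) ^ 3)) * (\<integral>\<^sup>+x. ennreal (square_fn f N x) \<partial>M)"
proof -
  interpret M: finite_measure M by fact
  let ?X = "square_fn f" and ?E = "\<lambda>T. indicator (tile T) :: real \<Rightarrow> ennreal"
  define I where "I = (\<integral>\<^sup>+x. ennreal (?X N x) \<partial>M)"
  note [measurable] = tile_sets G_sets
  have X_meas: "?X n \<in> borel_measurable M" if "n \<le> N" for n
  proof -
    have "f l \<in> borel_measurable M" if "l \<in> {1..n}" for l using f that \<open>n \<le> N\<close> by auto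
    then show ?thesis unfolding square_fn_def by measurable
  qed
  have lev: "lev T \<in> {1..N}" "1 \<le> lev T" "lev T \<le> N" if "T \<in> Tiles" for T using lev_range [OF that] by auto
  have G_pos: "0 < measure M (G T)" if "T \<in> Tiles" for T
    using tile_pos [OF that] G_large [OF that] \<kappa> by (smt (verit) mult_nonneg_nonpos)
  have X_ge: "\<alpha> T / \<kappa> \<le> ?X (lev T) x" if "T \<in> Tiles" "x \<in> G T" for T x
  proof -
    have "\<alpha> T / \<kappa> \<le> \<bar>f (lev T) x\<bar>" using f_ge [OF that] \<kappa> by (simp add: field_simps)
    also have "\<dots> \<le> ?X (lev T) x" by (rule abs_le_square_fn) (rule lev(2) [OF that(1)])
    finally show ?thesis .
  qed
  have X_pos: "0 < ?X (lev T) x" if "T \<in> Tiles" "x \<in> G T" for T x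
    using X_ge [OF that] divide_pos_pos [OF \<alpha> [OF that(1)] \<kappa>] by linarith
  \<comment> \<open>\<open>1 / s T\<close> is the harmonic mean of the square function of level \<open>lev T\<close> over \<open>G T\<close>. An
    arithmetic mean would control the first sum below as well, but only the harmonic mean has
    the property that \<open>\<theta> < 1 / s T\<close> forces the square function to exceed \<open>\<theta> / 2\<close> on half of \<open>G T\<close>.\<close>
  define S where "S T = (\<integral>\<^sup>+x. ennreal (1 / ?X (lev T) x) * indicator (G T) x \<partial>M)" for T
  define s where "s T = enn2real (S T) / measure M (G T)" for T
  have XT_meas: "(\<lambda>x. ennreal (1 / ?X (lev T) x) * indicator (G T) x) \<in> borel_measurable M" if "T \<in> Tiles" for T
    using X_meas [OF lev(3) [OF that]] G_sets [OF that] by measurable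
  have S_fin: "S T < \<infinity>" if T: "T \<in> Tiles" for T
  proof -
    have "S T \<le> (\<integral>\<^sup>+x. ennreal (\<kappa> / \<alpha> T) * indicator (G T) x \<partial>M)"
      unfolding S_def
    proof (intro nn_integral_mono)
      fix x
      show "ennreal (1 / ?X (lev T) x) * indicator (G T) x \<le> ennreal (\<kappa> / \<alpha> T) * indicator (G T) x"
      proof (cases "x \<in> G T")
        case True
        have "1 / ?X (lev T) x \<le> \<kappa> / \<alpha> T"
          using X_ge [OF T True] X_pos [OF T True] \<alpha> [OF T] \<kappa> by (simp add: field_simps)
        then show ?thesis using True by (simp add: ennreal_leI)
      qed simp
    qed
    also have "\<dots> = ennreal (\<kappa> / \<alpha> T) * emeasure M (G T)" using G_sets [OF T] by (rule nn_integral_cmult_indicator)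
    also have "\<dots> < \<infinity>" by (simp add: M.emeasure_eq_measure ennreal_mult'' [symmetric])
    finally show ?thesis .
  qed
  have S_pos: "S T \<noteq> 0" if T: "T \<in> Tiles" for T
  proof
    assume "S T = 0"
    then have "AE x in M. ennreal (1 / ?X (lev T) x) * indicator (G T) x = 0"
      unfolding S_def using XT_meas [OF T] by (subst (asm) nn_integral_0_iff_AE)
    then have "AE x in M. x \<notin> G T"
    proof eventually_elim
      case (elim x)
      then show ?case using X_pos [OF T, of x] by (auto simp: indicator_def ennreal_eq_0_iff)
    qed
    then have "emeasure M (G T) = 0" using G_sets [OF T] by (subst (asm) AE_iff_measurable [of "G T"]) (auto dest: sets.sets_into_space)
    then show False using G_pos [OF T] by (simp add: measure_def)
  qed
  have s_pos: "0 < s T" if T: "T \<in> Tiles" for T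
    using S_fin [OF T] S_pos [OF T] G_pos [OF T] by (simp add: s_def enn2real_positive_iff less_top zero_less_iff_neq_zero)
  have S_eq: "S T = ennreal (s T * measure M (G T))" if T: "T \<in> Tiles" for T
    using S_fin [OF T] G_pos [OF T] by (simp add: s_def less_top)
  define c where "c T = (\<integral>\<^sup>+x. ennreal ((h (lev T) x)\<^sup>2) * ?E T x \<partial>M)" for T
  have h_meas: "h (lev T) \<in> borel_measurable M" if "T \<in> Tiles" for T by (rule h [OF lev(1) [OF that]])

  \<comment> \<open>Replace the tile by \<open>G T\<close>, where \<open>\<alpha> T \<le> \<kappa> * \<bar>f (lev T) x\<bar>\<close>; since the tiles of one level
    overlap boundedly, the sum of \<open>f n ^ 2 / X n\<close> over the levels remains.\<close>
  have sum1: "(\<Sum>T\<in>Tiles. ennreal ((\<alpha> T)\<^sup>2 * s T) * emeasure M (tile T)) \<le> ennreal (2 * (real d + 1) * \<kappa> ^ 3) * I"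
  proof -
    define g where "g n x = (f n x)\<^sup>2 / ?X n x" for n x
    have g_nonneg: "0 \<le> g n x" for n x by (simp add: g_def square_fn_nonneg)
    have g_meas: "g n \<in> borel_measurable M" if "n \<in> {1..N}" for n
    proof -
      have "n \<le> N" using that by simp
      from X_meas [OF this] f [OF that] show ?thesis unfolding g_def by measurable
    qed
    have "(\<Sum>T\<in>Tiles. ennreal ((\<alpha> T)\<^sup>2 * s T) * emeasure M (tile T))
        \<le> (\<Sum>T\<in>Tiles. \<integral>\<^sup>+x. ennreal (\<kappa> ^ 3) * (ennreal (g (lev T) x) * ?E T x) \<partial>M)"
    proof (rule sum_mono)
      fix T assume T: "T \<in> Tiles"
      have "ennreal ((\<alpha> T)\<^sup>2 * s T) * emeasure M (tile T) = ennreal ((\<alpha> T)\<^sup>2 * s T * measure M (tile T))"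
        using s_pos [OF T] by (simp add: M.emeasure_eq_measure ennreal_mult')
      also have "\<dots> \<le> ennreal ((\<alpha> T)\<^sup>2 * s T * (\<kappa> * measure M (G T)))"
        using s_pos [OF T] G_large [OF T] by (intro ennreal_leI mult_left_mono) auto
      also have "\<dots> = ennreal ((\<kappa> * (\<alpha> T)\<^sup>2) * (s T * measure M (G T)))" by (simp only: mult_ac)
      also have "\<dots> = ennreal (\<kappa> * (\<alpha> T)\<^sup>2) * S T"
        unfolding S_eq [OF T] using \<kappa> by (intro ennreal_mult') auto
      also have "\<dots> = (\<integral>\<^sup>+x. ennreal (\<kappa> * (\<alpha> T)\<^sup>2) * (ennreal (1 / ?X (lev T) x) * indicator (G T) x) \<partial>M)"
        unfolding S_def using XT_meas [OF T] by (rule nn_integral_cmult [symmetric])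
      also have "\<dots> \<le> (\<integral>\<^sup>+x. ennreal (\<kappa> ^ 3) * (ennreal (g (lev T) x) * ?E T x) \<partial>M)"
      proof (rule nn_integral_mono)
        fix x
        show "ennreal (\<kappa> * (\<alpha> T)\<^sup>2) * (ennreal (1 / ?X (lev T) x) * indicator (G T) x)
          \<le> ennreal (\<kappa> ^ 3) * (ennreal (g (lev T) x) * ?E T x)"
        proof (cases "x \<in> G T")
          case True
          have "(\<alpha> T)\<^sup>2 \<le> (\<kappa> * \<bar>f (lev T) x\<bar>)\<^sup>2"
            using f_ge [OF T True] \<alpha> [OF T] by (intro power_mono) auto
          also have "(\<kappa> * \<bar>f (lev T) x\<bar>)\<^sup>2 = \<kappa>\<^sup>2 * (f (lev T) x)\<^sup>2"
            by (simp add: power_mult_distrib)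
          finally have "\<kappa> * (\<alpha> T)\<^sup>2 \<le> \<kappa> * (\<kappa>\<^sup>2 * (f (lev T) x)\<^sup>2)"
            using \<kappa> by simp
          also have "\<dots> = \<kappa> ^ 3 * (f (lev T) x)\<^sup>2"
            by (simp add: power2_eq_square power3_eq_cube)
          finally have "\<kappa> * (\<alpha> T)\<^sup>2 \<le> \<kappa> ^ 3 * (f (lev T) x)\<^sup>2" .
          then have "\<kappa> * (\<alpha> T)\<^sup>2 * (1 / ?X (lev T) x) \<le> \<kappa> ^ 3 * (f (lev T) x)\<^sup>2 * (1 / ?X (lev T) x)"
            using X_pos [OF T True] by (intro mult_right_mono) auto
          then have "ennreal (\<kappa> * (\<alpha> T)\<^sup>2 * (1 / ?X (lev T) x)) \<le> ennreal (\<kappa> ^ 3 * g (lev T) x)"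
            unfolding g_def by (intro ennreal_leI) simp
          moreover have "ennreal (\<kappa> * (\<alpha> T)\<^sup>2 * (1 / ?X (lev T) x)) = ennreal (\<kappa> * (\<alpha> T)\<^sup>2) * ennreal (1 / ?X (lev T) x)"
            "ennreal (\<kappa> ^ 3 * g (lev T) x) = ennreal (\<kappa> ^ 3) * ennreal (g (lev T) x)"
            using \<kappa> by (intro ennreal_mult'; simp)+
          moreover have "x \<in> tile T" using True G_sub [OF T] by blast
          ultimately show ?thesis using True by simp
        qed simp
      qed
      finally show "ennreal ((\<alpha> T)\<^sup>2 * s T) * emeasure M (tile T)
        \<le> (\<integral>\<^sup>+x. ennreal (\<kappa> ^ 3) * (ennreal (g (lev T) x) * ?E T x) \<partial>M)" .
    qed
    also have "\<dots> = (\<integral>\<^sup>+x. (\<Sum>T\<in>Tiles. ennreal (\<kappa> ^ 3) * (ennreal (g (lev T) x) * ?E T x)) \<partial>M)"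
    proof (rule nn_integral_sum [symmetric])
      fix T assume T: "T \<in> Tiles"
      show "(\<lambda>x. ennreal (\<kappa> ^ 3) * (ennreal (g (lev T) x) * ?E T x)) \<in> borel_measurable M"
        using g_meas [OF lev(1) [OF T]] tile_sets [OF T] by measurable
    qed
    also have "\<dots> \<le> (\<integral>\<^sup>+x. ennreal (2 * (real d + 1) * \<kappa> ^ 3) * ennreal (?X N x) \<partial>M)"
    proof (rule nn_integral_mono)
      fix x
      have "(\<Sum>T\<in>Tiles. ennreal (g (lev T) x) * ?E T x)
          \<le> of_nat (d + 1) * (\<Sum>n\<in>lev ` {T \<in> Tiles. x \<in> tile T}. ennreal (g n x))"
        using level_sum_bound [of Tiles "\<lambda>n. ennreal (g n x)" x] by simp
      also have "\<dots> \<le> of_nat (d + 1) * (\<Sum>n\<in>{1..N}. ennreal (g n x))"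
        using lev(1) by (intro mult_left_mono sum_mono2) auto
      also have "\<dots> \<le> of_nat (d + 1) * ennreal (2 * ?X N x)"
      proof (rule mult_left_mono)
        have "(\<Sum>n\<in>{1..N}. ennreal (g n x)) = ennreal (\<Sum>n=1..N. g n x)"
          using g_nonneg by (intro sum_ennreal) auto
        also have "\<dots> \<le> ennreal (2 * ?X N x)"
          unfolding g_def by (intro ennreal_leI square_fn_sum)
        finally show "(\<Sum>n\<in>{1..N}. ennreal (g n x)) \<le> ennreal (2 * ?X N x)" .
      qed simp
      also have "of_nat (d + 1) * ennreal (2 * ?X N x) = ennreal (real (d + 1) * (2 * ?X N x))"
        by (simp only: ennreal_of_nat_eq_real_of_nat ennreal_mult' of_nat_0_le_iff)
      finally have "ennreal (\<kappa> ^ 3) * (\<Sum>T\<in>Tiles. ennreal (g (lev T) x) * ?E T x)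
          \<le> ennreal (\<kappa> ^ 3) * ennreal (real (d + 1) * (2 * ?X N x))"
        by (rule mult_left_mono) simp
      also have "\<dots> = ennreal (\<kappa> ^ 3 * (real (d + 1) * (2 * ?X N x)))"
        using \<kappa> by (intro ennreal_mult' [symmetric]) auto
      also have "\<kappa> ^ 3 * (real (d + 1) * (2 * ?X N x)) = (2 * (real d + 1) * \<kappa> ^ 3) * ?X N x"
        by (simp add: algebra_simps)
      also have "ennreal \<dots> = ennreal (2 * (real d + 1) * \<kappa> ^ 3) * ennreal (?X N x)"
        using \<kappa> by (intro ennreal_mult') auto
      finally show "(\<Sum>T\<in>Tiles. ennreal (\<kappa> ^ 3) * (ennreal (g (lev T) x) * ?E T x)) \<le> ennreal (2 * (real d + 1) * \<kappa> ^ 3) * ennreal (?X N x)"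
        by (simp only: sum_distrib_left)
    qed
    also have "\<dots> = ennreal (2 * (real d + 1) * \<kappa> ^ 3) * I"
      unfolding I_def by (intro nn_integral_cmult measurable_compose [OF X_meas measurable_ennreal]) simp
    finally show ?thesis .
  qed

  \<comment> \<open>Layer cake: for each \<open>\<theta>\<close> the tiles with \<open>\<theta> < 1 / s T\<close> have a fixed proportion in \<open>L \<theta>\<close>, where \<open>X N\<close>
    exceeds \<open>\<theta> / 2\<close>, so that packing applies with \<open>S = L \<theta>\<close>.\<close>
  have sum2: "(\<Sum>T\<in>Tiles. ennreal (1 / s T) * c T) \<le> ennreal (8 * \<kappa> * (real d + 1) ^ 3 * \<epsilon>\<^sup>2) * I"
  proof -
    define L where "L \<theta> = {x \<in> space M. 0 < \<theta> \<and> \<theta> < 2 * ?X N x}" for \<theta>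
    define C where "C = ennreal (4 * \<kappa> * (real d + 1) ^ 3 * \<epsilon>\<^sup>2)"
    have XN: "?X N \<in> borel_measurable M" by (rule X_meas) simp
    have L_sets: "L \<theta> \<in> sets M" for \<theta> unfolding L_def using XN by measurable
    have level: "(\<Sum>T\<in>Tiles. indicator {0<..<1 / s T} \<theta> * c T) \<le> C * emeasure M (L \<theta>)" for \<theta> :: real
    proof (cases "0 < \<theta>")
      case True
      define Q where "Q = {T \<in> Tiles. \<theta> < 1 / s T}"
      have dense: "emeasure M (tile T) \<le> ennreal (2 * \<kappa>) * emeasure M (tile T \<inter> L \<theta>)" if "T \<in> Q" for T
      proof -
        have T: "T \<in> Tiles" "\<theta> < 1 / s T" using that by (auto simp: Q_def)
        have Gs: "G T \<in> sets M" "G T - L \<theta> \<in> sets M" using G_sets [OF T(1)] L_sets by auto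
        have "ennreal (2 / \<theta> * measure M (G T - L \<theta>)) = ennreal (2 / \<theta>) * emeasure M (G T - L \<theta>)"
          unfolding M.emeasure_eq_measure using True by (intro ennreal_mult') simp
        also have "\<dots> = (\<integral>\<^sup>+x. ennreal (2 / \<theta>) * indicator (G T - L \<theta>) x \<partial>M)"
          by (rule nn_integral_cmult_indicator [symmetric]) (rule Gs(2))
        also have "\<dots> \<le> S T" unfolding S_def
        proof (rule nn_integral_mono)
          fix x assume x: "x \<in> space M"
          show "ennreal (2 / \<theta>) * indicator (G T - L \<theta>) x \<le> ennreal (1 / ?X (lev T) x) * indicator (G T) x"
          proof (cases "x \<in> G T - L \<theta>")
            case True': True
            then have "2 * ?X N x \<le> \<theta>" using x True by (auto simp: L_def)
            then have "2 * ?X (lev T) x \<le> \<theta>" using square_fn_mono [OF lev(3) [OF T(1)], of f x] by linarith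
            then have "2 / \<theta> \<le> 1 / ?X (lev T) x"
              using X_pos [OF T(1), of x] True' True by (simp add: field_simps)
            then show ?thesis using True' by (simp add: ennreal_leI)
          qed simp
        qed
        finally have "2 / \<theta> * measure M (G T - L \<theta>) \<le> s T * measure M (G T)"
          unfolding S_eq [OF T(1)] using s_pos [OF T(1)] by (subst (asm) ennreal_le_iff) auto
        also have "\<dots> \<le> 1 / \<theta> * measure M (G T)"
          using T(2) s_pos [OF T(1)] True by (intro mult_right_mono) (auto simp: field_simps)
        finally have half: "2 * measure M (G T - L \<theta>) \<le> measure M (G T)"
          using True by (simp add: field_simps)
        have "measure M (G T) = measure M (G T - L \<theta>) + measure M (G T \<inter> L \<theta>)"
          using M.finite_measure_Union [of "G T - L \<theta>" "G T \<inter> L \<theta>"] Gs L_sets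
          by (simp add: Un_Diff_Int Int_Diff) blast
        then have "measure M (G T) \<le> 2 * measure M (G T \<inter> L \<theta>)" using half by linarith
        also have "measure M (G T \<inter> L \<theta>) \<le> measure M (tile T \<inter> L \<theta>)"
          using G_sub [OF T(1)] tile_sets [OF T(1)] L_sets by (intro M.finite_measure_mono) auto
        finally have "\<kappa> * measure M (G T) \<le> \<kappa> * (2 * measure M (tile T \<inter> L \<theta>))" using \<kappa> by simp
        then have "measure M (tile T) \<le> 2 * \<kappa> * measure M (tile T \<inter> L \<theta>)" using G_large [OF T(1)] by simp
        then show ?thesis using \<kappa> by (simp add: M.emeasure_eq_measure ennreal_mult' [symmetric] ennreal_leI)
      qed
      have "(\<Sum>T\<in>Tiles. indicator {0<..<1 / s T} \<theta> * c T) = (\<Sum>T\<in>Q. c T)"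
        unfolding Q_def sum.inter_filter [OF finite_Tiles] using True by (intro sum.cong) (auto simp: indicator_def)
      also have "\<dots> \<le> of_nat (2 * (d + 1) ^ 3) * ennreal (\<epsilon>\<^sup>2) * ennreal (2 * \<kappa>) * emeasure M (L \<theta>)"
        unfolding c_def
      proof (rule carleson_packing [where g = "\<lambda>l x. ennreal ((h l x)\<^sup>2)"])
        show "(\<lambda>x. ennreal ((h n x)\<^sup>2)) \<in> borel_measurable M" if "n \<in> {1..N}" for n using h [OF that] by measurable
      qed (use tile_sets L_sets carl dense in \<open>auto simp: Q_def\<close>)
      also have "of_nat (2 * (d + 1) ^ 3) * ennreal (\<epsilon>\<^sup>2) * ennreal (2 * \<kappa>) = C"
      proof -
        have "of_nat (2 * (d + 1) ^ 3) * ennreal (\<epsilon>\<^sup>2) * ennreal (2 * \<kappa>) = ennreal (real (2 * (d + 1) ^ 3) * \<epsilon>\<^sup>2 * (2 * \<kappa>))"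
          using \<kappa> by (simp only: ennreal_of_nat_eq_real_of_nat ennreal_mult' zero_le_power2 of_nat_0_le_iff mult_nonneg_nonneg)
        also have "real (2 * (d + 1) ^ 3) * \<epsilon>\<^sup>2 * (2 * \<kappa>) = 4 * \<kappa> * (real d + 1) ^ 3 * \<epsilon>\<^sup>2" by (simp add: mult_ac add.commute)
        finally show ?thesis unfolding C_def .
      qed
      finally show ?thesis .
    qed simp
    have "(\<Sum>T\<in>Tiles. ennreal (1 / s T) * c T) = (\<Sum>T\<in>Tiles. \<integral>\<^sup>+\<theta>. indicator {0<..<1 / s T} \<theta> * c T \<partial>lborel)"
    proof (rule sum.cong [OF refl])
      fix T assume T: "T \<in> Tiles"
      show "ennreal (1 / s T) * c T = (\<integral>\<^sup>+\<theta>. indicator {0<..<1 / s T} \<theta> * c T \<partial>lborel)"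
        using s_pos [OF T] by (simp add: nn_integral_multc)
    qed
    also have "\<dots> = (\<integral>\<^sup>+\<theta>. (\<Sum>T\<in>Tiles. indicator {0<..<1 / s T} \<theta> * c T) \<partial>lborel)"
      by (rule nn_integral_sum [symmetric]) measurable
    also have "\<dots> \<le> (\<integral>\<^sup>+\<theta>. C * emeasure M (L \<theta>) \<partial>lborel)" by (intro nn_integral_mono level)
    also have "\<dots> = C * (\<integral>\<^sup>+\<theta>. emeasure M (L \<theta>) \<partial>lborel)"
    proof (rule nn_integral_cmult)
      interpret pair_sigma_finite lborel M ..
      have "{p \<in> space (lborel \<Otimes>\<^sub>M M). 0 < fst p \<and> fst p < 2 * ?X N (snd p)} \<in> sets (lborel \<Otimes>\<^sub>M M)"
        using XN by measurable
      then have "(\<lambda>\<theta>. emeasure M (Pair \<theta> -` {p \<in> space (lborel \<Otimes>\<^sub>M M). 0 < fst p \<and> fst p < 2 * ?X N (snd p)})) \<in> borel_measurable lborel"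
        by (rule M.measurable_emeasure_Pair)
      then show "(\<lambda>\<theta>. emeasure M (L \<theta>)) \<in> borel_measurable lborel"
        by (simp add: L_def vimage_def space_pair_measure)
    qed
    also have "(\<integral>\<^sup>+\<theta>. emeasure M (L \<theta>) \<partial>lborel) = 2 * I"
      unfolding L_def I_def by (rule nn_integral_layer_cake [OF _ XN]) unfold_locales
    also have "C * (2 * I) = ennreal (8 * \<kappa> * (real d + 1) ^ 3 * \<epsilon>\<^sup>2) * I"
    proof -
      have "C * 2 = ennreal (4 * \<kappa> * (real d + 1) ^ 3 * \<epsilon>\<^sup>2 * 2)" unfolding C_def using \<kappa>
        by (subst ennreal_mult'') auto
      then show ?thesis by (simp add: mult.assoc [symmetric])
    qed
    finally show ?thesis .
  qed

  have "(\<Sum>n=1..N. \<integral>\<^sup>+x. ennreal \<bar>f n x * h n x\<bar> \<partial>M)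
      \<le> (\<Sum>n=1..N. \<Sum>T\<in>{T \<in> Tiles. lev T = n}. \<integral>\<^sup>+x. ennreal (\<alpha> T * \<bar>h (lev T) x\<bar>) * ?E T x \<partial>M)"
  proof (rule sum_mono)
    fix n assume n: "n \<in> {1..N}"
    have "(\<integral>\<^sup>+x. ennreal \<bar>f n x * h n x\<bar> \<partial>M)
        \<le> (\<integral>\<^sup>+x. (\<Sum>T\<in>{T \<in> Tiles. lev T = n}. ennreal (\<alpha> T * \<bar>h (lev T) x\<bar>) * ?E T x) \<partial>M)"
    proof (rule nn_integral_mono_AE, use f_le [OF n] in eventually_elim)
      case (elim x)
      have "\<bar>f n x * h n x\<bar> \<le> (\<Sum>T\<in>{T \<in> Tiles. lev T = n}. \<alpha> T * indicator (tile T) x) * \<bar>h n x\<bar>"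
        unfolding abs_mult using elim by (intro mult_right_mono) auto
      also have "\<dots> = (\<Sum>T\<in>{T \<in> Tiles. lev T = n}. (\<alpha> T * \<bar>h (lev T) x\<bar>) * indicator (tile T) x)"
        unfolding sum_distrib_right by (intro sum.cong) (auto simp: mult_ac)
      finally have "ennreal \<bar>f n x * h n x\<bar> \<le> ennreal (\<Sum>T\<in>{T \<in> Tiles. lev T = n}. (\<alpha> T * \<bar>h (lev T) x\<bar>) * indicator (tile T) x)"
        by (rule ennreal_leI)
      also have "\<dots> = (\<Sum>T\<in>{T \<in> Tiles. lev T = n}. ennreal ((\<alpha> T * \<bar>h (lev T) x\<bar>) * indicator (tile T) x))"
        using \<alpha> by (intro sum_ennreal [symmetric]) (auto simp: less_imp_le)
      also have "\<dots> = (\<Sum>T\<in>{T \<in> Tiles. lev T = n}. ennreal (\<alpha> T * \<bar>h (lev T) x\<bar>) * ?E T x)"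
        by (intro sum.cong) (auto simp: indicator_def)
      finally show ?case .
    qed
    also have "\<dots> = (\<Sum>T\<in>{T \<in> Tiles. lev T = n}. \<integral>\<^sup>+x. ennreal (\<alpha> T * \<bar>h (lev T) x\<bar>) * ?E T x \<partial>M)"
    proof (rule nn_integral_sum)
      fix T assume "T \<in> {T \<in> Tiles. lev T = n}"
      then have T: "T \<in> Tiles" by simp
      show "(\<lambda>x. ennreal (\<alpha> T * \<bar>h (lev T) x\<bar>) * ?E T x) \<in> borel_measurable M"
        using h_meas [OF T] tile_sets [OF T] by measurable
    qed
    finally show "(\<integral>\<^sup>+x. ennreal \<bar>f n x * h n x\<bar> \<partial>M)
      \<le> (\<Sum>T\<in>{T \<in> Tiles. lev T = n}. \<integral>\<^sup>+x. ennreal (\<alpha> T * \<bar>h (lev T) x\<bar>) * ?E T x \<partial>M)" .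
  qed
  also have "\<dots> = (\<Sum>T\<in>Tiles. \<integral>\<^sup>+x. ennreal (\<alpha> T * \<bar>h (lev T) x\<bar>) * ?E T x \<partial>M)"
    using lev(1) by (intro sum.group finite_Tiles) auto
  also have "\<dots> \<le> (\<Sum>T\<in>Tiles. ennreal (\<epsilon> / 2) * (ennreal ((\<alpha> T)\<^sup>2 * s T) * emeasure M (tile T))
      + ennreal (1 / (2 * \<epsilon>)) * (ennreal (1 / s T) * c T))"
  proof (rule sum_mono)
    fix T assume T: "T \<in> Tiles"
    have meas: "(\<lambda>x. ennreal ((h (lev T) x)\<^sup>2) * ?E T x) \<in> borel_measurable M"
      using h_meas [OF T] tile_sets [OF T] by measurable
    have "(\<integral>\<^sup>+x. ennreal (\<alpha> T * \<bar>h (lev T) x\<bar>) * ?E T x \<partial>M)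
        \<le> (\<integral>\<^sup>+x. ennreal (\<epsilon> / 2 * ((\<alpha> T)\<^sup>2 * s T)) * ?E T x
            + ennreal (1 / (2 * \<epsilon>) * (1 / s T)) * (ennreal ((h (lev T) x)\<^sup>2) * ?E T x) \<partial>M)"
    proof (rule nn_integral_mono)
      fix x
      have "\<alpha> T * \<bar>h (lev T) x\<bar> \<le> \<epsilon> / 2 * ((\<alpha> T)\<^sup>2 * s T) + 1 / (2 * \<epsilon>) * (1 / s T) * (h (lev T) x)\<^sup>2"
        using weighted_am_gm [OF \<epsilon> s_pos [OF T], of "\<alpha> T" "\<bar>h (lev T) x\<bar>"] by (simp add: mult_ac)
      then have "ennreal (\<alpha> T * \<bar>h (lev T) x\<bar>) \<le> ennreal (\<epsilon> / 2 * ((\<alpha> T)\<^sup>2 * s T) + 1 / (2 * \<epsilon>) * (1 / s T) * (h (lev T) x)\<^sup>2)"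
        by (rule ennreal_leI)
      also have "\<dots> = ennreal (\<epsilon> / 2 * ((\<alpha> T)\<^sup>2 * s T)) + ennreal (1 / (2 * \<epsilon>) * (1 / s T)) * ennreal ((h (lev T) x)\<^sup>2)"
        using \<epsilon> s_pos [OF T] by (subst ennreal_plus) (auto simp: ennreal_mult' [symmetric])
      finally show "ennreal (\<alpha> T * \<bar>h (lev T) x\<bar>) * ?E T x \<le> ennreal (\<epsilon> / 2 * ((\<alpha> T)\<^sup>2 * s T)) * ?E T x
            + ennreal (1 / (2 * \<epsilon>) * (1 / s T)) * (ennreal ((h (lev T) x)\<^sup>2) * ?E T x)"
        by (auto simp: indicator_def)
    qed
    also have "\<dots> = ennreal (\<epsilon> / 2 * ((\<alpha> T)\<^sup>2 * s T)) * emeasure M (tile T) + ennreal (1 / (2 * \<epsilon>) * (1 / s T)) * c T"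
      unfolding c_def using tile_sets [OF T] meas
      by (subst nn_integral_add) (auto simp: nn_integral_cmult nn_integral_cmult_indicator)
    also have "ennreal (\<epsilon> / 2 * ((\<alpha> T)\<^sup>2 * s T)) = ennreal (\<epsilon> / 2) * ennreal ((\<alpha> T)\<^sup>2 * s T)"
      using \<epsilon> by (intro ennreal_mult') simp
    also have "ennreal (1 / (2 * \<epsilon>) * (1 / s T)) = ennreal (1 / (2 * \<epsilon>)) * ennreal (1 / s T)"
      using \<epsilon> by (intro ennreal_mult') simp
    also have "ennreal (\<epsilon> / 2) * ennreal ((\<alpha> T)\<^sup>2 * s T) * emeasure M (tile T) + ennreal (1 / (2 * \<epsilon>)) * ennreal (1 / s T) * c T
      = ennreal (\<epsilon> / 2) * (ennreal ((\<alpha> T)\<^sup>2 * s T) * emeasure M (tile T))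
      + ennreal (1 / (2 * \<epsilon>)) * (ennreal (1 / s T) * c T)"
      by (simp only: mult.assoc)
    finally show "(\<integral>\<^sup>+x. ennreal (\<alpha> T * \<bar>h (lev T) x\<bar>) * ?E T x \<partial>M)
      \<le> ennreal (\<epsilon> / 2) * (ennreal ((\<alpha> T)\<^sup>2 * s T) * emeasure M (tile T))
      + ennreal (1 / (2 * \<epsilon>)) * (ennreal (1 / s T) * c T)" .
  qed
  also have "\<dots> = ennreal (\<epsilon> / 2) * (\<Sum>T\<in>Tiles. ennreal ((\<alpha> T)\<^sup>2 * s T) * emeasure M (tile T))
      + ennreal (1 / (2 * \<epsilon>)) * (\<Sum>T\<in>Tiles. ennreal (1 / s T) * c T)"
    by (simp only: sum.distrib sum_distrib_left)
  also have "\<dots> \<le> ennreal (\<epsilon> / 2) * (ennreal (2 * (real d + 1) * \<kappa> ^ 3) * I)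
      + ennreal (1 / (2 * \<epsilon>)) * (ennreal (8 * \<kappa> * (real d + 1) ^ 3 * \<epsilon>\<^sup>2) * I)"
    using sum1 sum2 by (intro add_mono mult_left_mono) auto
  also have "\<dots> = ennreal (\<epsilon> * ((real d + 1) * \<kappa> ^ 3 + 4 * \<kappa> * (real d + 1) ^ 3)) * I"
  proof -
    let ?a = "2 * (real d + 1) * \<kappa> ^ 3" and ?b = "8 * \<kappa> * (real d + 1) ^ 3 * \<epsilon>\<^sup>2"
    have "\<epsilon> / 2 * ?a + 1 / (2 * \<epsilon>) * ?b = \<epsilon> * ((real d + 1) * \<kappa> ^ 3 + 4 * \<kappa> * (real d + 1) ^ 3)"
      using \<epsilon> by (simp add: field_simps power2_eq_square)
    moreover have "ennreal (\<epsilon> / 2 * ?a + 1 / (2 * \<epsilon>) * ?b) = ennreal (\<epsilon> / 2 * ?a) + ennreal (1 / (2 * \<epsilon>) * ?b)"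
      using \<epsilon> \<kappa> by (intro ennreal_plus) auto
    moreover have "ennreal (\<epsilon> / 2 * ?a) = ennreal (\<epsilon> / 2) * ennreal ?a"
      "ennreal (1 / (2 * \<epsilon>) * ?b) = ennreal (1 / (2 * \<epsilon>)) * ennreal ?b"
      using \<epsilon> by (intro ennreal_mult'; simp)+
    ultimately show ?thesis by (simp only: distrib_right mult.assoc)
  qed
  finally show ?thesis unfolding I_def .
qed

end

section \<open>The inequality for spline sequences\<close>

lemma knot_in_grid:
  assumes "spline_grid m b"
  shows "spline_grid.t d m b j \<in> b ` {..m}"
proof -
  interpret spline_grid d m b by fact
  show ?thesis by (auto simp: t_def)
qed

text \<open>The link between splines and tiles. It will hold with the modulus of the \<open>i\<close>-th B-spline coefficient of \<open>f\<close>
  as \<open>a i\<close>, and with the points of a long atom of the \<open>i\<close>-th support at which \<open>\<bar>f\<bar>\<close> is not much smaller as \<open>G i\<close>.\<close>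

definition tile_data ::
    "nat \<Rightarrow> real set set \<Rightarrow> (real \<Rightarrow> real) \<Rightarrow> (nat \<Rightarrow> real) \<Rightarrow> (nat \<Rightarrow> real set) \<Rightarrow> bool" where
  "tile_data d \<F> f a G \<longleftrightarrow> (let t = spline_grid.t d (grid_size \<F>) (grid_pt \<F>) in
     (\<forall>i. 0 \<le> a i)
     \<and> (AE x in \<mu>01. \<bar>f x\<bar> \<le> (\<Sum>i<grid_size \<F> + d. a i * indicator {t i<..<t (i + d + 1)} x))
     \<and> (\<forall>i<grid_size \<F> + d. a i \<noteq> 0 \<longrightarrow> G i \<in> lmeasurable \<and> G i \<subseteq> {t i<..<t (i + d + 1)}
       \<and> t (i + d + 1) - t i \<le> 2 * (real d + 1) * measure lebesgue (G i)
       \<and> (\<forall>x\<in>G i. a i \<le> 2 * spline_grid.stability_const d * \<bar>f x\<bar>)))"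

lemma spline_tile_data:
  assumes \<F>: "interval_sigma_algebra \<F>" and f: "f \<in> spline_space (Suc d) \<F>"
  defines "t \<equiv> spline_grid.t d (grid_size \<F>) (grid_pt \<F>)"
    and "K \<equiv> spline_grid.stability_const d"
  shows "\<exists>a G. tile_data d \<F> f a G"
proof -
  note t_eq = t_def [symmetric] and K_eq = K_def [symmetric]
  interpret spline_grid d "grid_size \<F>" "grid_pt \<F>"
    rewrites "spline_grid.t d (grid_size \<F>) (grid_pt \<F>) \<equiv> t" and "spline_grid.stability_const d \<equiv> K"
    by (rule spline_grid_sigma_algebra [OF \<F>]) (simp_all add: t_def K_def)
  let ?m = "grid_size \<F>" and ?b = "grid_pt \<F>"
  obtain p where p: "\<And>r. r < ?m \<Longrightarrow> degree (p r) \<le> d"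
    "\<And>r x. r < ?m \<Longrightarrow> x \<in> {?b r<..<?b (Suc r)} \<Longrightarrow> f x = poly (p r) x"
    "\<And>r \<nu>. Suc r < ?m \<Longrightarrow> \<nu> < d \<Longrightarrow> poly ((pderiv ^^ \<nu>) (p r)) (?b (Suc r)) = poly ((pderiv ^^ \<nu>) (p (Suc r))) (?b (Suc r))"
    using spline_pieces [OF \<F> f] by metis
  have "\<forall>i\<in>{..<?m + d}. \<exists>r. r < ?m \<and> r \<le> i \<and> i \<le> r + d \<and> t (i + d + 1) - t i \<le> (real d + 1) * (?b (Suc r) - ?b r)"
  proof
    fix i assume "i \<in> {..<?m + d}"
    then have "i < ?m + d" by simp
    then show "\<exists>r. r < ?m \<and> r \<le> i \<and> i \<le> r + d \<and> t (i + d + 1) - t i \<le> (real d + 1) * (?b (Suc r) - ?b r)"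
      by (rule large_atom_in_support) blast
  qed
  from bchoice [OF this] obtain J where "\<forall>i\<in>{..<?m + d}. J i < ?m \<and> J i \<le> i \<and> i \<le> J i + d \<and>
      t (i + d + 1) - t i \<le> (real d + 1) * (?b (Suc (J i)) - ?b (J i))" ..
  then have J: "J i < ?m" "J i \<le> i" "i \<le> J i + d" "t (i + d + 1) - t i \<le> (real d + 1) * (?b (Suc (J i)) - ?b (J i))"
    if "i < ?m + d" for i using that by auto
  define c where "c i = bcoef (p (J i)) i" for i
  define a where "a i = \<bar>c i\<bar>" for i
  define G where "G i = {x\<in>{?b (J i)<..<?b (Suc (J i))}. \<bar>bcoef (p (J i)) i\<bar> \<le> 2 * K * \<bar>poly (p (J i)) x\<bar>}" for i
  have c_eq: "bcoef (p r) i = c i" if r: "r < ?m" "r \<le> i" "i \<le> r + d" for r i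
  proof -
    have i: "i < ?m + d" using r by simp
    show ?thesis
    proof (cases "r \<le> J i")
      case True
      then show ?thesis unfolding c_def using J [OF i] r by (intro bcoef_eq_on_support p) auto
    next
      case False
      then have "bcoef (p (J i)) i = bcoef (p r) i" using J [OF i] r by (intro bcoef_eq_on_support p) auto
      then show ?thesis unfolding c_def by simp
    qed
  qed
  have bound: "\<bar>f x\<bar> \<le> (\<Sum>i<?m + d. a i * indicator {t i<..<t (i + d + 1)} x)"
    if x: "x \<in> {0..1}" "x \<notin> endpoints \<F>" for x
  proof -
    obtain A where A: "A \<in> atoms \<F>" "x \<in> A" using x(1) by (rule atom_containing [OF \<F>])
    obtain r where r: "r < ?m" "Inf A = ?b r" "Sup A = ?b (Suc r)" using atom_is_grid_interval [OF \<F> A(1)] .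
    have "x \<in> {?b r..?b (Suc r)}" using atom_between_endpoints(3) [OF \<F> A(1)] A(2) r by auto
    moreover have "x \<noteq> Inf A" "x \<noteq> Sup A" using x(2) A(1) by auto
    ultimately have xr: "x \<in> {?b r<..<?b (Suc r)}" using r by auto
    have tr: "t (r + d) < x" "x < t (r + d + 1)"
      using t_shift [of r] t_shift [of "Suc r"] r(1) xr by auto
    have "\<bar>f x\<bar> \<le> (\<Sum>i\<in>{r..r + d}. \<bar>bcoef (p r) i\<bar>)"
      unfolding p(2) [OF r(1) xr] using r(1) xr by (intro poly_bound_bcoef p) auto
    also have "\<dots> = (\<Sum>i\<in>{r..r + d}. a i * indicator {t i<..<t (i + d + 1)} x)"
    proof (rule sum.cong [OF refl])
      fix i assume i: "i \<in> {r..r + d}"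
      have "t i \<le> t (r + d)" "t (r + d + 1) \<le> t (i + d + 1)" using i by (auto intro!: t_mono)
      then have "x \<in> {t i<..<t (i + d + 1)}" using tr by auto
      then show "\<bar>bcoef (p r) i\<bar> = a i * indicator {t i<..<t (i + d + 1)} x"
        using c_eq [of r i] r(1) i by (simp add: a_def)
    qed
    also have "\<dots> \<le> (\<Sum>i<?m + d. a i * indicator {t i<..<t (i + d + 1)} x)"
      using r(1) by (intro sum_mono2) (auto simp: a_def)
    finally show ?thesis .
  qed
  have "AE x in \<mu>01. x \<notin> endpoints \<F>"
  proof (rule AE_I)
    show "{x \<in> space \<mu>01. \<not> x \<notin> endpoints \<F>} \<subseteq> endpoints \<F> \<inter> {0..1}" by auto
    have fin: "finite (endpoints \<F> \<inter> {0..1})" using interval_sigma_algebra_atoms(1) [OF \<F>] by simp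
    then have "negligible (endpoints \<F> \<inter> {0..1})" by (rule negligible_finite)
    then have "endpoints \<F> \<inter> {0..1} \<in> null_sets lebesgue" by (simp add: negligible_iff_null_sets)
    then show "emeasure \<mu>01 (endpoints \<F> \<inter> {0..1}) = 0" by (subst emeasure_restrict_space) auto
    show "endpoints \<F> \<inter> {0..1} \<in> sets \<mu>01"
      using \<open>endpoints \<F> \<inter> {0..1} \<in> null_sets lebesgue\<close> by (subst sets_restrict_space_iff) auto
  qed
  then have "AE x in \<mu>01. \<bar>f x\<bar> \<le> (\<Sum>i<?m + d. a i * indicator {t i<..<t (i + d + 1)} x)"
    using AE_space by eventually_elim (rule bound, auto)
  moreover have "G i \<in> lmeasurable \<and> G i \<subseteq> {t i<..<t (i + d + 1)}
      \<and> t (i + d + 1) - t i \<le> 2 * (real d + 1) * measure lebesgue (G i) \<and> (\<forall>x\<in>G i. a i \<le> 2 * K * \<bar>f x\<bar>)"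
    if i: "i < ?m + d" and nz: "a i \<noteq> 0" for i
  proof (intro conjI ballI)
    have nz': "bcoef (p (J i)) i \<noteq> 0" using nz by (simp add: a_def c_def)
    note good = bcoef_good_set [OF J [OF i] p(1) [OF J(1) [OF i]] nz']
    show "G i \<in> lmeasurable" "t (i + d + 1) - t i \<le> 2 * (real d + 1) * measure lebesgue (G i)"
      unfolding G_def by (rule good)+
    have "t i \<le> t (J i + d)" "t (J i + d + 1) \<le> t (i + d + 1)" using J [OF i] by (auto intro!: t_mono)
    then have "t i \<le> ?b (J i)" "?b (Suc (J i)) \<le> t (i + d + 1)"
      using t_shift [of "J i"] t_shift [of "Suc (J i)"] J(1) [OF i] by auto
    then show "G i \<subseteq> {t i<..<t (i + d + 1)}" unfolding G_def by auto
    show "a i \<le> 2 * K * \<bar>f x\<bar>" if "x \<in> G i" for x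
      using that p(2) [OF J(1) [OF i], of x] by (auto simp: G_def a_def c_def)
  qed
  moreover have "0 \<le> a i" for i by (simp add: a_def)
  ultimately show ?thesis unfolding tile_data_def Let_def t_eq K_eq
    by (intro exI [of _ a] exI [of _ G] conjI allI impI) blast+
qed

lemma le_square_of_ennreal_sqrt_le:
  assumes "ennreal_sqrt y \<le> ennreal \<epsilon>" "0 \<le> \<epsilon>"
  shows "y \<le> ennreal (\<epsilon>\<^sup>2)"
proof -
  have "y \<noteq> \<infinity>" using assms(1) by (auto simp: ennreal_sqrt_def top_unique)
  then obtain r where r: "y = ennreal r" "0 \<le> r" by (cases y) auto
  then have "sqrt r \<le> \<epsilon>" using assms by (simp add: ennreal_sqrt_def ennreal_le_iff)
  then have "r \<le> \<epsilon>\<^sup>2" using r(2) assms(2)  real_sqrt_le_iff [of r "\<epsilon>\<^sup>2"] by simp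
  then show ?thesis using r(1) by (simp add: ennreal_leI)
qed

text \<open>The tiles are the pairs of a level and the number of a B-spline whose coefficient does not vanish. Two
  B-splines of one level whose supports share a point have numbers that differ by at most \<open>d\<close>, and the
  breakpoints inside a support are among the \<open>d\<close> knots that follow its first knot.\<close>

lemma inequality_of_projection_bound:
  fixes \<F> :: "nat \<Rightarrow> real set set" and f h :: "nat \<Rightarrow> real \<Rightarrow> real"
  assumes filt: "interval_filtration \<F>"
    and reg: "\<And>n. 1 \<le> n \<Longrightarrow> regularity (Suc d) (\<F> n) \<le> \<gamma>" and \<gamma>: "1 \<le> \<gamma>"
    and f: "\<And>n. 1 \<le> n \<Longrightarrow> f n \<in> spline_space (Suc d) (\<F> n)"
    and h: "\<And>n. 1 \<le> n \<Longrightarrow> integrable \<mu>01 (h n)"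
    and \<epsilon>: "0 < \<epsilon>" and proj: "\<And>n. n \<in> {1..N} \<Longrightarrow> spline_proj_norm (Suc d) (\<F> n) (\<lambda>x. \<Sum>l=n..N. (h l x)\<^sup>2) \<le> ennreal (\<epsilon>\<^sup>2)"
  defines "\<kappa> \<equiv> max (2 * (real d + 1)) (2 * spline_grid.stability_const d)"
    and "B \<equiv> (2 * real d + 1) * \<gamma> ^ d"
  shows "(\<Sum>n=1..N. \<integral>\<^sup>+x. ennreal \<bar>f n x * h n x\<bar> \<partial>\<mu>01)
    \<le> ennreal (\<epsilon> * sqrt B * ((real d + 1) * \<kappa> ^ 3 + 4 * \<kappa> * (real d + 1) ^ 3))
      * (\<integral>\<^sup>+x. ennreal (square_fn f N x) \<partial>\<mu>01)"
proof -
  have \<F>: "interval_sigma_algebra (\<F> n)" if "1 \<le> n" for n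
    using filt that by (simp add: interval_filtration_def)
  have mono: "\<F> n \<subseteq> \<F> n'" if "1 \<le> n" "n \<le> n'" for n n'
    using filt that by (auto simp: interval_filtration_def mono_on_def)
  have B: "0 < B" using \<gamma> by (simp add: B_def)
  have \<kappa>: "0 < \<kappa>" by (simp add: \<kappa>_def)
  define t where "t n = spline_grid.t d (grid_size (\<F> n)) (grid_pt (\<F> n))" for n
  define E where "E n i = {t n i<..<t n (i + d + 1)}" for n i
  define K where "K = spline_grid.stability_const d"
  have K\<kappa>: "2 * K \<le> \<kappa>" "2 * (real d + 1) \<le> \<kappa>" by (auto simp: K_def \<kappa>_def)
  have "\<forall>n\<in>{1..N}. \<exists>aG. tile_data d (\<F> n) (f n) (fst aG) (snd aG)"
    using spline_tile_data [OF \<F> f] by (metis atLeastAtMost_iff fst_conv snd_conv)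
  from bchoice [OF this] obtain aG where "\<forall>n\<in>{1..N}. tile_data d (\<F> n) (f n) (fst (aG n)) (snd (aG n))" ..
  then have aG: "tile_data d (\<F> n) (f n) (fst (aG n)) (snd (aG n))" if "n \<in> {1..N}" for n using that by (rule bspec)
  define a where "a n = fst (aG n)" for n
  define G where "G n = snd (aG n)" for n
  note data = aG [folded a_def G_def, unfolded tile_data_def Let_def, folded t_def, folded E_def K_def]
  have a0: "0 \<le> a n i" if "n \<in> {1..N}" for n i using data [OF that] by blast
  have fa: "AE x in \<mu>01. \<bar>f n x\<bar> \<le> (\<Sum>i<grid_size (\<F> n) + d. a n i * indicator (E n i) x)" if "n \<in> {1..N}" for n
    using data [OF that] by blast
  have aG': "G n i \<in> lmeasurable" "G n i \<subseteq> E n i"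
      "t n (i + d + 1) - t n i \<le> 2 * (real d + 1) * measure lebesgue (G n i)" "\<And>x. x \<in> G n i \<Longrightarrow> a n i \<le> 2 * K * \<bar>f n x\<bar>"
    if "n \<in> {1..N}" "i < grid_size (\<F> n) + d" "a n i \<noteq> 0" for n i
    using data [OF that(1)] that(2,3) by blast+

  define Tiles where "Tiles = Sigma {1..N} (\<lambda>n. {i. i < grid_size (\<F> n) + d \<and> a n i \<noteq> 0})"
  have TilesD: "fst T \<in> {1..N}" "1 \<le> fst T" "snd T < grid_size (\<F> (fst T)) + d" "a (fst T) (snd T) \<noteq> 0" if "T \<in> Tiles" for T
    using that by (auto simp: Tiles_def)
  have t_mono: "t n i \<le> t n j" if "1 \<le> n" "i \<le> j" for n i j
    unfolding t_def by (rule spline_grid.t_mono [OF spline_grid_sigma_algebra [OF \<F> [OF that(1)]] that(2)])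
  have t_less: "t n i < t n (i + d + 1)" if "1 \<le> n" "i < grid_size (\<F> n) + d" for n i
    unfolding t_def by (rule spline_grid.support_nonempty [OF spline_grid_sigma_algebra [OF \<F> [OF that(1)]] that(2)])
  have t_mem: "t n i \<in> endpoints (\<F> n)" if "1 \<le> n" for n i
    unfolding t_def grid_pt_image [OF \<F> [OF that], symmetric]
    by (rule knot_in_grid [OF spline_grid_sigma_algebra [OF \<F> [OF that]]])
  have t_surj: "\<exists>j. y = t n j" if n: "1 \<le> n" and y: "y \<in> endpoints (\<F> n)" for n y
  proof -
    obtain r where r: "r \<le> grid_size (\<F> n)" "y = grid_pt (\<F> n) r"
      using y unfolding grid_pt_image [OF \<F> [OF n], symmetric] by auto
    have "y = t n (r + d)"
      unfolding t_def r(2) by (rule spline_grid.t_shift [OF spline_grid_sigma_algebra [OF \<F> [OF n]] r(1), symmetric])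
    then show ?thesis ..
  qed
  have t01: "0 \<le> t n i" "t n i \<le> 1" if n: "1 \<le> n" for n i
  proof -
    obtain A where A: "A \<in> atoms (\<F> n)" "t n i = Inf A \<or> t n i = Sup A" using t_mem [OF n, of i] by blast
    show "0 \<le> t n i" "t n i \<le> 1" using atom_between_endpoints(1,4,5) [OF \<F> [OF n] A(1)] A(2) by auto
  qed
  have between: "j \<in> {i + 1..i + d}" if "1 \<le> n" "t n i < t n j" "t n j < t n (i + d + 1)" for n i j
  proof -
    have "\<not> j \<le> i" "\<not> i + d + 1 \<le> j" using t_mono [OF that(1), of j i] t_mono [OF that(1), of "i + d + 1" j] that by auto
    then show ?thesis by auto
  qed

  have tiles: "tile_system Tiles fst (\<lambda>T. t (fst T) (snd T)) (\<lambda>T. t (fst T) (snd T + d + 1)) (\<lambda>n. endpoints (\<F> n)) d N"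
  proof (unfold_locales, fold E_def)
    show "finite Tiles" unfolding Tiles_def by (intro finite_SigmaI) auto
    show "fst T \<in> {1..N}" if "T \<in> Tiles" for T by (rule TilesD(1) [OF that])
    show "endpoints (\<F> (fst T)) \<subseteq> endpoints (\<F> (fst T'))" if "T \<in> Tiles" "T' \<in> Tiles" "fst T \<le> fst T'" for T T'
      using TilesD(2) [OF that(1)] TilesD(2) [OF that(2)] that(3) by (intro endpoints_mono \<F> mono)
    show "finite (endpoints (\<F> (fst T)))" if "T \<in> Tiles" for T
      using interval_sigma_algebra_atoms(1) [OF \<F> [OF TilesD(2) [OF that]]] by simp
    show "t (fst T) (snd T) \<in> endpoints (\<F> (fst T)) \<and> t (fst T) (snd T + d + 1) \<in> endpoints (\<F> (fst T))" if "T \<in> Tiles" for T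
      using t_mem [OF TilesD(2) [OF that]] by blast
    show "card (endpoints (\<F> (fst T)) \<inter> E (fst T) (snd T)) \<le> d" if T: "T \<in> Tiles" for T
    proof -
      have "endpoints (\<F> (fst T)) \<inter> E (fst T) (snd T) \<subseteq> t (fst T) ` {snd T + 1..snd T + d}"
      proof
        fix y assume y: "y \<in> endpoints (\<F> (fst T)) \<inter> E (fst T) (snd T)"
        then obtain j where j: "y = t (fst T) j" using t_surj [OF TilesD(2) [OF T]] by blast
        have "j \<in> {snd T + 1..snd T + d}" using y j unfolding E_def by (intro between [OF TilesD(2) [OF T]]) auto
        then show "y \<in> t (fst T) ` {snd T + 1..snd T + d}" using j by blast
      qed
      then have "card (endpoints (\<F> (fst T)) \<inter> E (fst T) (snd T)) \<le> card (t (fst T) ` {snd T + 1..snd T + d})"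
        by (intro card_mono) auto
      also have "\<dots> \<le> card {snd T + 1..snd T + d}" by (rule card_image_le) simp
      finally show ?thesis by simp
    qed
    show "card {T \<in> Tiles. fst T = n \<and> x \<in> E (fst T) (snd T)} \<le> d + 1" for n x
    proof (cases "{T \<in> Tiles. fst T = n \<and> x \<in> E (fst T) (snd T)} = {}")
      case False
      define S where "S = {T \<in> Tiles. fst T = n \<and> x \<in> E (fst T) (snd T)}"
      have S: "T \<in> Tiles" "fst T = n" "t n (snd T) < x" "x < t n (snd T + d + 1)" if "T \<in> S" for T
        using that by (auto simp: S_def E_def)
      have ne: "S \<noteq> {}" using False by (simp only: S_def not_False_eq_True)
      define i0 where "i0 = (LEAST i. i \<in> snd ` S)"
      obtain T1 where "T1 \<in> S" using ne by blast
      then have "snd T1 \<in> snd ` S" by (rule imageI)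
      then have "i0 \<in> snd ` S" unfolding i0_def by (rule LeastI)
      then obtain T0 where T0: "T0 \<in> S" "snd T0 = i0" by auto
      have n1: "1 \<le> n" using TilesD(2) [OF S(1) [OF T0(1)]] S(2) [OF T0(1)] by simp
      have "S \<subseteq> Pair n ` {i0..i0 + d}"
      proof
        fix T assume T: "T \<in> S"
        have "i0 \<le> snd T" unfolding i0_def by (rule Least_le) (rule imageI [OF T])
        moreover have "\<not> i0 + d + 1 \<le> snd T"
          using t_mono [OF n1, of "i0 + d + 1" "snd T"] S(4) [OF T0(1)] S(3) [OF T] T0(2) by auto
        ultimately show "T \<in> Pair n ` {i0..i0 + d}" using S(2) [OF T] by (intro image_eqI [of _ _ "snd T"]) (auto simp: prod_eq_iff)
      qed
      then have "card S \<le> card (Pair n ` {i0..i0 + d})" by (intro card_mono) auto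
      also have "\<dots> \<le> d + 1" using card_image_le [of "{i0..i0 + d}" "Pair n"] by simp
      finally show ?thesis unfolding S_def .
    next
      case True
      then show ?thesis by (simp only: card.empty)
    qed
  qed

  have E_sets: "E n i \<in> sets \<mu>01" "measure \<mu>01 (E n i) = t n (i + d + 1) - t n i" if n: "1 \<le> n" for n i
  proof -
    have sub: "E n i \<subseteq> {0..1}" using t01 [OF n, of i] t01 [OF n, of "i + d + 1"] by (auto simp: E_def)
    then show "E n i \<in> sets \<mu>01" by (subst sets_restrict_space_iff) (auto simp: E_def)
    show "measure \<mu>01 (E n i) = t n (i + d + 1) - t n i"
      using sub t_mono [OF n, of i "i + d + 1"] by (subst measure_restrict_space) (auto simp: E_def)
  qed
  have G_sets: "G n i \<in> sets \<mu>01" "measure \<mu>01 (G n i) = measure lebesgue (G n i)"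
    if n: "n \<in> {1..N}" "i < grid_size (\<F> n) + d" "a n i \<noteq> 0" for n i
  proof -
    have "E n i \<subseteq> {0..1}" using n t01 [of n i] t01 [of n "i + d + 1"] by (auto simp: E_def)
    then have sub: "G n i \<subseteq> {0..1}" using aG'(2) [OF n] by blast
    then show "G n i \<in> sets \<mu>01" using aG'(1) [OF n] by (subst sets_restrict_space_iff) (auto dest: fmeasurableD)
    show "measure \<mu>01 (G n i) = measure lebesgue (G n i)" using sub by (subst measure_restrict_space) auto
  qed

  interpret tile_system Tiles fst "\<lambda>T. t (fst T) (snd T)" "\<lambda>T. t (fst T) (snd T + d + 1)" "\<lambda>n. endpoints (\<F> n)" d N
    by (rule tiles)
  have "(\<Sum>n=1..N. \<integral>\<^sup>+x. ennreal \<bar>f n x * h n x\<bar> \<partial>\<mu>01)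
    \<le> ennreal ((\<epsilon> * sqrt B) * ((real d + 1) * \<kappa> ^ 3 + 4 * \<kappa> * (real d + 1) ^ 3)) * (\<integral>\<^sup>+x. ennreal (square_fn f N x) \<partial>\<mu>01)"
  proof (rule tile_square_function_inequality [where G = "\<lambda>T. G (fst T) (snd T)" and \<alpha> = "\<lambda>T. a (fst T) (snd T)"])
    show "finite_measure \<mu>01" by (rule finite_measure_\<mu>01)
    show "0 < \<kappa>" "0 < \<epsilon> * sqrt B" using \<kappa> \<epsilon> B by auto
    show "f n \<in> borel_measurable \<mu>01" "h n \<in> borel_measurable \<mu>01" if "n \<in> {1..N}" for n
      using spline_bounded_measurable [OF \<F> [of n] f [of n]] h [of n] that by (auto simp: bounded_measurable_def)
    show "AE x in \<mu>01. \<bar>f n x\<bar> \<le> (\<Sum>T\<in>{T \<in> Tiles. fst T = n}. a (fst T) (snd T) * indicator (tile T) x)" if n: "n \<in> {1..N}" for n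
      using fa [OF n]
    proof eventually_elim
      case (elim x)
      have "(\<Sum>i<grid_size (\<F> n) + d. a n i * indicator (E n i) x)
          = (\<Sum>i\<in>{i. i < grid_size (\<F> n) + d \<and> a n i \<noteq> 0}. a n i * indicator (E n i) x)"
        by (rule sum.mono_neutral_right) auto
      also have "\<dots> = (\<Sum>T\<in>{T \<in> Tiles. fst T = n}. a (fst T) (snd T) * indicator (tile T) x)"
        by (rule sum.reindex_bij_witness [where i = snd and j = "Pair n"]) (use n in \<open>auto simp: Tiles_def E_def\<close>)
      finally show ?case using elim by simp
    qed
    fix T assume T: "T \<in> Tiles"
    note TD = TilesD [OF T] and TD' = TilesD(1,3,4) [OF T]
    have tileE: "tile T = E (fst T) (snd T)" by (simp add: E_def)
    show "tile T \<in> sets \<mu>01" unfolding tileE by (rule E_sets(1) [OF TD(2)])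
    show "G (fst T) (snd T) \<in> sets \<mu>01" by (rule G_sets(1) [OF TD'])
    show "G (fst T) (snd T) \<subseteq> tile T" unfolding tileE by (rule aG'(2) [OF TD'])
    show "0 < a (fst T) (snd T)" using a0 [OF TD(1), of "snd T"] TD(4) by simp
    show "0 < measure \<mu>01 (tile T)" unfolding tileE E_sets(2) [OF TD(2)] using t_less [OF TD(2,3)] by simp
    show "measure \<mu>01 (tile T) \<le> \<kappa> * measure \<mu>01 (G (fst T) (snd T))"
      unfolding tileE E_sets(2) [OF TD(2)] G_sets(2) [OF TD']
      by (rule order_trans [OF aG'(3) [OF TD'] mult_right_mono [OF K\<kappa>(2)]]) simp
    show "a (fst T) (snd T) \<le> \<kappa> * \<bar>f (fst T) x\<bar>" if "x \<in> G (fst T) (snd T)" for x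
      by (rule order_trans [OF aG'(4) [OF TD' that] mult_right_mono [OF K\<kappa>(1)]]) simp
    let ?H = "\<lambda>x. \<Sum>l=fst T..N. (h l x)\<^sup>2"
    have "(\<integral>\<^sup>+x. (\<Sum>l\<in>{fst T..N}. ennreal ((h l x)\<^sup>2)) * indicator (tile T) x \<partial>\<mu>01)
        = (\<integral>\<^sup>+x. ennreal (?H x) * indicator (tile T) x \<partial>\<mu>01)" by simp
    also have "\<dots> \<le> ennreal (\<epsilon>\<^sup>2 * ((2 * real d + 1) * \<gamma> ^ d * (t (fst T) (snd T + d + 1) - t (fst T) (snd T))))"
      unfolding t_def
      by (rule support_carleson_bound [OF \<F> [OF TD(2)] TD(3) reg [OF TD(2)] _ proj [OF TD(1)]]) (auto intro: sum_nonneg)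
    also have "\<dots> = ennreal ((\<epsilon> * sqrt B)\<^sup>2 * measure \<mu>01 (tile T))"
      unfolding tileE E_sets(2) [OF TD(2)] using B by (simp add: power_mult_distrib B_def mult.assoc)
    also have "\<dots> = ennreal ((\<epsilon> * sqrt B)\<^sup>2) * emeasure \<mu>01 (tile T)"
      unfolding finite_measure.emeasure_eq_measure [OF finite_measure_\<mu>01] by (intro ennreal_mult') simp
    finally show "(\<integral>\<^sup>+x. (\<Sum>l\<in>{fst T..N}. ennreal ((h l x)\<^sup>2)) * indicator (tile T) x \<partial>\<mu>01)
      \<le> ennreal ((\<epsilon> * sqrt B)\<^sup>2) * emeasure \<mu>01 (tile T)" .
  qed
  then show ?thesis by simp
qed

theorem theorem3p6:
  fixes k :: nat and \<gamma> :: real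
  assumes "k \<ge> 1"
  shows "\<exists>C::real. C > 0 \<and>
    (\<forall>(\<F> :: nat \<Rightarrow> real set set) (f :: nat \<Rightarrow> real \<Rightarrow> real) (h :: nat \<Rightarrow> real \<Rightarrow> real).
       interval_filtration \<F> \<longrightarrow>
       bdd_above ((\<lambda>n. regularity k (\<F> n)) ` {1..}) \<longrightarrow>
       (SUP n\<in>{1..}. regularity k (\<F> n)) = \<gamma> \<longrightarrow>
       (\<forall>n\<ge>1. f n \<in> spline_space k (\<F> n)) \<longrightarrow>
       (\<forall>n\<ge>1. integrable (lebesgue_on {0..1}) (h n)) \<longrightarrow>
       (\<forall>N\<ge>1.
          (\<Sum>n=1..N. \<integral>\<^sup>+x. ennreal \<bar>f n x * h n x\<bar> \<partial>lebesgue_on {0..1})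
          \<le> ennreal C
             * (\<integral>\<^sup>+x. ennreal (sqrt (\<Sum>l=1..N. (f l x)\<^sup>2)) \<partial>lebesgue_on {0..1})
             * (SUP n\<in>{1..N}. ennreal_sqrt
                  (spline_proj_norm k (\<F> n) (\<lambda>x. \<Sum>l=n..N. (h l x)\<^sup>2)))))"
proof -
  obtain d where k: "k = Suc d" using assms by (cases k) auto
  define \<kappa> where "\<kappa> = max (2 * (real d + 1)) (2 * spline_grid.stability_const d)"
  define B where "B = (2 * real d + 1) * (max 1 \<gamma>) ^ d"
  define C where "C = sqrt B * ((real d + 1) * \<kappa> ^ 3 + 4 * \<kappa> * (real d + 1) ^ 3)"
  have B: "0 < B" by (simp add: B_def)
  have \<kappa>: "0 < \<kappa>" by (simp add: \<kappa>_def)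
  have C: "0 < C" using B \<kappa> by (simp add: C_def add_pos_pos)
  show ?thesis
  proof (intro exI [of _ C] conjI allI impI)
    fix \<F> :: "nat \<Rightarrow> real set set" and f h :: "nat \<Rightarrow> real \<Rightarrow> real" and N :: nat
    assume filt: "interval_filtration \<F>" and bdd: "bdd_above ((\<lambda>n. regularity k (\<F> n)) ` {1..})"
      and sup: "(SUP n\<in>{1..}. regularity k (\<F> n)) = \<gamma>" and f: "\<forall>n\<ge>1. f n \<in> spline_space k (\<F> n)"
      and h: "\<forall>n\<ge>1. integrable \<mu>01 (h n)" and N: "1 \<le> N"
    have reg: "regularity k (\<F> n) \<le> max 1 \<gamma>" if "1 \<le> n" for n
    proof -
      have "regularity k (\<F> n) \<le> \<gamma>" unfolding sup [symmetric] using that by (intro cSUP_upper bdd) simp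
      then show ?thesis by simp
    qed
    let ?LHS = "\<Sum>n=1..N. \<integral>\<^sup>+x. ennreal \<bar>f n x * h n x\<bar> \<partial>\<mu>01"
    let ?p = "\<lambda>n. spline_proj_norm k (\<F> n) (\<lambda>x. \<Sum>l=n..N. (h l x)\<^sup>2)"
    define I where "I = (\<integral>\<^sup>+x. ennreal (square_fn f N x) \<partial>\<mu>01)"
    define S where "S = (SUP n\<in>{1..N}. ennreal_sqrt (?p n))"
    have f_meas: "f n \<in> bounded_measurable" if "1 \<le> n" for n
      using filt f that by (intro spline_bounded_measurable [of "\<F> n"]) (auto simp: interval_filtration_def)
    \<comment> \<open>Arbitrary \<open>\<epsilon>\<close> above the supremum: the weight in the inequality between the means must be
      positive, also if the supremum is \<open>0\<close>. That case follows by \<open>\<epsilon> \<longrightarrow> 0\<close>, as \<open>I\<close> is finite.\<close>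
    have main: "?LHS \<le> ennreal (\<epsilon> * C) * I" if \<epsilon>: "0 < \<epsilon>" "S \<le> ennreal \<epsilon>" for \<epsilon>
    proof -
      have "?p n \<le> ennreal (\<epsilon>\<^sup>2)" if n: "n \<in> {1..N}" for n
      proof (rule le_square_of_ennreal_sqrt_le)
        have "ennreal_sqrt (?p n) \<le> S" unfolding S_def using n by (rule SUP_upper)
        then show "ennreal_sqrt (?p n) \<le> ennreal \<epsilon>" using \<epsilon>(2) by (rule order_trans)
      qed (use \<epsilon> in simp)
      then have "?LHS \<le> ennreal (\<epsilon> * sqrt B * ((real d + 1) * \<kappa> ^ 3 + 4 * \<kappa> * (real d + 1) ^ 3)) * I"
        unfolding I_def \<kappa>_def B_def using filt reg f h \<epsilon>(1) unfolding k by (intro inequality_of_projection_bound) auto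
      then show ?thesis by (simp add: C_def mult.assoc)
    qed
    have I_fin: "I < \<infinity>"
    proof -
      have "I \<le> (\<integral>\<^sup>+x. (\<Sum>l=1..N. ennreal \<bar>f l x\<bar>) \<partial>\<mu>01)" unfolding I_def
      proof (rule nn_integral_mono)
        fix x
        have "square_fn f N x \<le> (\<Sum>l=1..N. \<bar>f l x\<bar>)"
          unfolding square_fn_def using L2_set_le_sum_abs [of "\<lambda>l. f l x" "{1..N}"] by (simp add: L2_set_def)
        then show "ennreal (square_fn f N x) \<le> (\<Sum>l=1..N. ennreal \<bar>f l x\<bar>)" by (simp add: ennreal_leI)
      qed
      also have "\<dots> = (\<Sum>l=1..N. \<integral>\<^sup>+x. ennreal \<bar>f l x\<bar> \<partial>\<mu>01)"
      proof (rule nn_integral_sum)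
        fix l assume "l \<in> {1..N}"
        then have [measurable]: "f l \<in> borel_measurable \<mu>01" using f_meas [of l] by (simp add: bounded_measurable_def)
        show "(\<lambda>x. ennreal \<bar>f l x\<bar>) \<in> borel_measurable \<mu>01" by measurable
      qed
      also have "\<dots> < \<infinity>"
      proof -
        have "(\<integral>\<^sup>+x. ennreal \<bar>f l x\<bar> \<partial>\<mu>01) < \<infinity>" if "l \<in> {1..N}" for l
          using integrable_bounded_measurable [OF f_meas, of l] that by (simp add: integrable_iff_bounded)
        then show ?thesis by simp
      qed
      finally show ?thesis .
    qed
    then obtain J where J: "I = ennreal J" "0 \<le> J" by (cases I) auto
    have "?LHS \<le> ennreal C * I * S"
    proof (cases S)
      \<comment> \<open>The product with \<open>\<infinity>\<close> is \<open>\<infinity>\<close> unless \<open>I = 0\<close>, and then all \<open>f n\<close> vanish almost everywhere.\<close>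
      case top
      show ?thesis
      proof (cases "I = 0")
        case False
        then show ?thesis using top C by (simp add: ennreal_mult_top)
      next
        case True
        have X_meas: "square_fn f N \<in> borel_measurable \<mu>01"
        proof -
          have "f l \<in> borel_measurable \<mu>01" if "l \<in> {1..N}" for l using f_meas [of l] that by (simp add: bounded_measurable_def)
          then show ?thesis unfolding square_fn_def by measurable
        qed
        have "AE x in \<mu>01. ennreal (square_fn f N x) = 0"
          using True X_meas unfolding I_def by (subst (asm) nn_integral_0_iff_AE) auto
        then have zero: "AE x in \<mu>01. square_fn f N x \<le> 0" by eventually_elim (simp add: ennreal_eq_0_iff)
        have "(\<integral>\<^sup>+x. ennreal \<bar>f n x * h n x\<bar> \<partial>\<mu>01) = (\<integral>\<^sup>+x. 0 \<partial>\<mu>01)" if n: "n \<in> {1..N}" for n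
        proof (rule nn_integral_cong_AE, use zero in eventually_elim)
          case (elim x)
          have "\<bar>f n x\<bar> \<le> square_fn f N x"
            using abs_le_square_fn [of n f x] square_fn_mono [of n N f x] n by auto
          then have "\<bar>f n x\<bar> \<le> 0" using elim by linarith
          then show ?case by simp
        qed
        then have "?LHS = 0" by simp
        then show ?thesis by simp
      qed
    next
      case (real r)
      show ?thesis
      proof (cases "r = 0")
        case False
        then have "?LHS \<le> ennreal (r * C) * I" using real by (intro main) auto
        also have "\<dots> = ennreal C * I * S" using real C by (simp add: ennreal_mult' mult_ac)
        finally show ?thesis .
      next
        case True
        have "?LHS \<le> ennreal \<delta>" if \<delta>: "0 < \<delta>" for \<delta>
        proof -
          have "?LHS \<le> ennreal (\<delta> / (J + 1) / C * C) * I"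
            using \<delta> C J real True by (intro main) auto
          also have "\<dots> = ennreal (\<delta> / (J + 1) / C * C * J)"
            unfolding J(1) using \<delta> C J(2) by (intro ennreal_mult' [symmetric]) auto
          also have "\<delta> / (J + 1) / C * C * J = \<delta> * (J / (J + 1))" using C by simp
          also have "ennreal (\<delta> * (J / (J + 1))) \<le> ennreal \<delta>"
            using \<delta> J(2) by (intro ennreal_leI mult_left_le) auto
          finally show ?thesis .
        qed
        then have le: "?LHS \<le> 0 + ennreal \<delta>" if "0 < \<delta>" for \<delta> using that by (simp only: add_0)
        have "?LHS \<le> 0" by (rule ennreal_le_epsilon) (rule le)
        then show ?thesis by simp
      qed
    qed
    then show "?LHS \<le> ennreal C * (\<integral>\<^sup>+x. ennreal (sqrt (\<Sum>l=1..N. (f l x)\<^sup>2)) \<partial>\<mu>01) * (SUP n\<in>{1..N}. ennreal_sqrt (?p n))"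
      unfolding I_def S_def square_fn_def .
  qed (rule C)
qed

end
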